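(* Let $d,p\in\mathbb{N}$ (both $\ge 1$), $\mu\in\mathbb{R}$ and $T>0$. Let $r>d/2$ and $0<\gamma\le 1$. Assume that the exact solution $u$ of the nonlinear Schr\"odinger equation $$i\partial_t u(t,x)=-\Delta u(t,x)+\mu|u(t,x)|^{2p}u(t,x),\qquad (t,x)\in\mathbb{R}\times\mathbb{T}^d,$$ satisfies $u(t)\in H^{r+\gamma}(\mathbb{T}^d)$ for $0\le t\le T$. For a step size $\tau>0$ let $t_n=n\tau$, $u^0=u(0)$ and $$u^{n+1}=\mathrm{e}^{i\tau\Delta}\left[u^n-i\mu\tau\,\big(u^n\big)^{p+1}\Big(\varphi_1(-2i\tau\Delta)\big(\overline{u^n}\big)^{p}\Big)\right],\qquad n\ge 0.$$ Then there exists a constant $\tau_0>0$ such that for all step sizes $\tau\le\tau_0$ and all $t_n\le T$, $$\Vert u(t_n)-u^n\Vert_r\le c\,\tau^\gamma,$$ where $c$ depends on $\sup_{0\le t\le T}\Vert u(t)\Vert_{r+\gamma}$.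
   Context: $\mathbb{T}^d$ is the $d$-dimensional torus (period $2\pi$ in each coordinate), functions are complex-valued with Fourier expansion $f(x)=\sum_{\mathbf{k}\in\mathbb{Z}^d}\hat f_{\mathbf{k}}\mathrm{e}^{i\mathbf{k}\cdot\mathbf{x}}$, and $\Delta=\sum_{k=1}^d\partial_{x_k}^2$. $\Vert\cdot\Vert_r$ denotes the standard Sobolev norm of $H^r=H^r(\mathbb{T}^d)$, $\Vert f\Vert_r^2=\sum_{\mathbf{k}}(1+|\mathbf{k}|)^{2r}|\hat f_{\mathbf{k}}|^2$. Functions of $\Delta$ act as Fourier multipliers: $\mathrm{e}^{it\Delta}$ multiplies $\hat f_{\mathbf{k}}$ by $\mathrm{e}^{-it|\mathbf{k}|^2}$. With $\varphi_1(z)=(\mathrm{e}^z-1)/z$, extended by $\varphi_1(0)=1$, the operator $\varphi_1(-2i\tau\Delta)$ multiplies $\hat f_{\mathbf{k}}$ by $\varphi_1(2i\tau|\mathbf{k}|^2)$. The exact solution is understood in the mild sense, $$u(t)=\mathrm{e}^{it\Delta}u(0)-i\mu\int_0^t\mathrm{e}^{i(t-s)\Delta}\big(|u(s)|^{2p}u(s)\big)\mathrm{d}s,$$ with finite supremum $\sup_{0\le t\le T}\Vert u(t)\Vert_{r+\gamma}$. The constant $c$ may additionally depend on $r,d,p,\gamma,\mu,T$, but neither $c$ nor $\tau_0$ depends on $\tau$ or $n$. *)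

theory Defs
  imports "HOL-Analysis.Analysis"
begin

text \<open>
  Functions on the \<open>d\<close>-dimensional torus are functions on \<open>real ^ 'd\<close>, with \<open>d = CARD('d)\<close>, that
  have period \<open>2 * pi\<close> in each coordinate. Elements of \<open>L\<^sup>2\<close> and of the Sobolev spaces are
  represented by functions; the definitions do not depend on the choice of the representative
  up to null sets.
\<close>

definition torus_periodic :: "(real ^ 'd \<Rightarrow> 'b) \<Rightarrow> bool" where
  "torus_periodic f \<longleftrightarrow> (\<forall>x j. f (x + axis j (2 * pi)) = f x)"

definition torus_cell :: "(real ^ 'd) set" where
  "torus_cell = cbox 0 (\<chi> j. 2 * pi)"

definition freq :: "int ^ 'd \<Rightarrow> real ^ 'd" where
  "freq k = (\<chi> j. real_of_int (k $ j))"

definition fourier_coeff :: "(real ^ 'd \<Rightarrow> complex) \<Rightarrow> int ^ 'd \<Rightarrow> complex" where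
  "fourier_coeff f k =
     integral torus_cell (\<lambda>x. f x * cis (- (freq k \<bullet> x))) / of_real ((2 * pi) ^ CARD('d))"

definition L2_torus :: "(real ^ 'd \<Rightarrow> complex) set" where
  "L2_torus = {f. torus_periodic f \<and> f \<in> borel_measurable lebesgue \<and>
     (\<lambda>x. (cmod (f x))\<^sup>2) absolutely_integrable_on torus_cell}"

text \<open>The following two notions are meant for \<open>r \<ge> 0\<close>, where the Sobolev space is contained in
  \<open>L\<^sup>2\<close>. The norm is meaningful for elements of the space only: a divergent \<open>infsum\<close> is 0.\<close>

definition sobolev :: "real \<Rightarrow> (real ^ 'd \<Rightarrow> complex) set" where
  "sobolev r = {f \<in> L2_torus.
     (\<lambda>k. (1 + norm (freq k)) powr (2 * r) * (cmod (fourier_coeff f k))\<^sup>2) summable_on UNIV}"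

definition sobolev_norm :: "real \<Rightarrow> (real ^ 'd \<Rightarrow> complex) \<Rightarrow> real" where
  "sobolev_norm r f =
     sqrt (\<Sum>\<^sub>\<infinity>k. (1 + norm (freq k)) powr (2 * r) * (cmod (fourier_coeff f k))\<^sup>2)"

text \<open>The operator \<open>F(\<Delta>)\<close>, where \<open>\<Delta>\<close> has the symbol \<open>- |k|\<^sup>2\<close>. The Fourier series on the right
  converges absolutely if \<open>F\<close> is bounded on the symbols and \<open>f\<close> lies in the Sobolev space of
  some order \<open>r > d / 2\<close>; its sum is then the continuous representative of \<open>F(\<Delta>) f\<close>.\<close>

definition laplace_fun ::
    "(complex \<Rightarrow> complex) \<Rightarrow> (real ^ 'd \<Rightarrow> complex) \<Rightarrow> real ^ 'd \<Rightarrow> complex" where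
  "laplace_fun F f x =
     (\<Sum>\<^sub>\<infinity>k. F (of_real (- (norm (freq k))\<^sup>2)) * fourier_coeff f k * cis (freq k \<bullet> x))"

definition free_flow :: "real \<Rightarrow> (real ^ 'd \<Rightarrow> complex) \<Rightarrow> real ^ 'd \<Rightarrow> complex" where
  "free_flow t = laplace_fun (\<lambda>z. exp (\<i> * of_real t * z))"

definition phi1 :: "complex \<Rightarrow> complex" where
  "phi1 z = (if z = 0 then 1 else (exp z - 1) / z)"

definition nls_nonlinearity :: "nat \<Rightarrow> (real ^ 'd \<Rightarrow> complex) \<Rightarrow> real ^ 'd \<Rightarrow> complex" where
  "nls_nonlinearity p v x = of_real (cmod (v x) ^ (2 * p)) * v x"

text \<open>Mild solutions on \<open>[0, T]\<close> with values in the Sobolev space of order \<open>\<sigma>\<close>, bounded in its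
  norm. For \<open>\<sigma> > d / 2\<close> point evaluation is a continuous linear functional on that space, so the
  vector-valued integral in Duhamel's formula may be evaluated pointwise in \<open>x\<close>; the formula is an
  identity of functions modulo null sets. No continuity in time is required, only
  that the integral exists.\<close>

definition mild_nls_solution ::
    "nat \<Rightarrow> real \<Rightarrow> real \<Rightarrow> real \<Rightarrow> (real \<Rightarrow> real ^ 'd \<Rightarrow> complex) \<Rightarrow> bool" where
  "mild_nls_solution p \<mu> \<sigma> T u \<longleftrightarrow>
     (\<forall>t\<in>{0..T}. u t \<in> sobolev \<sigma>) \<and>
     bdd_above ((\<lambda>t. sobolev_norm \<sigma> (u t)) ` {0..T}) \<and>
     (\<forall>t\<in>{0..T}.
        (\<forall>x. (\<lambda>s. free_flow (t - s) (nls_nonlinearity p (u s)) x) absolutely_integrable_on {0..t}) \<and>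
        (AE x in lebesgue.
           u t x = free_flow t (u 0) x
             - \<i> * of_real \<mu> * integral {0..t} (\<lambda>s. free_flow (t - s) (nls_nonlinearity p (u s)) x)))"

definition integrator_step ::
    "nat \<Rightarrow> real \<Rightarrow> real \<Rightarrow> (real ^ 'd \<Rightarrow> complex) \<Rightarrow> real ^ 'd \<Rightarrow> complex" where
  "integrator_step p \<mu> \<tau> v =
     free_flow \<tau> (\<lambda>x. v x - \<i> * of_real \<mu> * of_real \<tau> * v x ^ (p + 1) *
       laplace_fun (\<lambda>z. phi1 (- 2 * \<i> * of_real \<tau> * z)) (\<lambda>y. cnj (v y) ^ p) x)"

primrec integrator ::
    "nat \<Rightarrow> real \<Rightarrow> real \<Rightarrow> (real ^ 'd \<Rightarrow> complex) \<Rightarrow> nat \<Rightarrow> real ^ 'd \<Rightarrow> complex" where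
  "integrator p \<mu> \<tau> v 0 = v"
| "integrator p \<mu> \<tau> v (Suc n) = integrator_step p \<mu> \<tau> (integrator p \<mu> \<tau> v n)"

end

theory Submission
  imports Defs
begin

text \<open>
  On the level of Fourier coefficients the \<open>H\<^sup>r\<close> norm is a weighted \<open>\<ell>\<^sup>2\<close> norm. For \<open>r > d / 2\<close> such
  sequences are absolutely summable, the functions are continuous up to null sets, and \<open>H\<^sup>r\<close> is an
  algebra. Hence the nonlinearity is locally Lipschitz, and so is one step of the integrator, with a
  constant \<open>1 + L \<tau>\<close> (\<open>sobolev_le_integrator_step_diff\<close>), since the free flow is an isometry.

  The order of convergence comes from one estimate (\<open>sobolev_le_free_flow_mult\<close>): the free flow
  \<open>e\<^sup>i\<^sup>s\<^sup>\<Delta>\<close> of a product differs from the product of the free flows only by the phase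
  \<open>2 s (k - l) \<bullet> l\<close> of each pair of frequencies. Since \<open>|e\<^sup>i\<^sup>\<theta> - 1| \<le> 2 |\<theta>|\<^sup>\<gamma>\<close>, the difference is
  \<open>O(|s|\<^sup>\<gamma>)\<close> in \<open>H\<^sup>r\<close> if each factor has \<open>\<gamma>\<close> additional derivatives. Applied repeatedly, it shows that
  the integrand \<open>e\<^sup>-\<^sup>i\<^sup>s\<^sup>\<Delta>(|w|\<^sup>2\<^sup>pw)\<close> of Duhamel's formula along a free solution \<open>w = e\<^sup>i\<^sup>s\<^sup>\<Delta>v\<close> is
  \<open>v\<^sup>p\<^sup>+\<^sup>1 e\<^sup>-\<^sup>2\<^sup>i\<^sup>s\<^sup>\<Delta>(cnj v)\<^sup>p\<close> up to \<open>O(s\<^sup>\<gamma>)\<close> (\<open>sobolev_le_frozen_nonlinearity\<close>). The integral of the latter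
  is the nonlinear part of the integrator. As the solution itself stays \<open>O(s)\<close>-close to the free flow,
  the local error is \<open>O(\<tau>\<^sup>1\<^sup>+\<^sup>\<gamma>)\<close> (\<open>local_error\<close>). Stability sums up the local errors to
  \<open>O(\<tau>\<^sup>\<gamma>)\<close>; for small \<open>\<tau>\<close> this bound is at most 1, which keeps the numerical solution in the ball
  where the Lipschitz constant is valid.

  The passage from functions to coefficients rests on the uniqueness theorem for multiple Fourier
  series (\<open>fourier_uniqueness\<close>) and on Fubini's theorem for Duhamel's formula, which is given
  pointwise in space (\<open>fourier_coeff_integral\<close>).
\<close>

section \<open>Frequency weights\<close>

definition weight :: "int ^ 'd \<Rightarrow> real" where
  "weight k = 1 + norm (freq k)"

lemma freq_add: "freq (k + l) = freq k + freq l"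
  and freq_diff: "freq (k - l) = freq k - freq l"
  and freq_minus: "freq (- k) = - freq k"
  and freq_zero: "freq 0 = 0"
  by (simp_all add: freq_def vec_eq_iff)

lemma weight_ge_1: "weight k \<ge> 1" and weight_pos [simp]: "weight k > 0"
  by (simp_all add: weight_def add_pos_nonneg)

lemma weight_nonzero [simp]: "weight k \<noteq> 0" and weight_nonneg [simp]: "0 \<le> weight k"
  using weight_pos[of k] by linarith+

lemma weight_uminus: "weight (- k) = weight k"
  by (simp add: weight_def freq_minus)

lemma weight_triangle: "weight k \<le> weight (k - l) + weight l"
  using norm_triangle_ineq[of "freq (k - l)" "freq l"]
  by (simp add: weight_def freq_diff)

lemma weight_powr_triangle:
  assumes "r \<ge> 0"
  shows "weight k powr r \<le> 2 powr r * (weight (k - l) powr r + weight l powr r)"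
proof -
  let ?m = "max (weight (k - l)) (weight l)"
  have "weight k powr r \<le> (2 * ?m) powr r"
    using assms weight_triangle[of k l] weight_pos[of k] by (intro powr_mono2) (auto simp: less_imp_le)
  also have "\<dots> = 2 powr r * ?m powr r"
    by (subst powr_mult) auto
  also have "?m powr r \<le> weight (k - l) powr r + weight l powr r"
    by (auto simp: max_def)
  finally show ?thesis by simp
qed

text \<open>The one-dimensional case: each absolute value is taken by at most two integers.\<close>

lemma summable_int_weight:
  assumes "q > 1"
  shows "(\<lambda>n::int. (1 + real_of_int \<bar>n\<bar>) powr - q) summable_on UNIV"
proof (rule nonneg_bdd_above_summable_on)
  let ?f = "\<lambda>m::nat. (1 + real m) powr - q"
  have "summable (\<lambda>n. real n powr - q)"
    using assms by (simp add: summable_real_powr_iff)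
  then have s: "summable ?f"
    using summable_Suc_iff[of "\<lambda>n. real n powr - q"] by (simp add: add.commute)
  show "bdd_above (sum (\<lambda>n::int. (1 + real_of_int \<bar>n\<bar>) powr - q) ` {F. F \<subseteq> UNIV \<and> finite F})"
  proof (rule bdd_aboveI2)
    fix F :: "int set" assume "F \<in> {F. F \<subseteq> UNIV \<and> finite F}"
    then have F: "finite F" by simp
    define S where "S = (\<lambda>n. nat \<bar>n\<bar>) ` F"
    have S: "finite S" using F by (simp add: S_def)
    have "F \<subseteq> int ` S \<union> (\<lambda>m. - int m) ` S"
    proof
      fix n assume "n \<in> F"
      then have "nat \<bar>n\<bar> \<in> S" by (simp add: S_def)
      moreover have "n = int (nat \<bar>n\<bar>) \<or> n = - int (nat \<bar>n\<bar>)" by linarith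
      ultimately show "n \<in> int ` S \<union> (\<lambda>m. - int m) ` S" by blast
    qed
    then have "(\<Sum>n\<in>F. (1 + real_of_int \<bar>n\<bar>) powr - q)
        \<le> (\<Sum>n\<in>int ` S \<union> (\<lambda>m. - int m) ` S. (1 + real_of_int \<bar>n\<bar>) powr - q)"
      using S by (intro sum_mono2) auto
    also have "\<dots> \<le> (\<Sum>n\<in>int ` S. (1 + real_of_int \<bar>n\<bar>) powr - q)
        + (\<Sum>n\<in>(\<lambda>m. - int m) ` S. (1 + real_of_int \<bar>n\<bar>) powr - q)"
      using S by (subst sum.union_inter[symmetric]) (auto intro!: sum_nonneg)
    also have "\<dots> = 2 * (\<Sum>m\<in>S. ?f m)"
      by (subst (1 2) sum.reindex) (auto simp: inj_on_def)
    also have "\<dots> \<le> 2 * suminf ?f"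
      using S s by (intro mult_left_mono sum_le_suminf) auto
    finally show "(\<Sum>n\<in>F. (1 + real_of_int \<bar>n\<bar>) powr - q) \<le> 2 * suminf ?f" .
  qed
qed simp

text \<open>Since \<open>1 + |k| \<ge> 1 + |k\<^sub>j|\<close> for each of the \<open>d\<close> coordinates, the weight is bounded below by the
  geometric mean of the one-dimensional weights, so that the sum is dominated by a product of
  one-dimensional sums with exponent \<open>2 r / d > 1\<close>.\<close>

lemma summable_weight:
  assumes "r > real CARD('d::finite) / 2"
  shows "(\<lambda>k::int ^ 'd. weight k powr (- 2 * r)) summable_on UNIV"
proof (rule nonneg_bdd_above_summable_on)
  define q where "q = 2 * r / real CARD('d)"
  have q: "q > 1" using assms by (simp add: q_def field_simps)
  define f where "f = (\<lambda>n::int. (1 + real_of_int \<bar>n\<bar>) powr - q)"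
  have f0: "f n \<ge> 0" for n by (simp add: f_def)
  have sf: "f summable_on UNIV" unfolding f_def by (rule summable_int_weight[OF q])
  have le: "weight k powr (- 2 * r) \<le> (\<Prod>j\<in>UNIV. f (k $ j))" for k :: "int ^ 'd"
  proof -
    have "(\<Prod>j\<in>(UNIV :: 'd set). weight k powr - q) \<le> (\<Prod>j\<in>UNIV. f (k $ j))"
    proof (rule prod_mono)
      fix j :: 'd
      have "1 + real_of_int \<bar>k $ j\<bar> \<le> weight k"
        using component_le_norm_cart[of "freq k" j] by (simp add: weight_def freq_def)
      then show "0 \<le> weight k powr - q \<and> weight k powr - q \<le> f (k $ j)"
        unfolding f_def using q by (auto intro!: powr_mono2')
    qed
    also have "(\<Prod>j\<in>(UNIV :: 'd set). weight k powr - q) = weight k powr (- 2 * r)"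
      using powr_power[of "weight k" "- q" "CARD('d)"] by (simp add: q_def)
    finally show ?thesis .
  qed
  show "bdd_above (sum (\<lambda>k::int ^ 'd. weight k powr (- 2 * r)) ` {F. F \<subseteq> UNIV \<and> finite F})"
  proof (rule bdd_aboveI2)
    fix F :: "(int ^ 'd) set" assume "F \<in> {F. F \<subseteq> UNIV \<and> finite F}"
    then have F: "finite F" by simp
    define S where "S = (\<lambda>(k, j). k $ j) ` (F \<times> UNIV)"
    have S: "finite S" using F by (simp add: S_def)
    have inj: "inj_on ($) F" by (rule inj_onI) (simp add: vec_eq_iff)
    have sub: "($) ` F \<subseteq> PiE UNIV (\<lambda>_. S)" by (force simp: S_def)
    have "(\<Sum>k\<in>F. weight k powr (- 2 * r)) \<le> (\<Sum>k\<in>F. \<Prod>j\<in>UNIV. f (k $ j))"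
      by (intro sum_mono le)
    also have "\<dots> = (\<Sum>g\<in>($) ` F. \<Prod>j\<in>UNIV. f (g j))"
      by (subst sum.reindex[OF inj]) simp
    also have "\<dots> \<le> (\<Sum>g\<in>PiE UNIV (\<lambda>_. S). \<Prod>j\<in>(UNIV :: 'd set). f (g j))"
      using sub S f0 by (intro sum_mono2 finite_PiE prod_nonneg) auto
    also have "\<dots> = (\<Prod>j\<in>(UNIV :: 'd set). \<Sum>n\<in>S. f n)"
      using S by (subst prod_sum_PiE) auto
    also have "\<dots> \<le> (\<Prod>j\<in>(UNIV :: 'd set). infsum f UNIV)"
      using S f0 sf by (intro prod_mono conjI sum_nonneg finite_sum_le_infsum) auto
    finally show "(\<Sum>k\<in>F. weight k powr (- 2 * r)) \<le> (\<Prod>j\<in>(UNIV :: 'd set). infsum f UNIV)" .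
  qed
qed simp

section \<open>Weighted square-summable sequences\<close>

text \<open>The bound and the summability that makes it meaningful are kept together in one predicate
  on finite partial sums; it is closed under pointwise limits.\<close>

definition weighted_l2_le :: "real \<Rightarrow> real \<Rightarrow> (int ^ 'd \<Rightarrow> complex) \<Rightarrow> bool" where
  "weighted_l2_le r B a \<longleftrightarrow> (\<forall>K. finite K \<longrightarrow> L2_set (\<lambda>k. weight k powr r * cmod (a k)) K \<le> B)"

lemma weighted_l2_leI:
  "(\<And>K. finite K \<Longrightarrow> L2_set (\<lambda>k. weight k powr r * cmod (a k)) K \<le> B) \<Longrightarrow> weighted_l2_le r B a"
  by (simp add: weighted_l2_le_def)

lemma weighted_l2_leD:
  "weighted_l2_le r B a \<Longrightarrow> finite K \<Longrightarrow> L2_set (\<lambda>k. weight k powr r * cmod (a k)) K \<le> B"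
  by (simp add: weighted_l2_le_def)

lemma weighted_l2_le_nonneg: "weighted_l2_le r B a \<Longrightarrow> 0 \<le> B"
  using weighted_l2_leD[of r B a "{}"] by simp

lemma weighted_l2_le_mono: "weighted_l2_le r B a \<Longrightarrow> B \<le> B' \<Longrightarrow> weighted_l2_le r B' a"
  by (meson order_trans weighted_l2_le_def)

lemma weighted_l2_le_dominated:
  assumes "weighted_l2_le r B a"
    and "\<And>k. weight k powr r' * cmod (b k) \<le> weight k powr r * cmod (a k)"
  shows "weighted_l2_le r' B b"
proof (rule weighted_l2_leI)
  fix K :: "(int ^ 'a) set" assume K: "finite K"
  have "L2_set (\<lambda>k. weight k powr r' * cmod (b k)) K \<le> L2_set (\<lambda>k. weight k powr r * cmod (a k)) K"
    by (intro L2_set_mono assms(2)) auto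
  also have "\<dots> \<le> B" by (rule weighted_l2_leD[OF assms(1) K])
  finally show "L2_set (\<lambda>k. weight k powr r' * cmod (b k)) K \<le> B" .
qed

lemma weighted_l2_le_multiplier:
  assumes "weighted_l2_le r B a" and "\<And>k. cmod (m k) \<le> 1"
  shows "weighted_l2_le r B (\<lambda>k. m k * a k)"
  by (rule weighted_l2_le_dominated[OF assms(1)])
    (use assms(2) in \<open>auto simp: norm_mult intro!: mult_left_mono mult_left_le_one_le\<close>)

lemma weighted_l2_le_order:
  assumes "weighted_l2_le r B a" and "r' \<le> r"
  shows "weighted_l2_le r' B a"
  by (rule weighted_l2_le_dominated[OF assms(1)])
    (use assms(2) weight_ge_1 in \<open>auto intro!: mult_right_mono powr_mono\<close>)

lemma weighted_l2_le_add:
  assumes "weighted_l2_le r A a" and "weighted_l2_le r B b"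
  shows "weighted_l2_le r (A + B) (\<lambda>k. a k + b k)"
proof (rule weighted_l2_leI)
  fix K :: "(int ^ 'a) set" assume K: "finite K"
  have "L2_set (\<lambda>k. weight k powr r * cmod (a k + b k)) K
      \<le> L2_set (\<lambda>k. weight k powr r * cmod (a k) + weight k powr r * cmod (b k)) K"
    by (intro L2_set_mono) (auto simp: distrib_left[symmetric] intro!: mult_left_mono norm_triangle_ineq)
  also have "\<dots> \<le> L2_set (\<lambda>k. weight k powr r * cmod (a k)) K + L2_set (\<lambda>k. weight k powr r * cmod (b k)) K"
    by (rule L2_set_triangle_ineq)
  also have "\<dots> \<le> A + B"
    by (intro add_mono weighted_l2_leD assms K)
  finally show "L2_set (\<lambda>k. weight k powr r * cmod (a k + b k)) K \<le> A + B" .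
qed

lemma weighted_l2_le_cmult:
  assumes "weighted_l2_le r A a"
  shows "weighted_l2_le r (cmod c * A) (\<lambda>k. c * a k)"
proof (rule weighted_l2_leI)
  fix K :: "(int ^ 'a) set" assume K: "finite K"
  have "L2_set (\<lambda>k. weight k powr r * cmod (c * a k)) K = cmod c * L2_set (\<lambda>k. weight k powr r * cmod (a k)) K"
    by (subst L2_set_right_distrib) (auto simp: norm_mult mult_ac)
  also have "\<dots> \<le> cmod c * A" by (intro mult_left_mono weighted_l2_leD assms K) auto
  finally show "L2_set (\<lambda>k. weight k powr r * cmod (c * a k)) K \<le> cmod c * A" .
qed

lemma weighted_l2_le_reflect:
  assumes "weighted_l2_le r A a"
  shows "weighted_l2_le r A (\<lambda>k. cnj (a (- k)))"
proof (rule weighted_l2_leI)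
  fix K :: "(int ^ 'a) set" assume K: "finite K"
  have "L2_set (\<lambda>k. weight k powr r * cmod (cnj (a (- k)))) K = L2_set (\<lambda>k. weight k powr r * cmod (a k)) (uminus ` K)"
    unfolding L2_set_def by (subst sum.reindex) (auto simp: weight_uminus)
  also have "\<dots> \<le> A" using assms K by (intro weighted_l2_leD) auto
  finally show "L2_set (\<lambda>k. weight k powr r * cmod (cnj (a (- k)))) K \<le> A" .
qed

lemma weighted_l2_le_component:
  assumes "weighted_l2_le r B a"
  shows "weight k powr r * cmod (a k) \<le> B"
  using weighted_l2_leD[OF assms, of "{k}"] by simp

lemma weighted_l2_le_iff:
  "weighted_l2_le r B a \<longleftrightarrow> 0 \<le> B \<and>
     (\<lambda>k. weight k powr (2 * r) * (cmod (a k))\<^sup>2) summable_on UNIV \<and>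
     sqrt (\<Sum>\<^sub>\<infinity>k. weight k powr (2 * r) * (cmod (a k))\<^sup>2) \<le> B" (is "?L \<longleftrightarrow> ?R")
proof -
  let ?g = "\<lambda>k. weight k powr (2 * r) * (cmod (a k))\<^sup>2"
  have sq: "(weight k powr r * cmod (a k))\<^sup>2 = ?g k" for k
    by (simp add: power_mult_distrib powr_powr powr_realpow[symmetric] mult.commute flip: powr_numeral)
  have L2: "L2_set (\<lambda>k. weight k powr r * cmod (a k)) K = sqrt (sum ?g K)" for K
    unfolding L2_set_def by (simp add: sq)
  show ?thesis
  proof
    assume L: ?L
    then have B: "0 \<le> B" by (rule weighted_l2_le_nonneg)
    have le: "sum ?g K \<le> B\<^sup>2" if "finite K" for K
    proof -
      have "sqrt (sum ?g K) \<le> B" using weighted_l2_leD[OF L that] by (simp only: L2)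
      then show ?thesis by (simp add: real_le_lsqrt sqrt_le_D)
    qed
    have s: "?g summable_on UNIV"
      by (rule nonneg_bdd_above_summable_on) (auto intro!: bdd_aboveI2 le)
    moreover have "infsum ?g UNIV \<le> B\<^sup>2"
      by (rule infsum_le_finite_sums[OF s le])
    ultimately show ?R using B by (simp add: real_le_lsqrt infsum_nonneg)
  next
    assume R: ?R
    show ?L
    proof (rule weighted_l2_leI)
      fix K :: "(int ^ 'a) set" assume K: "finite K"
      have "sum ?g K \<le> infsum ?g UNIV" using R K by (intro finite_sum_le_infsum) auto
      then show "L2_set (\<lambda>k. weight k powr r * cmod (a k)) K \<le> B"
        unfolding L2 using R by (meson order_trans real_sqrt_le_iff)
    qed
  qed
qed

text \<open>The embedding of weighted \<open>\<ell>\<^sup>2\<close> in \<open>\<ell>\<^sup>1\<close>, by the Cauchy-Schwarz inequality against the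
  square-summable sequence \<open>(1 + |k|)\<^sup>-\<^sup>r\<close>.\<close>

lemma weighted_l2_le_abs_sum:
  assumes "r > real CARD('d::finite) / 2"
  obtains C where "C \<ge> 0"
    and "\<And>B (a :: int ^ 'd \<Rightarrow> complex). weighted_l2_le r B a \<Longrightarrow> (\<lambda>k. cmod (a k)) summable_on UNIV"
    and "\<And>B (a :: int ^ 'd \<Rightarrow> complex). weighted_l2_le r B a \<Longrightarrow> (\<Sum>\<^sub>\<infinity>k. cmod (a k)) \<le> C * B"
proof
  let ?s = "\<Sum>\<^sub>\<infinity>k::int ^ 'd. weight k powr (- 2 * r)"
  show "0 \<le> sqrt ?s" by (simp add: infsum_nonneg)
  have fin: "(\<Sum>k\<in>K. cmod (a k)) \<le> sqrt ?s * B"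
    if "weighted_l2_le r B a" "finite K" for B K and a :: "int ^ 'd \<Rightarrow> complex"
  proof -
    have "(\<Sum>k\<in>K. cmod (a k)) = (\<Sum>k\<in>K. \<bar>weight k powr - r\<bar> * \<bar>weight k powr r * cmod (a k)\<bar>)"
      by (simp add: abs_mult powr_minus field_simps)
    also have "\<dots> \<le> L2_set (\<lambda>k. weight k powr - r) K * L2_set (\<lambda>k. weight k powr r * cmod (a k)) K"
      by (rule L2_set_mult_ineq)
    also have "\<dots> \<le> sqrt ?s * B"
    proof (intro mult_mono weighted_l2_leD that)
      have "(\<Sum>k\<in>K. weight k powr (- 2 * r)) \<le> ?s"
        using summable_weight[OF assms] that(2) by (intro finite_sum_le_infsum) auto
      then show "L2_set (\<lambda>k. weight k powr - r) K \<le> sqrt ?s"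
        unfolding L2_set_def by (simp add: powr_power mult.commute)
    qed (simp_all add: infsum_nonneg)
    finally show ?thesis .
  qed
  show s: "(\<lambda>k. cmod (a k)) summable_on UNIV" if "weighted_l2_le r B a" for B and a :: "int ^ 'd \<Rightarrow> complex"
    by (rule nonneg_bdd_above_summable_on) (auto intro!: bdd_aboveI2 fin[OF that])
  show "(\<Sum>\<^sub>\<infinity>k. cmod (a k)) \<le> sqrt ?s * B"
    if "weighted_l2_le r B a" for B and a :: "int ^ 'd \<Rightarrow> complex"
    by (rule infsum_le_finite_sums[OF s[OF that] fin[OF that]])
qed

text \<open>Fatou's lemma for the weighted norm: each finite partial sum passes to the limit.\<close>

lemma weighted_l2_le_limit:
  assumes "F \<noteq> bot" and "\<And>k. ((\<lambda>x. a x k) \<longlongrightarrow> b k) F" and "\<forall>\<^sub>F x in F. weighted_l2_le r B (a x)"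
  shows "weighted_l2_le r B b"
proof (rule weighted_l2_leI)
  fix K :: "(int ^ 'b) set" assume K: "finite K"
  have "((\<lambda>x. L2_set (\<lambda>k. weight k powr r * cmod (a x k)) K) \<longlongrightarrow> L2_set (\<lambda>k. weight k powr r * cmod (b k)) K) F"
    unfolding L2_set_def by (intro tendsto_intros assms(2))
  moreover have "\<forall>\<^sub>F x in F. L2_set (\<lambda>k. weight k powr r * cmod (a x k)) K \<le> B"
    using assms(3) by eventually_elim (rule weighted_l2_leD[OF _ K])
  ultimately show "L2_set (\<lambda>k. weight k powr r * cmod (b k)) K \<le> B"
    by (rule tendsto_upperbound[OF _ _ assms(1)])
qed

lemma weighted_l2_le_sum:
  assumes "finite L" and "\<And>l. l \<in> L \<Longrightarrow> weighted_l2_le r (B l) (a l)"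
  shows "weighted_l2_le r (sum B L) (\<lambda>k. \<Sum>l\<in>L. a l k)"
  using assms
proof (induction L rule: finite_induct)
  case empty
  show ?case by (rule weighted_l2_leI) (simp add: L2_set_def)
qed (auto intro: weighted_l2_le_add)

text \<open>Young's inequality \<open>\<ell>\<^sup>2 * \<ell>\<^sup>1 \<subseteq> \<ell>\<^sup>2\<close>: the convolution is a superposition of translates.\<close>

lemma young_l2_l1:
  assumes a: "weighted_l2_le 0 A a" and b: "(\<lambda>k. cmod (b k)) summable_on UNIV" and S: "(\<Sum>\<^sub>\<infinity>l. cmod (b l)) \<le> S"
  shows "weighted_l2_le 0 (A * S) (\<lambda>k. \<Sum>\<^sub>\<infinity>l. a (k - l) * b l)"
    and "(\<lambda>l. cmod (a (k - l) * b l)) summable_on UNIV"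
proof -
  have A: "0 \<le> A" by (rule weighted_l2_le_nonneg[OF a])
  have a_le: "cmod (a k) \<le> A" for k using weighted_l2_le_component[OF a, of k] by simp
  show s: "(\<lambda>l. cmod (a (k - l) * b l)) summable_on UNIV" for k
    by (rule summable_on_comparison_test[OF summable_on_cmult_right[OF b, of A]])
      (auto simp: norm_mult intro!: mult_right_mono a_le)
  have translate: "weighted_l2_le 0 A (\<lambda>k. a (k - l))" for l
  proof (rule weighted_l2_leI)
    fix K :: "(int ^ 'a) set" assume K: "finite K"
    have "L2_set (\<lambda>k. weight k powr 0 * cmod (a (k - l))) K
        = L2_set (\<lambda>k. weight k powr 0 * cmod (a k)) ((\<lambda>k. k - l) ` K)"
      unfolding L2_set_def by (subst sum.reindex) auto
    also have "\<dots> \<le> A" using K by (intro weighted_l2_leD[OF a]) auto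
    finally show "L2_set (\<lambda>k. weight k powr 0 * cmod (a (k - l))) K \<le> A" .
  qed
  show "weighted_l2_le 0 (A * S) (\<lambda>k. \<Sum>\<^sub>\<infinity>l. a (k - l) * b l)"
  proof (rule weighted_l2_le_limit[where F = "finite_subsets_at_top UNIV"
          and a = "\<lambda>L k. \<Sum>l\<in>L. a (k - l) * b l"])
    show "((\<lambda>L. \<Sum>l\<in>L. a (k - l) * b l) \<longlongrightarrow> (\<Sum>\<^sub>\<infinity>l. a (k - l) * b l)) (finite_subsets_at_top UNIV)" for k
      by (rule infsum_tendsto[OF abs_summable_summable[OF s]])
    have "weighted_l2_le 0 (A * S) (\<lambda>k. \<Sum>l\<in>L. a (k - l) * b l)" if L: "finite L" for L
    proof (rule weighted_l2_le_mono)
      show "weighted_l2_le 0 (\<Sum>l\<in>L. cmod (b l) * A) (\<lambda>k. \<Sum>l\<in>L. a (k - l) * b l)"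
        by (rule weighted_l2_le_sum[OF L])
          (use weighted_l2_le_cmult[OF translate] in \<open>simp add: mult.commute\<close>)
      have "(\<Sum>l\<in>L. cmod (b l)) \<le> (\<Sum>\<^sub>\<infinity>l. cmod (b l))"
        using b L by (intro finite_sum_le_infsum) auto
      then have "(\<Sum>l\<in>L. cmod (b l)) * A \<le> S * A" using A S by (intro mult_right_mono) auto
      then show "(\<Sum>l\<in>L. cmod (b l) * A) \<le> A * S"
        by (simp only: sum_distrib_right mult.commute[of S])
    qed
    then show "\<forall>\<^sub>F L in finite_subsets_at_top UNIV. weighted_l2_le 0 (A * S) (\<lambda>k. \<Sum>l\<in>L. a (k - l) * b l)"
      by (intro eventually_finite_subsets_at_top_weakI) auto
  qed simp
qed

lemma infsum_flip:
  fixes f :: "'a::ab_group_add \<Rightarrow> 'b::{comm_monoid_add,t2_space}"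
  shows "(\<Sum>\<^sub>\<infinity>l. f (k - l)) = (\<Sum>\<^sub>\<infinity>l. f l)"
  by (rule infsum_reindex_bij_witness[of _ "\<lambda>l. k - l" "\<lambda>l. k - l"]) auto

lemma summable_on_flip:
  fixes f :: "'a::ab_group_add \<Rightarrow> 'b::{comm_monoid_add,t2_space}"
  shows "(\<lambda>l. f (k - l)) summable_on UNIV \<longleftrightarrow> f summable_on UNIV"
  by (rule summable_on_reindex_bij_witness[of _ "\<lambda>l. k - l" "\<lambda>l. k - l"]) auto

text \<open>The algebra property of \<open>H\<^sup>r\<close> for \<open>r > d / 2\<close>, in terms of an arbitrary sequence dominated by a
  convolution, so that it also serves for products with a modified symbol.
  By the triangle inequality for the weights one of the two factors carries the
  weight; the other is absolutely summable, and Young's inequality applies.\<close>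

lemma weighted_l2_le_convolution:
  assumes r: "r > real CARD('d::finite) / 2"
  obtains C where "C > 0"
    and "\<And>A B a b (c :: int ^ 'd \<Rightarrow> complex). weighted_l2_le r A a \<Longrightarrow> weighted_l2_le r B b \<Longrightarrow>
      (\<And>k. cmod (c k) \<le> (\<Sum>\<^sub>\<infinity>l. cmod (a (k - l)) * cmod (b l))) \<Longrightarrow> weighted_l2_le r (C * A * B) c"
proof -
  have r0: "r \<ge> 0" using r by (meson divide_nonneg_nonneg of_nat_0_le_iff order_trans less_imp_le zero_le_numeral)
  obtain C where C: "C \<ge> 0"
    and sum: "\<And>B (a :: int ^ 'd \<Rightarrow> complex). weighted_l2_le r B a \<Longrightarrow> (\<lambda>k. cmod (a k)) summable_on UNIV"
    and le: "\<And>B (a :: int ^ 'd \<Rightarrow> complex). weighted_l2_le r B a \<Longrightarrow> (\<Sum>\<^sub>\<infinity>k. cmod (a k)) \<le> C * B"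
    using weighted_l2_le_abs_sum[OF r] by blast
  show ?thesis
  proof (rule that)
    show "2 powr r * (2 * C) + 1 > 0" using C by (simp add: add_nonneg_pos)
    fix A B :: real and a b c :: "int ^ 'd \<Rightarrow> complex"
    assume a: "weighted_l2_le r A a" and b: "weighted_l2_le r B b"
      and c: "\<And>k. cmod (c k) \<le> (\<Sum>\<^sub>\<infinity>l. cmod (a (k - l)) * cmod (b l))"
    define w :: "(int ^ 'd \<Rightarrow> complex) \<Rightarrow> int ^ 'd \<Rightarrow> complex"
      where "w f k = of_real (weight k powr r * cmod (f k))" for f k
    define v :: "(int ^ 'd \<Rightarrow> complex) \<Rightarrow> int ^ 'd \<Rightarrow> complex"
      where "v f k = of_real (cmod (f k))" for f k
    have w: "weighted_l2_le 0 A (w a)" "weighted_l2_le 0 B (w b)"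
      by (auto intro!: weighted_l2_le_dominated[OF a] weighted_l2_le_dominated[OF b] simp: w_def norm_mult)
    have v: "(\<lambda>k. cmod (v f k)) summable_on UNIV" "(\<Sum>\<^sub>\<infinity>k. cmod (v f k)) \<le> C * D" if "weighted_l2_le r D f" for f D
      using sum[OF that] le[OF that] by (simp_all add: v_def)
    let ?X = "\<lambda>k. \<Sum>\<^sub>\<infinity>l. w a (k - l) * v b l" and ?Y = "\<lambda>k. \<Sum>\<^sub>\<infinity>l. w b (k - l) * v a l"
    note yX = young_l2_l1[OF w(1) v[OF b]] and yY = young_l2_l1[OF w(2) v[OF a]]
    have XY: "weighted_l2_le 0 (2 powr r * (A * (C * B) + B * (C * A))) (\<lambda>k. 2 powr r * (?X k + ?Y k))"
      using weighted_l2_le_cmult[OF weighted_l2_le_add[OF yX(1) yY(1)], of "2 powr r"]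
      by (simp add: powr_of_real[of 2 r, simplified])
    have sX: "(\<lambda>l. weight (k - l) powr r * cmod (a (k - l)) * cmod (b l)) summable_on UNIV" for k
      using yX(2)[of k] by (simp add: w_def v_def norm_mult)
    have sY: "(\<lambda>l. weight l powr r * cmod (a (k - l)) * cmod (b l)) summable_on UNIV" for k
      using yY(2)[of k] summable_on_flip[of "\<lambda>l. cmod (w b (k - l) * v a l)" k] 
      by (simp add: w_def v_def norm_mult mult_ac)
    have of_real: "(\<Sum>\<^sub>\<infinity>l. complex_of_real (f l)) = of_real (\<Sum>\<^sub>\<infinity>l. f l)" if "f summable_on UNIV" for f :: "int ^ 'd \<Rightarrow> real"
      by (rule infsumI[OF has_sum_of_real[OF has_sum_infsum[OF that]]])
    have Xr: "?X k = of_real (\<Sum>\<^sub>\<infinity>l. weight (k - l) powr r * cmod (a (k - l)) * cmod (b l))" for k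
      by (simp add: w_def v_def flip: of_real[OF sX])
    have Yr: "?Y k = of_real (\<Sum>\<^sub>\<infinity>l. weight l powr r * cmod (a (k - l)) * cmod (b l))" for k
      using infsum_flip[of "\<lambda>l. w b (k - l) * v a l" k]
      by (simp add: w_def v_def mult_ac flip: of_real[OF sY[simplified mult_ac]])
    show "weighted_l2_le r ((2 powr r * (2 * C) + 1) * A * B) c"
    proof (rule weighted_l2_le_mono)
      show "weighted_l2_le r (2 powr r * (A * (C * B) + B * (C * A))) c"
      proof (rule weighted_l2_le_dominated[OF XY])
        fix k
        have s1: "(\<lambda>l. 2 powr r * (weight (k - l) powr r * cmod (a (k - l)) * cmod (b l)
              + weight l powr r * cmod (a (k - l)) * cmod (b l))) summable_on UNIV"
          by (intro summable_on_cmult_right summable_on_add sX sY)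
        have le1: "weight k powr r * (cmod (a (k - l)) * cmod (b l)) \<le>
             2 powr r * (weight (k - l) powr r * cmod (a (k - l)) * cmod (b l)
              + weight l powr r * cmod (a (k - l)) * cmod (b l))" for l
          using mult_right_mono[OF weight_powr_triangle[OF r0, of k l], of "cmod (a (k - l)) * cmod (b l)"]
          by (simp add: algebra_simps)
        have "weight k powr r * cmod (c k) \<le> weight k powr r * (\<Sum>\<^sub>\<infinity>l. cmod (a (k - l)) * cmod (b l))"
          by (intro mult_left_mono c) auto
        also have "\<dots> = (\<Sum>\<^sub>\<infinity>l. weight k powr r * (cmod (a (k - l)) * cmod (b l)))"
          by (simp add: infsum_cmult_right')
        also have "\<dots> \<le> (\<Sum>\<^sub>\<infinity>l. 2 powr r * (weight (k - l) powr r * cmod (a (k - l)) * cmod (b l)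
              + weight l powr r * cmod (a (k - l)) * cmod (b l)))"
          by (intro infsum_mono le1 s1 summable_on_comparison_test[OF s1 le1]) auto
        also have "\<dots> = 2 powr r * ((\<Sum>\<^sub>\<infinity>l. weight (k - l) powr r * cmod (a (k - l)) * cmod (b l))
              + (\<Sum>\<^sub>\<infinity>l. weight l powr r * cmod (a (k - l)) * cmod (b l)))"
          by (simp add: infsum_cmult_right' infsum_add[OF sX sY])
        also have "\<dots> = cmod (2 powr r * (?X k + ?Y k))"
        proof -
          have "0 \<le> (\<Sum>\<^sub>\<infinity>l. weight (k - l) powr r * cmod (a (k - l)) * cmod (b l))
              + (\<Sum>\<^sub>\<infinity>l. weight l powr r * cmod (a (k - l)) * cmod (b l))"
            by (intro add_nonneg_nonneg infsum_nonneg) auto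
          then show ?thesis unfolding Xr Yr norm_mult
            by (simp add: powr_of_real[of 2 r, simplified] flip: of_real_add)
        qed
        finally show "weight k powr r * cmod (c k) \<le> weight k powr 0 * cmod (2 powr r * (?X k + ?Y k))"
          by simp
      qed
      show "2 powr r * (A * (C * B) + B * (C * A)) \<le> (2 powr r * (2 * C) + 1) * A * B"
        using weighted_l2_le_nonneg[OF a] weighted_l2_le_nonneg[OF b] by (simp add: algebra_simps)
    qed
  qed
qed

section \<open>Absolutely convergent Fourier series\<close>

lemma
  fixes f :: "'i \<Rightarrow> 'b::euclidean_space \<Rightarrow> 'c::banach"
  assumes "\<And>k x. norm (f k x) \<le> M k" and "M summable_on UNIV"
    and cont: "\<And>k. continuous_on UNIV (f k)"
  shows continuous_on_infsum: "continuous_on UNIV (\<lambda>x. \<Sum>\<^sub>\<infinity>k. f k x)"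
    and has_integral_infsum:
      "((\<lambda>x. \<Sum>\<^sub>\<infinity>k. f k x) has_integral (\<Sum>\<^sub>\<infinity>k. integral (cbox a b) (f k))) (cbox a b)"
proof -
  have lim: "uniform_limit S (\<lambda>K x. \<Sum>k\<in>K. f k x) (\<lambda>x. \<Sum>\<^sub>\<infinity>k. f k x) (finite_subsets_at_top UNIV)" for S
    using assms(1,2) by (intro Weierstrass_m_test_general) auto
  have c: "continuous_on S (\<lambda>x. \<Sum>k\<in>K. f k x)" for S K
    by (intro continuous_intros continuous_on_subset[OF cont]) auto
  show "continuous_on UNIV (\<lambda>x. \<Sum>\<^sub>\<infinity>k. f k x)"
    by (rule uniform_limit_theorem[OF _ lim]) (auto intro: c)
  obtain I J where I: "\<And>K. ((\<lambda>x. \<Sum>k\<in>K. f k x) has_integral I K) (cbox a b)"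
    and J: "((\<lambda>x. \<Sum>\<^sub>\<infinity>k. f k x) has_integral J) (cbox a b)"
    and IJ: "(I \<longlongrightarrow> J) (finite_subsets_at_top UNIV)"
    using uniform_limit_integral_cbox[OF lim c finite_subsets_at_top_neq_bot] by metis
  have "I K = (\<Sum>k\<in>K. integral (cbox a b) (f k))" if "finite K" for K
  proof -
    have "((\<lambda>x. \<Sum>k\<in>K. f k x) has_integral (\<Sum>k\<in>K. integral (cbox a b) (f k))) (cbox a b)"
      using that by (intro has_integral_sum integrable_integral integrable_continuous
          continuous_on_subset[OF cont]) auto
    then show ?thesis using I has_integral_unique by blast
  qed
  then have "((\<lambda>k. integral (cbox a b) (f k)) has_sum J) UNIV"
    unfolding has_sum_def using IJ
    by (rule_tac Lim_transform_eventually[OF IJ]) (auto intro!: eventually_finite_subsets_at_top_weakI)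
  then show "((\<lambda>x. \<Sum>\<^sub>\<infinity>k. f k x) has_integral (\<Sum>\<^sub>\<infinity>k. integral (cbox a b) (f k))) (cbox a b)"
    using J by (simp add: infsumI)
qed

lemma continuous_on_character [continuous_intros]:
  "continuous_on S (\<lambda>x. cis (freq k \<bullet> x))"
  by (simp add: cis_conv_exp) (intro continuous_intros)

lemma character_add: "cis (freq (k + l) \<bullet> x) = cis (freq k \<bullet> x) * cis (freq l \<bullet> x)"
  by (simp add: freq_add inner_add_left cis_mult)

lemma character_shift:
  "cis (freq k \<bullet> (x + axis j c)) = cis (freq k \<bullet> x) * cis (real_of_int (k $ j) * c)"
  by (simp add: inner_add_right inner_axis cis_mult freq_def)

lemma torus_periodic_character: "torus_periodic (\<lambda>x. cis (freq k \<bullet> x))"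
  unfolding torus_periodic_def character_shift
  by (simp add: cis_multiple_2pi mult.commute[of _ "2 * pi"])

text \<open>A nontrivial character changes its sign under a translation by half a wavelength along some
  axis, while the integral of a periodic function over a cell is invariant under translations.\<close>

lemma integral_character:
  fixes k :: "int ^ 'd"
  shows "integral torus_cell (\<lambda>x. cis (freq k \<bullet> x)) = (if k = 0 then of_real ((2 * pi) ^ CARD('d)) else 0)"
proof (cases "k = 0")
  case True
  then show ?thesis
    by (simp add: freq_zero torus_cell_def content_cbox_cart interval_ne_empty_cart scaleR_conv_of_real)
next
  case False
  then obtain j where j: "k $ j \<noteq> 0" by (auto simp: vec_eq_iff)
  define f where "f = (\<lambda>x. cis (freq k \<bullet> x))"
  define c where "c = pi / real_of_int \<bar>k $ j\<bar>"
  have kj: "1 \<le> real_of_int \<bar>k $ j\<bar>" using j by linarith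
  then have c: "0 \<le> c" "c \<le> 2 * pi"
    using pi_gt_zero by (auto simp: c_def field_simps intro: order_trans[of pi "2 * pi"])
  define slab :: "real \<Rightarrow> real \<Rightarrow> (real ^ 'd) set" where
    "slab s t = cbox (\<chi> i. if i = j then s else 0) (\<chi> i. if i = j then t else 2 * pi)" for s t
  define J where "J s t = integral (slab s t) f" for s t
  have int: "f integrable_on slab s t" for s t
    unfolding slab_def f_def by (intro integrable_continuous continuous_intros)
  have split: "J s t = J s u + J u t" if "s \<le> u" "u \<le> t" for s t u
  proof -
    have e: "axis j 1 \<in> (Basis :: (real ^ 'd) set)" by (simp add: axis_in_Basis_iff)
    have "slab s t \<inter> {x. x \<bullet> axis j 1 \<le> u} = slab s u" "slab s t \<inter> {x. x \<bullet> axis j 1 \<ge> u} = slab u t"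
      using that by (auto simp: slab_def mem_box_cart inner_axis split: if_splits; metis order_trans)+
    then have "(f has_integral J s u + J u t) (slab s t)"
      unfolding J_def using int e
      by (subst slab_def, intro has_integral_split[where k = "axis j 1" and c = u]) (auto simp: slab_def[symmetric])
    then show ?thesis by (simp add: J_def integral_unique)
  qed
  have shift: "J (s + b) (t + b) = cis (real_of_int (k $ j) * b) * J s t" for s t b
  proof -
    have "(f has_integral J (s + b) (t + b)) (slab (s + b) (t + b))"
      unfolding J_def by (rule integrable_integral[OF int])
    then have "((\<lambda>x. f (1 *\<^sub>R x + axis j b)) has_integral J (s + b) (t + b) /\<^sub>R 1 ^ DIM(real ^ 'd))
        (cbox (((\<chi> i. if i = j then s + b else 0) - axis j b) /\<^sub>R 1) (((\<chi> i. if i = j then t + b else 2 * pi) - axis j b) /\<^sub>R 1))"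
      unfolding slab_def by (rule has_integral_affinity') simp
    moreover have "(\<chi> i. if i = j then s + b else 0) - axis j b = (\<chi> i. if i = j then s else 0)"
      "(\<chi> i. if i = j then t + b else 2 * pi) - axis j b = (\<chi> i. if i = j then t else 2 * pi)"
      by (auto simp: vec_eq_iff axis_def)
    ultimately have "((\<lambda>x. f x * cis (real_of_int (k $ j) * b)) has_integral J (s + b) (t + b)) (slab s t)"
      by (simp add: slab_def f_def character_shift)
    moreover have "((\<lambda>x. f x * cis (real_of_int (k $ j) * b)) has_integral J s t * cis (real_of_int (k $ j) * b)) (slab s t)"
      unfolding J_def by (intro has_integral_mult_left integrable_integral int)
    ultimately show ?thesis using has_integral_unique by (metis mult.commute)
  qed
  have "cis (real_of_int (k $ j) * c) = - 1"
  proof (cases "k $ j > 0")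
    case True then show ?thesis using j by (simp add: c_def)
  next
    case False
    then have "real_of_int (k $ j) * c = - pi" using j by (simp add: c_def field_simps)
    then show ?thesis by (simp add: complex_eq_iff)
  qed
  then have "J c (2 * pi + c) = - J 0 (2 * pi)" using shift[of 0 c "2 * pi"] by simp
  moreover have "J (2 * pi) (2 * pi + c) = J 0 c"
    using shift[of 0 "2 * pi" c] by (simp add: cis_multiple_2pi mult.commute[of _ "2 * pi"] add.commute)
  moreover have "J c (2 * pi + c) = J c (2 * pi) + J (2 * pi) (2 * pi + c)"
    "J 0 (2 * pi) = J 0 c + J c (2 * pi)"
    using c by (auto intro: split)
  ultimately have "2 * J 0 (2 * pi) = 0" by (simp add: algebra_simps)
  then have "J 0 (2 * pi) = 0" by simp
  moreover have "slab 0 (2 * pi) = torus_cell"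
    unfolding slab_def torus_cell_def by (rule arg_cong2[where f = cbox]) (auto simp: vec_eq_iff)
  ultimately show ?thesis using False by (simp add: J_def f_def)
qed

definition fourier_series :: "(int ^ 'd \<Rightarrow> complex) \<Rightarrow> real ^ 'd \<Rightarrow> complex" where
  "fourier_series a x = (\<Sum>\<^sub>\<infinity>k. a k * cis (freq k \<bullet> x))"

abbreviation abs_summable :: "(int ^ 'd \<Rightarrow> complex) \<Rightarrow> bool" where
  "abs_summable a \<equiv> (\<lambda>k. cmod (a k)) summable_on UNIV"

lemma fourier_series_summable:
  assumes "abs_summable a"
  shows "(\<lambda>k. a k * cis (freq k \<bullet> x)) summable_on UNIV"
  by (rule abs_summable_summable) (use assms in \<open>simp add: norm_mult\<close>)

lemma continuous_on_fourier_series: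
  assumes "abs_summable a"
  shows "continuous_on S (fourier_series a)"
proof -
  have "continuous_on UNIV (\<lambda>x. \<Sum>\<^sub>\<infinity>k. a k * cis (freq k \<bullet> x))"
    by (rule continuous_on_infsum[where M = "\<lambda>k. cmod (a k)"])
      (auto simp: norm_mult assms intro!: continuous_intros)
  then show ?thesis unfolding fourier_series_def[abs_def] by (rule continuous_on_subset) auto
qed

lemma norm_fourier_series_le:
  assumes "abs_summable a"
  shows "cmod (fourier_series a x) \<le> (\<Sum>\<^sub>\<infinity>k. cmod (a k))"
  unfolding fourier_series_def
  by (rule norm_infsum_le[OF has_sum_infsum[OF fourier_series_summable[OF assms]] has_sum_infsum[OF assms]])
    (simp add: norm_mult)

lemma torus_periodic_fourier_series: "torus_periodic (fourier_series a)"
  unfolding torus_periodic_def fourier_series_def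
  by (intro allI infsum_cong arg_cong2[where f = "(*)"] refl torus_periodic_character[unfolded torus_periodic_def, rule_format])

lemma fourier_coeff_fourier_series:
  fixes a :: "int ^ 'd \<Rightarrow> complex"
  assumes "abs_summable a"
  shows "fourier_coeff (fourier_series a) = a"
proof
  fix k
  let ?f = "\<lambda>l x. a l * cis (freq (l - k) \<bullet> x)"
  have eq: "fourier_series a x * cis (- (freq k \<bullet> x)) = (\<Sum>\<^sub>\<infinity>l. ?f l x)" for x
    unfolding fourier_series_def
    by (subst infsum_cmult_left'[symmetric]) (simp add: mult.assoc cis_mult freq_diff inner_diff_left)
  have "((\<lambda>x. \<Sum>\<^sub>\<infinity>l. ?f l x) has_integral (\<Sum>\<^sub>\<infinity>l. integral (cbox 0 (\<chi> j. 2 * pi)) (?f l))) (cbox 0 (\<chi> j. 2 * pi))"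
    by (rule has_integral_infsum[where M = "\<lambda>k. cmod (a k)"])
      (auto simp: norm_mult assms intro!: continuous_intros)
  then have "integral torus_cell (\<lambda>x. fourier_series a x * cis (- (freq k \<bullet> x))) = (\<Sum>\<^sub>\<infinity>l. integral torus_cell (?f l))"
    unfolding eq torus_cell_def by (rule integral_unique)
  also have "\<dots> = (\<Sum>\<^sub>\<infinity>l. if l = k then a k * of_real ((2 * pi) ^ CARD('d)) else 0)"
    by (rule infsum_cong) (auto simp: integral_character)
  also have "\<dots> = a k * of_real ((2 * pi) ^ CARD('d))"
    by (subst infsum_cong_neutral[where T = "{k}" and g = "\<lambda>_. a k * of_real ((2 * pi) ^ CARD('d))"]) auto
  finally show "fourier_coeff (fourier_series a) k = a k"
    by (simp add: fourier_coeff_def)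
qed

lemma fourier_series_add:
  assumes "abs_summable a" "abs_summable b"
  shows "fourier_series (\<lambda>k. a k + b k) x = fourier_series a x + fourier_series b x"
  unfolding fourier_series_def using fourier_series_summable[OF assms(1)] fourier_series_summable[OF assms(2)]
  by (subst infsum_add[symmetric]) (auto simp: algebra_simps)

lemma fourier_series_cmult: "fourier_series (\<lambda>k. c * a k) x = c * fourier_series a x"
  unfolding fourier_series_def by (subst infsum_cmult_right'[symmetric]) (simp add: mult.assoc)

lemma fourier_series_cnj: "cnj (fourier_series a x) = fourier_series (\<lambda>k. cnj (a (- k))) x"
proof -
  have "cnj (fourier_series a x) = (\<Sum>\<^sub>\<infinity>k. cnj (a k) * cis (freq (- k) \<bullet> x))"
    by (simp add: fourier_series_def freq_minus cis_cnj flip: infsum_cnj)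
  also have "\<dots> = fourier_series (\<lambda>k. cnj (a (- k))) x"
    unfolding fourier_series_def by (rule infsum_reindex_bij_witness[of _ uminus uminus]) auto
  finally show ?thesis .
qed

lemma laplace_fun_fourier_series:
  assumes "abs_summable a"
  shows "laplace_fun F (fourier_series a) = fourier_series (\<lambda>k. F (of_real (- (norm (freq k))\<^sup>2)) * a k)"
  by (simp add: fun_eq_iff laplace_fun_def fourier_series_def fourier_coeff_fourier_series[OF assms])

definition convolution :: "(int ^ 'd \<Rightarrow> complex) \<Rightarrow> (int ^ 'd \<Rightarrow> complex) \<Rightarrow> int ^ 'd \<Rightarrow> complex" where
  "convolution a b k = (\<Sum>\<^sub>\<infinity>l. a (k - l) * b l)"

text \<open>These sums are rearrangements of the double series of \<open>a k * b l\<close>, which converges absolutely;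
  the shear \<open>(k, l) \<mapsto> (k - l, l)\<close> turns it into the series of convolutions.\<close>

lemma
  assumes a: "abs_summable a" and b: "abs_summable b"
  shows convolution_summable: "(\<lambda>l. a (k - l) * b l) summable_on UNIV"
    and abs_convolution_summable: "(\<lambda>l. cmod (a (k - l)) * cmod (b l)) summable_on UNIV"
    and abs_summable_convolution: "abs_summable (convolution a b)"
    and norm_convolution_le: "cmod (convolution a b k) \<le> (\<Sum>\<^sub>\<infinity>l. cmod (a (k - l)) * cmod (b l))"
    and fourier_series_mult: "fourier_series a x * fourier_series b x = fourier_series (convolution a b) x"
proof -
  have "(\<lambda>(k, l). cmod (a k * b l)) summable_on (UNIV \<times> UNIV)"
  proof (rule summable_on_SigmaI)
    show "((\<lambda>l. case (k, l) of (k, l) \<Rightarrow> cmod (a k * b l)) has_sum cmod (a k) * (\<Sum>\<^sub>\<infinity>l. cmod (b l))) UNIV" for k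
      by (simp add: norm_mult has_sum_cmult_right[OF has_sum_infsum[OF b]])
    show "(\<lambda>k. cmod (a k) * (\<Sum>\<^sub>\<infinity>l. cmod (b l))) summable_on UNIV"
      by (rule summable_on_cmult_left[OF a])
  qed auto
  moreover have "bij_betw (\<lambda>(k, l). (k - l, l)) UNIV (UNIV :: ((int ^ 'a) \<times> (int ^ 'a)) set)"
    by (rule bij_betwI[of _ _ _ "\<lambda>(k, l). (k + l, l)"]) auto
  ultimately have s: "(\<lambda>(k, l). cmod (a (k - l)) * cmod (b l)) summable_on UNIV"
    using summable_on_reindex_bij_betw[of "\<lambda>(k, l). (k - l, l)" UNIV UNIV "\<lambda>(k, l). cmod (a k * b l)"]
    by (simp add: case_prod_unfold norm_mult)
  show s1: "(\<lambda>l. cmod (a (k - l)) * cmod (b l)) summable_on UNIV" for k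
    by (rule summable_on_SigmaD1[where A = UNIV and B = "\<lambda>_. UNIV"]) (use s in auto)
  show s2: "(\<lambda>l. a (k - l) * b l) summable_on UNIV" for k
    by (rule abs_summable_summable) (use s1 in \<open>simp add: norm_mult\<close>)
  show le: "cmod (convolution a b k) \<le> (\<Sum>\<^sub>\<infinity>l. cmod (a (k - l)) * cmod (b l))" for k
    unfolding convolution_def by (rule norm_infsum_le[OF has_sum_infsum[OF s2] has_sum_infsum[OF s1]])
      (simp add: norm_mult)
  have "(\<lambda>k. \<Sum>\<^sub>\<infinity>l. cmod (a (k - l)) * cmod (b l)) summable_on UNIV"
    using summable_on_Sigma_banach[of "\<lambda>k l. cmod (a (k - l)) * cmod (b l)" UNIV "\<lambda>_. UNIV"] s by simp
  then show "abs_summable (convolution a b)"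
    by (rule summable_on_comparison_test) (simp_all add: le)
  let ?g = "\<lambda>(k, l). a (k - l) * b l * cis (freq k \<bullet> x)"
  have g: "?g summable_on UNIV \<times> UNIV"
    by (rule abs_summable_summable) (use s in \<open>simp add: norm_mult case_prod_unfold\<close>)
  have "fourier_series (convolution a b) x = (\<Sum>\<^sub>\<infinity>k. \<Sum>\<^sub>\<infinity>l. ?g (k, l))"
    unfolding fourier_series_def convolution_def by (simp add: infsum_cmult_left')
  also have "\<dots> = (\<Sum>\<^sub>\<infinity>l. \<Sum>\<^sub>\<infinity>k. ?g (k, l))"
    using infsum_swap_banach[where f = "\<lambda>k l. ?g (k, l)"] g by simp
  also have "\<dots> = (\<Sum>\<^sub>\<infinity>l. b l * cis (freq l \<bullet> x) * fourier_series a x)"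
  proof (rule infsum_cong)
    fix l
    have "(\<Sum>\<^sub>\<infinity>k. ?g (k, l)) = (\<Sum>\<^sub>\<infinity>k. a (k - l) * b l * cis (freq (k - l + l) \<bullet> x))" by simp
    also have "\<dots> = (\<Sum>\<^sub>\<infinity>k. a k * b l * cis (freq (k + l) \<bullet> x))"
      by (rule infsum_reindex_bij_witness[of _ "\<lambda>k. k + l" "\<lambda>k. k - l"]) auto
    also have "\<dots> = (\<Sum>\<^sub>\<infinity>k. (b l * cis (freq l \<bullet> x)) * (a k * cis (freq k \<bullet> x)))"
      by (simp only: character_add mult_ac)
    finally show "(\<Sum>\<^sub>\<infinity>k. ?g (k, l)) = b l * cis (freq l \<bullet> x) * fourier_series a x"
      by (simp add: fourier_series_def infsum_cmult_right')
  qed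
  also have "\<dots> = fourier_series b x * fourier_series a x"
    by (simp add: fourier_series_def infsum_cmult_left')
  finally show "fourier_series a x * fourier_series b x = fourier_series (convolution a b) x"
    by simp
qed

section \<open>The algebra of Sobolev functions\<close>

text \<open>The bound \<open>\<parallel>f\<parallel>\<^sub>r \<le> B\<close> for the continuous representative of an element of \<open>H\<^sup>r\<close> whose
  Fourier series converges absolutely.\<close>

definition sobolev_le :: "real \<Rightarrow> real \<Rightarrow> (real ^ 'd \<Rightarrow> complex) \<Rightarrow> bool" where
  "sobolev_le r B f \<longleftrightarrow> (\<exists>a. weighted_l2_le r B a \<and> abs_summable a \<and> f = fourier_series a)"

lemma sobolev_leI:
  assumes "r > real CARD('d::finite) / 2" and "weighted_l2_le r B (a :: int ^ 'd \<Rightarrow> complex)"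
  shows "sobolev_le r B (fourier_series a)"
  using weighted_l2_le_abs_sum[OF assms(1)] assms(2) unfolding sobolev_le_def by metis

lemma sobolev_le_nonneg: "sobolev_le r B f \<Longrightarrow> 0 \<le> B"
  by (auto simp: sobolev_le_def intro: weighted_l2_le_nonneg)

lemma sobolev_le_mono: "sobolev_le r B f \<Longrightarrow> B \<le> B' \<Longrightarrow> sobolev_le r B' f"
  unfolding sobolev_le_def using weighted_l2_le_mono by blast

lemma sobolev_le_order: "sobolev_le r B f \<Longrightarrow> r' \<le> r \<Longrightarrow> sobolev_le r' B f"
  unfolding sobolev_le_def using weighted_l2_le_order by blast

lemma sobolev_le_fourier_coeff:
  assumes "sobolev_le r B f"
  shows "weighted_l2_le r B (fourier_coeff f)" and "abs_summable (fourier_coeff f)"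
    and "fourier_series (fourier_coeff f) = f"
  using assms by (auto simp: sobolev_le_def fourier_coeff_fourier_series)

lemma sobolev_le_add:
  assumes "sobolev_le r A f" and "sobolev_le r B g"
  shows "sobolev_le r (A + B) (\<lambda>x. f x + g x)"
proof -
  obtain a b where *: "weighted_l2_le r A a" "abs_summable a" "f = fourier_series a"
    "weighted_l2_le r B b" "abs_summable b" "g = fourier_series b"
    using assms by (auto simp: sobolev_le_def)
  have "abs_summable (\<lambda>k. a k + b k)"
    by (rule summable_on_comparison_test[OF summable_on_add[OF *(2,5)]]) (auto intro: norm_triangle_ineq)
  then show ?thesis
    unfolding sobolev_le_def using * weighted_l2_le_add[OF *(1,4)] fourier_series_add[OF *(2,5)]
    by (intro exI[of _ "\<lambda>k. a k + b k"]) auto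
qed

lemma sobolev_le_cmult:
  assumes "sobolev_le r A f"
  shows "sobolev_le r (cmod c * A) (\<lambda>x. c * f x)"
proof -
  obtain a where *: "weighted_l2_le r A a" "abs_summable a" "f = fourier_series a"
    using assms by (auto simp: sobolev_le_def)
  then show ?thesis
    unfolding sobolev_le_def using weighted_l2_le_cmult[OF *(1), of c] summable_on_cmult_right[OF *(2), of "cmod c"]
    by (intro exI[of _ "\<lambda>k. c * a k"]) (auto simp: norm_mult fourier_series_cmult)
qed

lemma sobolev_le_diff:
  assumes "sobolev_le r A f" and "sobolev_le r B g"
  shows "sobolev_le r (A + B) (\<lambda>x. f x - g x)"
  using sobolev_le_add[OF assms(1) sobolev_le_cmult[OF assms(2), of "- 1"]] by simp

lemma sobolev_le_cnj:
  assumes "sobolev_le r A f"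
  shows "sobolev_le r A (\<lambda>x. cnj (f x))"
proof -
  obtain a where *: "weighted_l2_le r A a" "abs_summable a" "f = fourier_series a"
    using assms by (auto simp: sobolev_le_def)
  have "abs_summable (\<lambda>k. cnj (a (- k)))"
    using *(2) summable_on_flip[of "\<lambda>k. cmod (a k)" 0] by simp
  then show ?thesis
    unfolding sobolev_le_def using weighted_l2_le_reflect[OF *(1)] *
    by (intro exI[of _ "\<lambda>k. cnj (a (- k))"]) (auto simp: fourier_series_cnj)
qed

lemma sobolev_le_one: "sobolev_le r 1 (\<lambda>_ :: real ^ 'd. 1)"
proof -
  let ?a = "\<lambda>k :: int ^ 'd. if k = 0 then 1 else 0 :: complex"
  have "weighted_l2_le r 1 ?a"
  proof (rule weighted_l2_leI)
    fix K :: "(int ^ 'd) set" assume K: "finite K"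
    have "L2_set (\<lambda>k. weight k powr r * cmod (?a k)) K \<le> (\<Sum>k\<in>K. weight k powr r * cmod (?a k))"
      by (rule L2_set_le_sum) auto
    also have "\<dots> = (\<Sum>k\<in>K. if k = 0 then 1 else 0)"
      by (intro sum.cong) (auto simp: weight_def freq_zero)
    finally show "L2_set (\<lambda>k. weight k powr r * cmod (?a k)) K \<le> 1" using K by (simp split: if_splits)
  qed
  moreover have "abs_summable ?a"
    by (rule finite_nonzero_values_imp_summable_on) (auto intro: finite_subset[of _ "{0}"])
  moreover have "fourier_series ?a x = 1" for x :: "real ^ 'd"
    unfolding fourier_series_def
    by (subst infsum_cong_neutral[where T = "{0}" and g = "\<lambda>_. 1"]) (auto simp: freq_zero)
  ultimately show ?thesis unfolding sobolev_le_def by (intro exI[of _ ?a]) auto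
qed

lemma sobolev_le_laplace_fun:
  assumes "sobolev_le r A f" and "\<And>x. x \<ge> 0 \<Longrightarrow> cmod (F (of_real (- x))) \<le> 1"
  shows "sobolev_le r A (laplace_fun F f)"
proof -
  obtain a where *: "weighted_l2_le r A a" "abs_summable a" "f = fourier_series a"
    using assms by (auto simp: sobolev_le_def)
  let ?b = "\<lambda>k. F (of_real (- (norm (freq k))\<^sup>2)) * a k"
  have F: "cmod (F (of_real (- (norm (freq k))\<^sup>2))) \<le> 1" for k :: "int ^ 'a"
    using assms(2)[of "(norm (freq k))\<^sup>2"] by simp
  have "abs_summable ?b"
    by (rule summable_on_comparison_test[OF *(2)]) (use F in \<open>auto simp: norm_mult intro!: mult_left_le_one_le\<close>)
  then show ?thesis
    unfolding sobolev_le_def using weighted_l2_le_multiplier[OF *(1) F] *(3) laplace_fun_fourier_series[OF *(2)]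
    by (intro exI[of _ ?b]) auto
qed

lemma laplace_fun_diff:
  fixes f g :: "real ^ 'a \<Rightarrow> complex"
  assumes f: "sobolev_le r A f" and g: "sobolev_le r B g"
    and F: "\<And>x. x \<ge> 0 \<Longrightarrow> cmod (F (of_real (- x))) \<le> 1"
  shows "laplace_fun F (\<lambda>x. f x - g x) = (\<lambda>x. laplace_fun F f x - laplace_fun F g x)"
proof
  fix x
  have s: "(\<lambda>k. F (of_real (- (norm (freq k))\<^sup>2)) * fourier_coeff h k * cis (freq k \<bullet> x)) summable_on UNIV"
    if "sobolev_le r C h" for C and h :: "real ^ 'a \<Rightarrow> complex"
  proof (rule abs_summable_summable, rule summable_on_comparison_test[OF sobolev_le_fourier_coeff(2)[OF that]])
    fix k :: "int ^ 'a"
    show "cmod (F (of_real (- (norm (freq k))\<^sup>2)) * fourier_coeff h k * cis (freq k \<bullet> x)) \<le> cmod (fourier_coeff h k)"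
      using F[of "(norm (freq k))\<^sup>2"] by (simp add: norm_mult mult_left_le_one_le)
  qed simp
  have m: "fourier_coeff (\<lambda>x. f x - g x) k = fourier_coeff f k - fourier_coeff g k" for k
  proof -
    have "(\<lambda>x. f x - g x) = fourier_series (\<lambda>k. fourier_coeff f k + (- 1) * fourier_coeff g k)"
      using fourier_series_add[OF sobolev_le_fourier_coeff(2)[OF f], of "\<lambda>k. (- 1) * fourier_coeff g k"]
        sobolev_le_fourier_coeff(2)[OF g] fourier_series_cmult[of "- 1" "fourier_coeff g"]
        sobolev_le_fourier_coeff(3)[OF f] sobolev_le_fourier_coeff(3)[OF g]
      by (simp add: fun_eq_iff)
    moreover have "abs_summable (\<lambda>k. fourier_coeff f k + (- 1) * fourier_coeff g k)"
      by (rule summable_on_comparison_test[OF summable_on_add[OF sobolev_le_fourier_coeff(2)[OF f] sobolev_le_fourier_coeff(2)[OF g]]])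
        (auto intro: norm_triangle_ineq4)
    ultimately show ?thesis by (simp add: fourier_coeff_fourier_series)
  qed
  show "laplace_fun F (\<lambda>x. f x - g x) x = laplace_fun F f x - laplace_fun F g x"
    unfolding laplace_fun_def m left_diff_distrib right_diff_distrib
    using infsum_add[OF s[OF f] summable_on_uminus[THEN iffD2, OF s[OF g]]] by (simp add: infsum_uminus)
qed

lemma free_flow_symbol: "exp (\<i> * of_real t * of_real (- x)) = cis (- (t * x))"
  by (simp add: cis_conv_exp mult.assoc)

lemma free_flow_fourier_series:
  assumes "abs_summable a"
  shows "free_flow t (fourier_series a) = fourier_series (\<lambda>k. cis (- (t * (norm (freq k))\<^sup>2)) * a k)"
  unfolding free_flow_def laplace_fun_fourier_series[OF assms] free_flow_symbol ..

lemma sobolev_le_free_flow: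
  assumes "sobolev_le r A f"
  shows "sobolev_le r A (free_flow t f)"
  unfolding free_flow_def by (rule sobolev_le_laplace_fun[OF assms], subst free_flow_symbol) simp

lemma free_flow_diff:
  assumes "sobolev_le r A f" and "sobolev_le r B g"
  shows "free_flow t (\<lambda>x. f x - g x) = (\<lambda>x. free_flow t f x - free_flow t g x)"
  unfolding free_flow_def by (rule laplace_fun_diff[OF assms], subst free_flow_symbol) simp

lemma free_flow_free_flow:
  assumes "sobolev_le r A f"
  shows "free_flow s (free_flow t f) = free_flow (s + t) f"
proof -
  obtain a where *: "abs_summable a" "f = fourier_series a"
    using assms by (auto simp: sobolev_le_def)
  have "abs_summable (\<lambda>k. cis (- (t * (norm (freq k))\<^sup>2)) * a k)" using * by (simp add: norm_mult)
  then show ?thesis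
    using * by (simp add: free_flow_fourier_series mult.assoc[symmetric] cis_mult distrib_right)
qed

lemma free_flow_0:
  assumes "sobolev_le r A f"
  shows "free_flow 0 f = f"
  using assms by (auto simp: sobolev_le_def free_flow_fourier_series)

lemma free_flow_cnj:
  assumes "sobolev_le r A f"
  shows "free_flow t (\<lambda>x. cnj (f x)) = (\<lambda>x. cnj (free_flow (- t) f x))"
proof -
  obtain a where *: "abs_summable a" "f = fourier_series a"
    using assms by (auto simp: sobolev_le_def)
  have "abs_summable (\<lambda>k. cnj (a (- k)))"
    using *(1) summable_on_flip[of "\<lambda>k. cmod (a k)" 0] by simp
  then show ?thesis
    using * by (simp add: free_flow_fourier_series fourier_series_cnj cis_cnj freq_minus)
qed

lemma sobolev_le_mult:
  assumes "r > real CARD('d::finite) / 2"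
  obtains C where "C > 0"
    and "\<And>A B f (g :: real ^ 'd \<Rightarrow> complex). sobolev_le r A f \<Longrightarrow> sobolev_le r B g \<Longrightarrow>
      sobolev_le r (C * A * B) (\<lambda>x. f x * g x)"
proof -
  obtain C where C: "C > 0"
    and conv: "\<And>A B a b (c :: int ^ 'd \<Rightarrow> complex). weighted_l2_le r A a \<Longrightarrow> weighted_l2_le r B b \<Longrightarrow>
      (\<And>k. cmod (c k) \<le> (\<Sum>\<^sub>\<infinity>l. cmod (a (k - l)) * cmod (b l))) \<Longrightarrow> weighted_l2_le r (C * A * B) c"
    using weighted_l2_le_convolution[OF assms] by blast
  show ?thesis
  proof (rule that[OF C])
    fix A B and f g :: "real ^ 'd \<Rightarrow> complex"
    assume "sobolev_le r A f" "sobolev_le r B g"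
    then obtain a b where *: "weighted_l2_le r A a" "abs_summable a" "f = fourier_series a"
      "weighted_l2_le r B b" "abs_summable b" "g = fourier_series b"
      by (auto simp: sobolev_le_def)
    have "(\<lambda>x. f x * g x) = fourier_series (convolution a b)"
      using * by (simp add: fun_eq_iff fourier_series_mult)
    then show "sobolev_le r (C * A * B) (\<lambda>x. f x * g x)"
      using sobolev_leI[OF assms conv[OF *(1,4) norm_convolution_le[OF *(2,5)]]] by simp
  qed
qed

lemma sobolev_le_power:
  assumes "r > real CARD('d::finite) / 2"
  shows "\<exists>C\<ge>0. \<forall>f :: real ^ 'd \<Rightarrow> complex. sobolev_le r R f \<longrightarrow> sobolev_le r C (\<lambda>x. f x ^ m)"
proof (induction m)
  case 0
  show ?case using sobolev_le_one[of r, where 'd = 'd] by (intro exI[of _ 1]) auto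
next
  case (Suc m)
  obtain K where K: "K > 0"
    and mult: "\<And>A B f (g :: real ^ 'd \<Rightarrow> complex). sobolev_le r A f \<Longrightarrow> sobolev_le r B g \<Longrightarrow>
      sobolev_le r (K * A * B) (\<lambda>x. f x * g x)"
    using sobolev_le_mult[OF assms] by blast
  obtain C where C: "C \<ge> 0" "\<And>f :: real ^ 'd \<Rightarrow> complex. sobolev_le r R f \<Longrightarrow> sobolev_le r C (\<lambda>x. f x ^ m)"
    using Suc by blast
  show ?case
  proof (intro exI conjI allI impI)
    show "0 \<le> K * \<bar>R\<bar> * C" using K C by simp
    fix f :: "real ^ 'd \<Rightarrow> complex" assume f: "sobolev_le r R f"
    show "sobolev_le r (K * \<bar>R\<bar> * C) (\<lambda>x. f x ^ Suc m)"
      using mult[OF f C(2)[OF f]] sobolev_le_nonneg[OF f] by simp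
  qed
qed

lemma sobolev_le_power_diff:
  assumes "r > real CARD('d::finite) / 2"
  shows "\<exists>L\<ge>0. \<forall>f (g :: real ^ 'd \<Rightarrow> complex) D. sobolev_le r R f \<longrightarrow> sobolev_le r R g \<longrightarrow>
    sobolev_le r D (\<lambda>x. f x - g x) \<longrightarrow> sobolev_le r (L * D) (\<lambda>x. f x ^ m - g x ^ m)"
proof (induction m)
  case 0
  have "sobolev_le r 0 (\<lambda>_ :: real ^ 'd. 0)"
    using sobolev_le_cmult[OF sobolev_le_one, of r 0] by simp
  then show ?case by (intro exI[of _ 0]) simp
next
  case (Suc m)
  obtain K where K: "K > 0"
    and mult: "\<And>A B f (g :: real ^ 'd \<Rightarrow> complex). sobolev_le r A f \<Longrightarrow> sobolev_le r B g \<Longrightarrow>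
      sobolev_le r (K * A * B) (\<lambda>x. f x * g x)"
    using sobolev_le_mult[OF assms] by blast
  obtain C where C: "C \<ge> 0" "\<And>f :: real ^ 'd \<Rightarrow> complex. sobolev_le r R f \<Longrightarrow> sobolev_le r C (\<lambda>x. f x ^ m)"
    using sobolev_le_power[OF assms] by blast
  obtain L where L: "L \<ge> 0" "\<And>f (g :: real ^ 'd \<Rightarrow> complex) D. sobolev_le r R f \<Longrightarrow> sobolev_le r R g \<Longrightarrow>
    sobolev_le r D (\<lambda>x. f x - g x) \<Longrightarrow> sobolev_le r (L * D) (\<lambda>x. f x ^ m - g x ^ m)"
    using Suc by blast
  show ?case
  proof (intro exI conjI allI impI)
    show "0 \<le> K * \<bar>R\<bar> * L + K * C" using K C L by simp
    fix f g :: "real ^ 'd \<Rightarrow> complex" and D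
    assume f: "sobolev_le r R f" and g: "sobolev_le r R g" and D: "sobolev_le r D (\<lambda>x. f x - g x)"
    have "sobolev_le r (K * R * (L * D) + K * D * C) (\<lambda>x. f x * (f x ^ m - g x ^ m) + (f x - g x) * g x ^ m)"
      by (intro sobolev_le_add mult f D C(2)[OF g] L(2)[OF f g D])
    then show "sobolev_le r ((K * \<bar>R\<bar> * L + K * C) * D) (\<lambda>x. f x ^ Suc m - g x ^ Suc m)"
      using sobolev_le_nonneg[OF f] by (simp add: algebra_simps)
  qed
qed

text \<open>A difference of products is handled by \<open>f\<^sub>1 g\<^sub>1 - f\<^sub>2 g\<^sub>2 = f\<^sub>1 (g\<^sub>1 - g\<^sub>2) + (f\<^sub>1 - f\<^sub>2) g\<^sub>2\<close>.\<close>

lemma sobolev_le_mult_diff: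
  fixes f\<^sub>1 f\<^sub>2 g\<^sub>1 g\<^sub>2 :: "real ^ 'd \<Rightarrow> complex"
  assumes mult: "\<And>A B f (g :: real ^ 'd \<Rightarrow> complex). sobolev_le r A f \<Longrightarrow> sobolev_le r B g \<Longrightarrow>
      sobolev_le r (K * A * B) (\<lambda>x. f x * g x)"
    and "sobolev_le r A f\<^sub>1" and "sobolev_le r B g\<^sub>2"
    and "sobolev_le r D (\<lambda>x. f\<^sub>1 x - f\<^sub>2 x)" and "sobolev_le r E (\<lambda>x. g\<^sub>1 x - g\<^sub>2 x)"
  shows "sobolev_le r (K * A * E + K * D * B) (\<lambda>x. f\<^sub>1 x * g\<^sub>1 x - f\<^sub>2 x * g\<^sub>2 x)"
proof -
  have "sobolev_le r (K * A * E + K * D * B) (\<lambda>x. f\<^sub>1 x * (g\<^sub>1 x - g\<^sub>2 x) + (f\<^sub>1 x - f\<^sub>2 x) * g\<^sub>2 x)"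
    by (intro sobolev_le_add mult assms)
  then show ?thesis by (simp add: algebra_simps)
qed

section \<open>The free flow and products\<close>

lemma norm_cis_minus_1_le:
  assumes "0 < \<gamma>" and "\<gamma> \<le> 1"
  shows "cmod (cis \<theta> - 1) \<le> 2 * \<bar>\<theta>\<bar> powr \<gamma>"
proof (cases "\<bar>\<theta>\<bar> \<le> 1")
  case True
  have "cmod (cis \<theta> - 1) \<le> \<bar>\<theta>\<bar>"
    using dist_exp_i_1[of \<theta>] abs_sin_x_le_abs_x[of "\<theta> / 2"] by (simp add: cis_conv_exp)
  also have "\<dots> \<le> \<bar>\<theta>\<bar> powr \<gamma>"
    using powr_mono'[of \<gamma> 1 "\<bar>\<theta>\<bar>"] assms True by simp
  finally show ?thesis using norm_ge_zero[of "cis \<theta> - 1"] by linarith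
next
  case False
  have "cmod (cis \<theta> - 1) \<le> 2"
    using norm_triangle_ineq4[of "cis \<theta>" 1] by simp
  moreover have "1 \<le> \<bar>\<theta>\<bar> powr \<gamma>" using False assms by (intro ge_one_powr_ge_zero) auto
  ultimately show ?thesis by simp
qed

text \<open>The symbols of \<open>e\<^sup>i\<^sup>s\<^sup>\<Delta>(f g)\<close> and of \<open>(e\<^sup>i\<^sup>s\<^sup>\<Delta>f)(e\<^sup>i\<^sup>s\<^sup>\<Delta>g)\<close> at the pair of frequencies \<open>(k - l, l)\<close> have the
  phases \<open>- s |k|\<^sup>2\<close> and \<open>- s (|k - l|\<^sup>2 + |l|\<^sup>2)\<close>. They differ by the mixed term
  \<open>2 s (k - l) \<bullet> l\<close>, so that \<open>\<gamma>\<close> derivatives on each factor gain the power \<open>|s|\<^sup>\<gamma>\<close>. No pure square of a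
  frequency occurs, which would cost \<open>2 \<gamma>\<close> derivatives on one factor.\<close>

lemma sobolev_le_free_flow_mult:
  assumes r: "r > real CARD('d::finite) / 2" and \<gamma>: "0 < \<gamma>" "\<gamma> \<le> 1"
  obtains C where "C > 0"
    and "\<And>A B s f (g :: real ^ 'd \<Rightarrow> complex). sobolev_le (r + \<gamma>) A f \<Longrightarrow> sobolev_le (r + \<gamma>) B g \<Longrightarrow>
      sobolev_le r (C * \<bar>s\<bar> powr \<gamma> * A * B) (\<lambda>x. free_flow s (\<lambda>x. f x * g x) x - free_flow s f x * free_flow s g x)"
proof -
  obtain C where C: "C > 0"
    and conv: "\<And>A B a b (c :: int ^ 'd \<Rightarrow> complex). weighted_l2_le r A a \<Longrightarrow> weighted_l2_le r B b \<Longrightarrow>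
      (\<And>k. cmod (c k) \<le> (\<Sum>\<^sub>\<infinity>l. cmod (a (k - l)) * cmod (b l))) \<Longrightarrow> weighted_l2_le r (C * A * B) c"
    using weighted_l2_le_convolution[OF r] by blast
  show ?thesis
  proof (rule that)
    show "C * (2 * 2 powr \<gamma>) > 0" using C by simp
    fix A B s and f g :: "real ^ 'd \<Rightarrow> complex"
    assume "sobolev_le (r + \<gamma>) A f" "sobolev_le (r + \<gamma>) B g"
    then obtain a b where *: "weighted_l2_le (r + \<gamma>) A a" "abs_summable a" "f = fourier_series a"
      "weighted_l2_le (r + \<gamma>) B b" "abs_summable b" "g = fourier_series b"
      by (auto simp: sobolev_le_def)
    define e :: "int ^ 'd \<Rightarrow> complex" where "e k = cis (- (s * (norm (freq k))\<^sup>2))" for k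
    define D where "D = 2 * 2 powr \<gamma> * \<bar>s\<bar> powr \<gamma>"
    define a' b' :: "int ^ 'd \<Rightarrow> complex" where "a' k = of_real D * (weight k powr \<gamma> * a k)"
      and "b' k = weight k powr \<gamma> * b k" for k
    have a': "weighted_l2_le r (D * A) a'"
      using weighted_l2_le_cmult[of r A "\<lambda>k. weight k powr \<gamma> * a k" D]
        weighted_l2_le_dominated[OF *(1), of r "\<lambda>k. weight k powr \<gamma> * a k"]
      by (simp add: a'_def[abs_def] norm_mult powr_add D_def abs_mult)
    have b': "weighted_l2_le r B b'"
      by (rule weighted_l2_le_dominated[OF *(4)]) (simp add: b'_def norm_mult powr_add)
    have sum': "abs_summable a'" "abs_summable b'"
      using weighted_l2_le_abs_sum[OF r] a' b' by metis+
    have e1: "cmod (e k) = 1" for k by (simp add: e_def)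
    have ea: "abs_summable (\<lambda>k. e k * a k)" and eb: "abs_summable (\<lambda>k. e k * b k)"
      using * by (simp_all add: norm_mult e1)
    have phase: "cmod (e k - e (k - l) * e l) \<le> D * (weight (k - l) powr \<gamma> * weight l powr \<gamma>)" for k l
    proof -
      define \<theta> where "\<theta> = - (2 * s * (freq (k - l) \<bullet> freq l))"
      have "freq k = freq (k - l) + freq l" by (simp add: freq_diff)
      then have "(norm (freq k))\<^sup>2 = (norm (freq (k - l)))\<^sup>2 + 2 * (freq (k - l) \<bullet> freq l) + (norm (freq l))\<^sup>2"
        by (simp add: power2_norm_eq_inner inner_add_left inner_add_right inner_commute)
      then have "e k = e (k - l) * e l * cis \<theta>"
        by (simp add: e_def \<theta>_def cis_mult algebra_simps)
      then have "e k - e (k - l) * e l = e (k - l) * e l * (cis \<theta> - 1)" by (simp add: algebra_simps)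
      then have "cmod (e k - e (k - l) * e l) = cmod (cis \<theta> - 1)" by (simp add: norm_mult e1)
      also have "\<dots> \<le> 2 * \<bar>\<theta>\<bar> powr \<gamma>" by (rule norm_cis_minus_1_le[OF \<gamma>])
      also have "\<dots> \<le> 2 * (2 * \<bar>s\<bar> * (weight (k - l) * weight l)) powr \<gamma>"
      proof -
        have "\<bar>freq (k - l) \<bullet> freq l\<bar> \<le> norm (freq (k - l)) * norm (freq l)"
          by (rule Cauchy_Schwarz_ineq2)
        also have "\<dots> \<le> weight (k - l) * weight l"
          by (intro mult_mono) (auto simp: weight_def)
        finally show ?thesis using \<gamma> by (auto simp: \<theta>_def abs_mult mult.assoc intro!: powr_mono2 mult_left_mono)
      qed
      also have "\<dots> = D * (weight (k - l) powr \<gamma> * weight l powr \<gamma>)"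
        by (simp add: D_def powr_mult)
      finally show ?thesis .
    qed
    define c where "c k = e k * convolution a b k - convolution (\<lambda>k. e k * a k) (\<lambda>k. e k * b k) k" for k
    have c_le: "cmod (c k) \<le> (\<Sum>\<^sub>\<infinity>l. cmod (a' (k - l)) * cmod (b' l))" for k
    proof -
      have s1: "(\<lambda>l. e k * (a (k - l) * b l)) summable_on UNIV"
        by (intro summable_on_cmult_right convolution_summable *)
      have s2: "(\<lambda>l. (e (k - l) * a (k - l)) * (e l * b l)) summable_on UNIV"
        by (rule convolution_summable[OF ea eb])
      have "((\<lambda>l. e k * (a (k - l) * b l) - (e (k - l) * a (k - l)) * (e l * b l)) has_sum c k) UNIV"
        using has_sum_add[OF has_sum_infsum[OF s1] has_sum_uminusI[OF has_sum_infsum[OF s2]]]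
        by (simp add: c_def convolution_def infsum_cmult_right')
      then show ?thesis
      proof (rule norm_infsum_le[OF _ has_sum_infsum[OF abs_convolution_summable[OF sum']]])
        fix l
        have "cmod (e k * (a (k - l) * b l) - (e (k - l) * a (k - l)) * (e l * b l))
            = cmod (e k - e (k - l) * e l) * (cmod (a (k - l)) * cmod (b l))"
          by (simp add: norm_mult[symmetric] algebra_simps)
        also have "\<dots> \<le> D * (weight (k - l) powr \<gamma> * weight l powr \<gamma>) * (cmod (a (k - l)) * cmod (b l))"
          by (intro mult_right_mono phase) auto
        also have "\<dots> = cmod (a' (k - l)) * cmod (b' l)"
          by (simp add: a'_def b'_def norm_mult D_def abs_mult)
        finally show "cmod (e k * (a (k - l) * b l) - (e (k - l) * a (k - l)) * (e l * b l))
          \<le> cmod (a' (k - l)) * cmod (b' l)" .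
      qed
    qed
    note S1 = abs_summable_convolution[OF *(2,5)] and S2 = abs_summable_convolution[OF ea eb]
    have eq: "free_flow s (\<lambda>x. f x * g x) x - free_flow s f x * free_flow s g x = fourier_series c x" for x
    proof -
      have "free_flow s (\<lambda>x. f x * g x) x = fourier_series (\<lambda>k. e k * convolution a b k) x"
      proof -
        have "(\<lambda>x. f x * g x) = fourier_series (convolution a b)"
          using * by (simp add: fun_eq_iff fourier_series_mult)
        then show ?thesis using S1 by (simp add: free_flow_fourier_series e_def)
      qed
      moreover have "free_flow s f x * free_flow s g x = fourier_series (convolution (\<lambda>k. e k * a k) (\<lambda>k. e k * b k)) x"
        unfolding *(3,6) free_flow_fourier_series[OF *(2)] free_flow_fourier_series[OF *(5)]
        by (simp add: fourier_series_mult[OF ea eb] flip: e_def)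
      moreover have "fourier_series c x = fourier_series (\<lambda>k. e k * convolution a b k) x
          + (- 1) * fourier_series (convolution (\<lambda>k. e k * a k) (\<lambda>k. e k * b k)) x"
        unfolding fourier_series_cmult[symmetric] c_def[abs_def] using S1 S2
        by (subst fourier_series_add[symmetric]) (auto simp: norm_mult e1)
      ultimately show ?thesis by simp
    qed
    have "weighted_l2_le r (C * (D * A) * B) c" by (rule conv[OF a' b' c_le])
    then show "sobolev_le r (C * (2 * 2 powr \<gamma>) * \<bar>s\<bar> powr \<gamma> * A * B)
        (\<lambda>x. free_flow s (\<lambda>x. f x * g x) x - free_flow s f x * free_flow s g x)"
      using sobolev_leI[OF r, of _ c] by (simp add: eq D_def mult_ac)
  qed
qed

section \<open>The nonlinearity and one step of the integrator\<close>

lemma nls_nonlinearity_eq: "nls_nonlinearity p v = (\<lambda>x. v x ^ (p + 1) * cnj (v x) ^ p)"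
proof
  fix x
  have "complex_of_real (cmod (v x) ^ (2 * p)) = (v x * cnj (v x)) ^ p"
    unfolding complex_norm_square[symmetric] by (simp add: power_mult)
  then show "nls_nonlinearity p v x = v x ^ (p + 1) * cnj (v x) ^ p"
    by (simp add: nls_nonlinearity_def power_mult_distrib mult_ac)
qed

lemma norm_phi1_le: "cmod (phi1 (\<i> * of_real y)) \<le> 1"
proof (cases "y = 0")
  case False
  have "cmod (exp (\<i> * of_real y) - 1) \<le> \<bar>y\<bar>"
    using dist_exp_i_1[of y] abs_sin_x_le_abs_x[of "y / 2"] by simp
  then show ?thesis using False by (simp add: phi1_def norm_divide norm_mult)
qed (simp add: phi1_def)

text \<open>The factor \<open>\<phi>\<^sub>1(- 2 i \<tau> \<Delta>) (cnj v)\<^sup>p\<close> of the integrator.\<close>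

definition filtered_power :: "nat \<Rightarrow> real \<Rightarrow> (real ^ 'd \<Rightarrow> complex) \<Rightarrow> real ^ 'd \<Rightarrow> complex" where
  "filtered_power p \<tau> v = laplace_fun (\<lambda>z. phi1 (- 2 * \<i> * of_real \<tau> * z)) (\<lambda>y. cnj (v y) ^ p)"

lemma integrator_step_eq:
  "integrator_step p \<mu> \<tau> v =
     free_flow \<tau> (\<lambda>x. v x - (\<i> * of_real \<mu> * of_real \<tau>) * (v x ^ (p + 1) * filtered_power p \<tau> v x))"
  unfolding integrator_step_def filtered_power_def by (simp only: mult.assoc)

lemma norm_filter_symbol_le: "cmod (phi1 (- 2 * \<i> * of_real \<tau> * of_real (- x))) \<le> 1"
  using norm_phi1_le[of "2 * \<tau> * x"] by (simp add: mult_ac)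

lemma sobolev_le_cnj_power_diff:
  assumes "r > real CARD('d::finite) / 2"
  shows "\<exists>L\<ge>0. \<forall>f (g :: real ^ 'd \<Rightarrow> complex) D. sobolev_le r R f \<longrightarrow> sobolev_le r R g \<longrightarrow>
    sobolev_le r D (\<lambda>x. f x - g x) \<longrightarrow> sobolev_le r (L * D) (\<lambda>x. cnj (f x) ^ m - cnj (g x) ^ m)"
proof -
  obtain L where "L \<ge> 0" and L: "\<And>f (g :: real ^ 'd \<Rightarrow> complex) D. sobolev_le r R f \<Longrightarrow> sobolev_le r R g \<Longrightarrow>
    sobolev_le r D (\<lambda>x. f x - g x) \<Longrightarrow> sobolev_le r (L * D) (\<lambda>x. f x ^ m - g x ^ m)"
    using sobolev_le_power_diff[OF assms, of R m] by blast
  show ?thesis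
  proof (intro exI conjI allI impI)
    fix f g :: "real ^ 'd \<Rightarrow> complex" and D
    assume "sobolev_le r R f" "sobolev_le r R g" "sobolev_le r D (\<lambda>x. f x - g x)"
    from sobolev_le_cnj[OF L[OF this]]
    show "sobolev_le r (L * D) (\<lambda>x. cnj (f x) ^ m - cnj (g x) ^ m)" by simp
  qed fact
qed

lemma sobolev_le_nls_nonlinearity:
  assumes "r > real CARD('d::finite) / 2"
  shows "\<exists>C\<ge>0. \<forall>f :: real ^ 'd \<Rightarrow> complex. sobolev_le r R f \<longrightarrow> sobolev_le r C (nls_nonlinearity p f)"
proof -
  obtain K where K: "K > 0"
    and mult: "\<And>A B f (g :: real ^ 'd \<Rightarrow> complex). sobolev_le r A f \<Longrightarrow> sobolev_le r B g \<Longrightarrow>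
      sobolev_le r (K * A * B) (\<lambda>x. f x * g x)"
    using sobolev_le_mult[OF assms] by blast
  obtain C where C: "C \<ge> 0" "\<And>f :: real ^ 'd \<Rightarrow> complex. sobolev_le r R f \<Longrightarrow> sobolev_le r C (\<lambda>x. f x ^ (p + 1))"
    using sobolev_le_power[OF assms, of R "p + 1"] by blast
  obtain C' where C': "C' \<ge> 0" "\<And>f :: real ^ 'd \<Rightarrow> complex. sobolev_le r R f \<Longrightarrow> sobolev_le r C' (\<lambda>x. f x ^ p)"
    using sobolev_le_power[OF assms, of R p] by blast
  show ?thesis
    unfolding nls_nonlinearity_eq using K C C' by (intro exI[of _ "K * C * C'"]) (auto intro!: mult sobolev_le_cnj)
qed

lemma sobolev_le_nls_nonlinearity_diff:
  assumes "r > real CARD('d::finite) / 2"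
  shows "\<exists>L\<ge>0. \<forall>f (g :: real ^ 'd \<Rightarrow> complex) D. sobolev_le r R f \<longrightarrow> sobolev_le r R g \<longrightarrow>
    sobolev_le r D (\<lambda>x. f x - g x) \<longrightarrow> sobolev_le r (L * D) (\<lambda>x. nls_nonlinearity p f x - nls_nonlinearity p g x)"
proof -
  obtain K where K: "K > 0"
    and mult: "\<And>A B f (g :: real ^ 'd \<Rightarrow> complex). sobolev_le r A f \<Longrightarrow> sobolev_le r B g \<Longrightarrow>
      sobolev_le r (K * A * B) (\<lambda>x. f x * g x)"
    using sobolev_le_mult[OF assms] by blast
  obtain C where C: "C \<ge> 0" "\<And>f :: real ^ 'd \<Rightarrow> complex. sobolev_le r R f \<Longrightarrow> sobolev_le r C (\<lambda>x. f x ^ (p + 1))"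
    using sobolev_le_power[OF assms, of R "p + 1"] by blast
  obtain C' where C': "C' \<ge> 0" "\<And>f :: real ^ 'd \<Rightarrow> complex. sobolev_le r R f \<Longrightarrow> sobolev_le r C' (\<lambda>x. f x ^ p)"
    using sobolev_le_power[OF assms, of R p] by blast
  obtain L where L: "L \<ge> 0" "\<And>f (g :: real ^ 'd \<Rightarrow> complex) D. sobolev_le r R f \<Longrightarrow> sobolev_le r R g \<Longrightarrow>
    sobolev_le r D (\<lambda>x. f x - g x) \<Longrightarrow> sobolev_le r (L * D) (\<lambda>x. f x ^ (p + 1) - g x ^ (p + 1))"
    using sobolev_le_power_diff[OF assms, of R "p + 1"] by blast
  obtain L' where L': "L' \<ge> 0" "\<And>f (g :: real ^ 'd \<Rightarrow> complex) D. sobolev_le r R f \<Longrightarrow> sobolev_le r R g \<Longrightarrow>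
    sobolev_le r D (\<lambda>x. f x - g x) \<Longrightarrow> sobolev_le r (L' * D) (\<lambda>x. cnj (f x) ^ p - cnj (g x) ^ p)"
    using sobolev_le_cnj_power_diff[OF assms, of R p] by blast
  show ?thesis
  proof (intro exI conjI allI impI)
    show "0 \<le> K * C * L' + K * L * C'" using K C C' L L' by simp
    fix f g :: "real ^ 'd \<Rightarrow> complex" and D
    assume f: "sobolev_le r R f" and g: "sobolev_le r R g" and D: "sobolev_le r D (\<lambda>x. f x - g x)"
    have "sobolev_le r (K * C * (L' * D) + K * (L * D) * C') (\<lambda>x. nls_nonlinearity p f x - nls_nonlinearity p g x)"
      unfolding nls_nonlinearity_eq
      by (intro sobolev_le_mult_diff mult C(2)[OF f] C'(2)[OF sobolev_le_cnj[OF g]] L(2)[OF f g D] L'(2)[OF f g D])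
    then show "sobolev_le r ((K * C * L' + K * L * C') * D) (\<lambda>x. nls_nonlinearity p f x - nls_nonlinearity p g x)"
      by (simp add: algebra_simps)
  qed
qed

text \<open>Stability. The free flow is an isometry of \<open>H\<^sup>r\<close> and the filter a contraction, so that only the
  locally Lipschitz nonlinear part, which has the factor \<open>\<tau>\<close>, can expand distances.\<close>

lemma sobolev_le_integrator_step_diff:
  assumes r: "r > real CARD('d::finite) / 2"
  shows "\<exists>L\<ge>0. \<forall>\<tau> f (g :: real ^ 'd \<Rightarrow> complex) D. \<tau> \<ge> 0 \<longrightarrow> sobolev_le r R f \<longrightarrow> sobolev_le r R g \<longrightarrow>
    sobolev_le r D (\<lambda>x. f x - g x) \<longrightarrow>
    sobolev_le r ((1 + L * \<tau>) * D) (\<lambda>x. integrator_step p \<mu> \<tau> f x - integrator_step p \<mu> \<tau> g x)"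
proof -
  obtain K where K: "K > 0"
    and mult: "\<And>A B f (g :: real ^ 'd \<Rightarrow> complex). sobolev_le r A f \<Longrightarrow> sobolev_le r B g \<Longrightarrow>
      sobolev_le r (K * A * B) (\<lambda>x. f x * g x)"
    using sobolev_le_mult[OF r] by blast
  obtain C where C: "C \<ge> 0" "\<And>f :: real ^ 'd \<Rightarrow> complex. sobolev_le r R f \<Longrightarrow> sobolev_le r C (\<lambda>x. f x ^ (p + 1))"
    using sobolev_le_power[OF r, of R "p + 1"] by blast
  obtain C' where C': "C' \<ge> 0" "\<And>f :: real ^ 'd \<Rightarrow> complex. sobolev_le r R f \<Longrightarrow> sobolev_le r C' (\<lambda>x. f x ^ p)"
    using sobolev_le_power[OF r, of R p] by blast
  obtain L where L: "L \<ge> 0" "\<And>f (g :: real ^ 'd \<Rightarrow> complex) D. sobolev_le r R f \<Longrightarrow> sobolev_le r R g \<Longrightarrow>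
    sobolev_le r D (\<lambda>x. f x - g x) \<Longrightarrow> sobolev_le r (L * D) (\<lambda>x. f x ^ (p + 1) - g x ^ (p + 1))"
    using sobolev_le_power_diff[OF r, of R "p + 1"] by blast
  obtain L' where L': "L' \<ge> 0" "\<And>f (g :: real ^ 'd \<Rightarrow> complex) D. sobolev_le r R f \<Longrightarrow> sobolev_le r R g \<Longrightarrow>
    sobolev_le r D (\<lambda>x. f x - g x) \<Longrightarrow> sobolev_le r (L' * D) (\<lambda>x. cnj (f x) ^ p - cnj (g x) ^ p)"
    using sobolev_le_cnj_power_diff[OF r, of R p] by blast
  show ?thesis
  proof (intro exI conjI allI impI)
    show "0 \<le> \<bar>\<mu>\<bar> * (K * C * L' + K * L * C')" using K C C' L L' by simp
    fix \<tau> :: real and f g :: "real ^ 'd \<Rightarrow> complex" and D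
    assume \<tau>: "0 \<le> \<tau>" and f: "sobolev_le r R f" and g: "sobolev_le r R g" and D: "sobolev_le r D (\<lambda>x. f x - g x)"
    define G where "G h x = h x ^ (p + 1) * filtered_power p \<tau> h x" for h :: "real ^ 'd \<Rightarrow> complex" and x
    define c where "c = \<i> * complex_of_real \<mu> * complex_of_real \<tau>"
    have pow: "sobolev_le r C' (\<lambda>x. cnj (h x) ^ p)" if "sobolev_le r R h" for h :: "real ^ 'd \<Rightarrow> complex"
      by (rule C'(2)[OF sobolev_le_cnj[OF that]])
    have filt: "sobolev_le r C' (filtered_power p \<tau> h)" if "sobolev_le r R h" for h :: "real ^ 'd \<Rightarrow> complex"
      unfolding filtered_power_def by (intro sobolev_le_laplace_fun pow that norm_filter_symbol_le)
    have filt_diff: "sobolev_le r (L' * D) (\<lambda>x. filtered_power p \<tau> f x - filtered_power p \<tau> g x)"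
      unfolding filtered_power_def
      by (subst laplace_fun_diff[where F = "\<lambda>z. phi1 (- 2 * \<i> * of_real \<tau> * z)", symmetric,
              OF pow[OF f] pow[OF g] norm_filter_symbol_le])
        (intro sobolev_le_laplace_fun norm_filter_symbol_le L'(2) f g D)
    have G: "sobolev_le r (K * C * C') (G h)" if "sobolev_le r R h" for h
      unfolding G_def[abs_def] by (intro mult C(2) filt that)
    have G_diff: "sobolev_le r (K * C * (L' * D) + K * (L * D) * C') (\<lambda>x. G f x - G g x)"
      unfolding G_def by (intro sobolev_le_mult_diff mult C(2)[OF f] filt[OF g] L(2)[OF f g D] filt_diff)
    have step: "integrator_step p \<mu> \<tau> h = free_flow \<tau> (\<lambda>x. h x - c * G h x)" for h :: "real ^ 'd \<Rightarrow> complex"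
      by (simp add: integrator_step_eq G_def c_def)
    have "(\<lambda>x. integrator_step p \<mu> \<tau> f x - integrator_step p \<mu> \<tau> g x)
        = free_flow \<tau> (\<lambda>x. (f x - c * G f x) - (g x - c * G g x))"
      unfolding step
      by (rule free_flow_diff[symmetric, OF sobolev_le_diff[OF f sobolev_le_cmult[OF G[OF f]]]
            sobolev_le_diff[OF g sobolev_le_cmult[OF G[OF g]]]])
    also have "(\<lambda>x. (f x - c * G f x) - (g x - c * G g x)) = (\<lambda>x. (f x - g x) - c * (G f x - G g x))"
      by (simp add: algebra_simps)
    finally have "sobolev_le r (D + cmod c * (K * C * (L' * D) + K * (L * D) * C'))
        (\<lambda>x. integrator_step p \<mu> \<tau> f x - integrator_step p \<mu> \<tau> g x)"
      by (simp only:) (intro sobolev_le_free_flow sobolev_le_diff D sobolev_le_cmult G_diff)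
    moreover have "cmod c = \<bar>\<mu>\<bar> * \<tau>" using \<tau> by (simp add: c_def norm_mult)
    ultimately show "sobolev_le r ((1 + \<bar>\<mu>\<bar> * (K * C * L' + K * L * C') * \<tau>) * D)
        (\<lambda>x. integrator_step p \<mu> \<tau> f x - integrator_step p \<mu> \<tau> g x)"
      by (simp add: algebra_simps)
  qed
qed

text \<open>The factors are split off one at a time. The remaining power is again bounded in the algebra
  \<open>H\<^sup>r\<^sup>+\<^sup>\<gamma>\<close>, so that the estimate for a product of two functions applies to each splitting.\<close>

lemma sobolev_le_free_flow_power:
  assumes r: "r > real CARD('d::finite) / 2" and \<gamma>: "0 < \<gamma>" "\<gamma> \<le> 1"
  shows "\<exists>C\<ge>0. \<forall>s (f :: real ^ 'd \<Rightarrow> complex). sobolev_le (r + \<gamma>) R f \<longrightarrow>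
    sobolev_le r (C * \<bar>s\<bar> powr \<gamma>) (\<lambda>x. free_flow s (\<lambda>x. f x ^ Suc m) x - free_flow s f x ^ Suc m)"
proof (induction m)
  case 0
  have "sobolev_le r 0 (\<lambda>_ :: real ^ 'd. 0)"
    using sobolev_le_cmult[OF sobolev_le_one, of r 0] by simp
  then show ?case by (intro exI[of _ 0]) simp
next
  case (Suc m)
  have r\<gamma>: "r + \<gamma> > real CARD('d) / 2" using r \<gamma> by simp
  obtain K where K: "K > 0"
    and mult: "\<And>A B f (g :: real ^ 'd \<Rightarrow> complex). sobolev_le r A f \<Longrightarrow> sobolev_le r B g \<Longrightarrow>
      sobolev_le r (K * A * B) (\<lambda>x. f x * g x)"
    using sobolev_le_mult[OF r] by blast
  obtain K' where K': "K' > 0"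
    and comm: "\<And>A B s f (g :: real ^ 'd \<Rightarrow> complex). sobolev_le (r + \<gamma>) A f \<Longrightarrow> sobolev_le (r + \<gamma>) B g \<Longrightarrow>
      sobolev_le r (K' * \<bar>s\<bar> powr \<gamma> * A * B) (\<lambda>x. free_flow s (\<lambda>x. f x * g x) x - free_flow s f x * free_flow s g x)"
    using sobolev_le_free_flow_mult[OF r \<gamma>] by blast
  obtain B where B: "B \<ge> 0"
    "\<And>f :: real ^ 'd \<Rightarrow> complex. sobolev_le (r + \<gamma>) R f \<Longrightarrow> sobolev_le (r + \<gamma>) B (\<lambda>x. f x ^ Suc m)"
    using sobolev_le_power[OF r\<gamma>, of R "Suc m"] by blast
  obtain C where C: "C \<ge> 0"
    "\<And>s (f :: real ^ 'd \<Rightarrow> complex). sobolev_le (r + \<gamma>) R f \<Longrightarrow>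
    sobolev_le r (C * \<bar>s\<bar> powr \<gamma>) (\<lambda>x. free_flow s (\<lambda>x. f x ^ Suc m) x - free_flow s f x ^ Suc m)"
    using Suc by blast
  show ?case
  proof (intro exI conjI allI impI)
    show "0 \<le> K' * \<bar>R\<bar> * B + K * \<bar>R\<bar> * C" using K K' B C by simp
    fix s and f :: "real ^ 'd \<Rightarrow> complex" assume f: "sobolev_le (r + \<gamma>) R f"
    have "sobolev_le r R f" using f \<gamma> by (auto intro: sobolev_le_order)
    then have Sf: "sobolev_le r R (free_flow s f)" by (rule sobolev_le_free_flow)
    have "sobolev_le r (K' * \<bar>s\<bar> powr \<gamma> * R * B + K * R * (C * \<bar>s\<bar> powr \<gamma>))
      (\<lambda>x. (free_flow s (\<lambda>x. f x * f x ^ Suc m) x - free_flow s f x * free_flow s (\<lambda>x. f x ^ Suc m) x)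
        + free_flow s f x * (free_flow s (\<lambda>x. f x ^ Suc m) x - free_flow s f x ^ Suc m))"
      by (intro sobolev_le_add comm mult f Sf B(2)[OF f] C(2)[OF f])
    then show "sobolev_le r ((K' * \<bar>R\<bar> * B + K * \<bar>R\<bar> * C) * \<bar>s\<bar> powr \<gamma>)
      (\<lambda>x. free_flow s (\<lambda>x. f x ^ Suc (Suc m)) x - free_flow s f x ^ Suc (Suc m))"
      using sobolev_le_nonneg[OF f] by (simp add: algebra_simps)
  qed
qed

text \<open>The approximation from which the integrator is derived: with \<open>u(s) \<approx> e\<^sup>i\<^sup>s\<^sup>\<Delta>v\<close>, the integrand
  \<open>e\<^sup>-\<^sup>i\<^sup>s\<^sup>\<Delta>(|u|\<^sup>2\<^sup>pu)\<close> of Duhamel's formula is replaced by \<open>v\<^sup>p\<^sup>+\<^sup>1 e\<^sup>-\<^sup>2\<^sup>i\<^sup>s\<^sup>\<Delta>(cnj v)\<^sup>p\<close>, whose integral in \<open>s\<close> is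
  explicit. The free flow is moved through each product in turn. It acts on \<open>v\<close> forwards and on
  \<open>cnj v\<close> backwards in time; the flow \<open>e\<^sup>-\<^sup>i\<^sup>s\<^sup>\<Delta>\<close> in front undoes the former and doubles the latter.\<close>

lemma sobolev_le_frozen_nonlinearity:
  assumes r: "r > real CARD('d::finite) / 2" and \<gamma>: "0 < \<gamma>" "\<gamma> \<le> 1" and p: "p \<ge> 1"
  shows "\<exists>C\<ge>0. \<forall>s (v :: real ^ 'd \<Rightarrow> complex). sobolev_le (r + \<gamma>) R v \<longrightarrow>
    sobolev_le r (C * \<bar>s\<bar> powr \<gamma>) (\<lambda>x. free_flow (- s) (nls_nonlinearity p (free_flow s v)) x
      - v x ^ (p + 1) * free_flow (- 2 * s) (\<lambda>x. cnj (v x) ^ p) x)"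
proof -
  have r\<gamma>: "r + \<gamma> > real CARD('d) / 2" using r \<gamma> by simp
  obtain K where K: "K > 0"
    and mult: "\<And>A B f (g :: real ^ 'd \<Rightarrow> complex). sobolev_le r A f \<Longrightarrow> sobolev_le r B g \<Longrightarrow>
      sobolev_le r (K * A * B) (\<lambda>x. f x * g x)"
    using sobolev_le_mult[OF r] by blast
  obtain K' where K': "K' > 0"
    and comm: "\<And>A B s f (g :: real ^ 'd \<Rightarrow> complex). sobolev_le (r + \<gamma>) A f \<Longrightarrow> sobolev_le (r + \<gamma>) B g \<Longrightarrow>
      sobolev_le r (K' * \<bar>s\<bar> powr \<gamma> * A * B) (\<lambda>x. free_flow s (\<lambda>x. f x * g x) x - free_flow s f x * free_flow s g x)"
    using sobolev_le_free_flow_mult[OF r \<gamma>] by blast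
  obtain A where A: "A \<ge> 0" "\<And>f :: real ^ 'd \<Rightarrow> complex. sobolev_le (r + \<gamma>) R f \<Longrightarrow> sobolev_le (r + \<gamma>) A (\<lambda>x. f x ^ (p + 1))"
    using sobolev_le_power[OF r\<gamma>, of R "p + 1"] by blast
  obtain B where B: "B \<ge> 0" "\<And>f :: real ^ 'd \<Rightarrow> complex. sobolev_le (r + \<gamma>) R f \<Longrightarrow> sobolev_le (r + \<gamma>) B (\<lambda>x. f x ^ p)"
    using sobolev_le_power[OF r\<gamma>, of R p] by blast
  obtain A' where A': "A' \<ge> 0" "\<And>f :: real ^ 'd \<Rightarrow> complex. sobolev_le r R f \<Longrightarrow> sobolev_le r A' (\<lambda>x. f x ^ (p + 1))"
    using sobolev_le_power[OF r, of R "p + 1"] by blast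
  obtain C where C: "C \<ge> 0" "\<And>s (f :: real ^ 'd \<Rightarrow> complex). sobolev_le (r + \<gamma>) R f \<Longrightarrow>
    sobolev_le r (C * \<bar>s\<bar> powr \<gamma>) (\<lambda>x. free_flow s (\<lambda>x. f x ^ (p + 1)) x - free_flow s f x ^ (p + 1))"
    using sobolev_le_free_flow_power[OF r \<gamma>, of R p] by auto
  obtain C' where C': "C' \<ge> 0" "\<And>s (f :: real ^ 'd \<Rightarrow> complex). sobolev_le (r + \<gamma>) R f \<Longrightarrow>
    sobolev_le r (C' * \<bar>s\<bar> powr \<gamma>) (\<lambda>x. free_flow s (\<lambda>x. f x ^ p) x - free_flow s f x ^ p)"
    using sobolev_le_free_flow_power[OF r \<gamma>, of R "p - 1"] p by auto
  show ?thesis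
  proof (intro exI conjI allI impI)
    show "0 \<le> (K * A' * C' + K * C * B) + K' * A * B" using K K' A B A' C C' by simp
    fix s and v :: "real ^ 'd \<Rightarrow> complex" assume v: "sobolev_le (r + \<gamma>) R v"
    define w where "w x = cnj (v x)" for x
    have w: "sobolev_le (r + \<gamma>) R w" unfolding w_def[abs_def] by (rule sobolev_le_cnj[OF v])
    define V W where "V = (\<lambda>x. v x ^ (p + 1))" and "W = (\<lambda>x. w x ^ p)"
    have V: "sobolev_le (r + \<gamma>) A V" and W: "sobolev_le (r + \<gamma>) B W"
      unfolding V_def W_def by (intro A(2)[OF v] B(2)[OF w])+
    have order: "sobolev_le r D f" if "sobolev_le (r + \<gamma>) D f" for D and f :: "real ^ 'd \<Rightarrow> complex"
      using that \<gamma> by (auto intro: sobolev_le_order)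
    have flip: "sobolev_le r D (\<lambda>x. g x - f x)" if "sobolev_le r D (\<lambda>x. f x - g x)" for D and f g :: "real ^ 'd \<Rightarrow> complex"
      using sobolev_le_cmult[OF that, of "- 1"] by simp
    have "nls_nonlinearity p (free_flow s v) = (\<lambda>x. free_flow s v x ^ (p + 1) * free_flow (- s) w x ^ p)"
      using free_flow_cnj[OF v, of "- s"] by (simp add: nls_nonlinearity_eq w_def[abs_def])
    moreover have "sobolev_le r (K * A' * (C' * \<bar>- s\<bar> powr \<gamma>) + K * (C * \<bar>s\<bar> powr \<gamma>) * B)
       (\<lambda>x. free_flow s v x ^ (p + 1) * free_flow (- s) w x ^ p - free_flow s V x * free_flow (- s) W x)"
    proof (rule sobolev_le_mult_diff[OF mult])
      show "sobolev_le r A' (\<lambda>x. free_flow s v x ^ (p + 1))"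
        by (rule A'(2)[OF sobolev_le_free_flow[OF order[OF v]]])
      show "sobolev_le r B (free_flow (- s) W)" by (rule sobolev_le_free_flow[OF order[OF W]])
      show "sobolev_le r (C * \<bar>s\<bar> powr \<gamma>) (\<lambda>x. free_flow s v x ^ (p + 1) - free_flow s V x)"
        unfolding V_def by (rule flip[OF C(2)[OF v]])
      show "sobolev_le r (C' * \<bar>- s\<bar> powr \<gamma>) (\<lambda>x. free_flow (- s) w x ^ p - free_flow (- s) W x)"
        unfolding W_def by (rule flip[OF C'(2)[OF w]])
    qed
    ultimately have N: "sobolev_le r ((K * A' * C' + K * C * B) * \<bar>s\<bar> powr \<gamma>)
       (\<lambda>x. nls_nonlinearity p (free_flow s v) x - free_flow s V x * free_flow (- s) W x)"
      by (simp add: algebra_simps)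
    have SV: "sobolev_le (r + \<gamma>) A (free_flow s V)" and SW: "sobolev_le (r + \<gamma>) B (free_flow (- s) W)"
      by (intro sobolev_le_free_flow V W)+
    have P: "sobolev_le r (K * A * B) (\<lambda>x. free_flow s V x * free_flow (- s) W x)"
      by (intro mult order SV SW)
    obtain D where D: "sobolev_le r D (nls_nonlinearity p (free_flow s v))"
      using sobolev_le_nls_nonlinearity[OF r] sobolev_le_free_flow[OF order[OF v]] by metis
    have "sobolev_le r ((K * A' * C' + K * C * B) * \<bar>s\<bar> powr \<gamma> + K' * \<bar>- s\<bar> powr \<gamma> * A * B)
       (\<lambda>x. (free_flow (- s) (nls_nonlinearity p (free_flow s v)) x
            - free_flow (- s) (\<lambda>x. free_flow s V x * free_flow (- s) W x) x)
        + (free_flow (- s) (\<lambda>x. free_flow s V x * free_flow (- s) W x) x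
            - free_flow (- s) (free_flow s V) x * free_flow (- s) (free_flow (- s) W) x))"
      using sobolev_le_free_flow[OF N, of "- s"] unfolding free_flow_diff[OF D P]
      by (intro sobolev_le_add comm SV SW)
    moreover have "free_flow (- s) (free_flow s V) = V"
      using free_flow_free_flow[OF V, of "- s" s] free_flow_0[OF V] by simp
    moreover have "free_flow (- s) (free_flow (- s) W) = free_flow (- 2 * s) W"
      using free_flow_free_flow[OF W, of "- s" "- s"] by simp
    ultimately show "sobolev_le r (((K * A' * C' + K * C * B) + K' * A * B) * \<bar>s\<bar> powr \<gamma>)
      (\<lambda>x. free_flow (- s) (nls_nonlinearity p (free_flow s v)) x
        - v x ^ (p + 1) * free_flow (- 2 * s) (\<lambda>x. cnj (v x) ^ p) x)"
      by (simp add: V_def W_def w_def algebra_simps)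
  qed
qed

section \<open>Uniqueness of Fourier coefficients\<close>

lemma torus_cell_sets [simp]: "torus_cell \<in> sets lebesgue" "torus_cell \<in> lmeasurable"
  by (simp_all add: torus_cell_def)

lemma compact_torus_cell: "compact torus_cell"
  by (simp add: torus_cell_def)

lemma absolutely_integrable_mult_continuous:
  fixes f g :: "real ^ 'd \<Rightarrow> complex"
  assumes "f absolutely_integrable_on torus_cell" and "continuous_on torus_cell g"
  shows "(\<lambda>x. f x * g x) absolutely_integrable_on torus_cell"
proof -
  have "(\<lambda>x. g x * f x) absolutely_integrable_on torus_cell"
  proof (rule absolutely_integrable_bounded_measurable_product[OF bilinear_times])
    show "g \<in> borel_measurable (lebesgue_on torus_cell)"
      by (rule continuous_imp_measurable_on_sets_lebesgue[OF assms(2)]) simp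
    show "bounded (g ` torus_cell)"
      by (rule compact_imp_bounded[OF compact_continuous_image[OF assms(2) compact_torus_cell]])
  qed (use assms in simp_all)
  then show ?thesis by (simp add: mult.commute)
qed

lemma fourier_coeff_cong_negligible:
  assumes "negligible N" and "\<And>x. x \<in> torus_cell - N \<Longrightarrow> f x = g x"
  shows "fourier_coeff f = fourier_coeff g"
proof
  fix k
  have "integral torus_cell (\<lambda>x. f x * cis (- (freq k \<bullet> x))) = integral torus_cell (\<lambda>x. g x * cis (- (freq k \<bullet> x)))"
    by (rule integral_spike[OF assms(1)]) (use assms(2) in auto)
  then show "fourier_coeff f k = fourier_coeff g k" by (simp add: fourier_coeff_def)
qed

lemma fourier_coeff_diff:
  assumes "f absolutely_integrable_on torus_cell" "g absolutely_integrable_on torus_cell"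
  shows "fourier_coeff (\<lambda>x. f x - g x) k = fourier_coeff f k - fourier_coeff g k"
proof -
  have c: "continuous_on torus_cell (\<lambda>x. cis (- (freq k \<bullet> x)))"
    by (simp add: cis_conv_exp) (intro continuous_intros)
  have "(\<lambda>x. f x * cis (- (freq k \<bullet> x))) integrable_on torus_cell"
    "(\<lambda>x. g x * cis (- (freq k \<bullet> x))) integrable_on torus_cell"
    using absolutely_integrable_mult_continuous[OF _ c] assms set_lebesgue_integral_eq_integral(1) by blast+
  then show ?thesis
    by (simp add: fourier_coeff_def left_diff_distrib integral_diff diff_divide_distrib)
qed

inductive trig_poly :: "(real ^ 'd \<Rightarrow> complex) \<Rightarrow> bool" where
  character: "trig_poly (\<lambda>x. c * cis (freq k \<bullet> x))"
| add: "trig_poly f \<Longrightarrow> trig_poly g \<Longrightarrow> trig_poly (\<lambda>x. f x + g x)"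

lemma trig_poly_const: "trig_poly (\<lambda>_. c)"
  using trig_poly.character[of c 0] by (simp add: freq_zero)

lemma trig_poly_sum: "finite I \<Longrightarrow> (\<And>i. i \<in> I \<Longrightarrow> trig_poly (f i)) \<Longrightarrow> trig_poly (\<lambda>x. \<Sum>i\<in>I. f i x)"
  by (induction I rule: finite_induct) (auto intro: trig_poly_const trig_poly.add)

lemma trig_poly_mult:
  assumes "trig_poly f" and "trig_poly g"
  shows "trig_poly (\<lambda>x. f x * g x)"
  using assms(1)
proof induction
  case (character c k)
  from assms(2) show ?case
  proof induction
    case (character d l)
    show ?case using trig_poly.character[of "c * d" "k + l"] by (simp add: character_add mult_ac)
  qed (auto simp: distrib_left intro: trig_poly.add)
qed (auto simp: distrib_right intro: trig_poly.add)

text \<open>An embedding of the torus in a Euclidean space, where polynomials are dense in the continuous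
  functions on a compact set. Polynomials of the image point are trigonometric polynomials.\<close>

definition circle_map :: "real ^ 'd \<Rightarrow> complex ^ 'd" where
  "circle_map x = (\<chi> j. cis (x $ j))"

lemma continuous_on_circle_map: "continuous_on S circle_map"
  unfolding circle_map_def[abs_def] cis_conv_exp by (intro continuous_intros)

lemma trig_poly_real_polynomial:
  assumes "real_polynomial_function g"
  shows "trig_poly (\<lambda>x :: real ^ 'd. of_real (g (circle_map x)))"
  using assms
proof induction
  case (linear g)
  then interpret bounded_linear g .
  have "circle_map x = (\<Sum>j\<in>UNIV. cos (x $ j) *\<^sub>R axis j 1 + sin (x $ j) *\<^sub>R axis j \<i>)" for x :: "real ^ 'd"
    unfolding vec_eq_iff
    by (auto simp: circle_map_def axis_def if_distrib[of "\<lambda>x. _ *\<^sub>R x"] complex_eq_iff sum.distrib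
        if_distrib[of Re] if_distrib[of Im] cong: if_cong)
  then have g: "g (circle_map x) = (\<Sum>j\<in>UNIV. cos (x $ j) * g (axis j 1) + sin (x $ j) * g (axis j \<i>))" for x :: "real ^ 'd"
    by (simp add: sum add scaleR)
  have c: "trig_poly (\<lambda>x :: real ^ 'd. c * cis (x $ j))" "trig_poly (\<lambda>x :: real ^ 'd. c * cis (- (x $ j)))" for j c
    using trig_poly.character[of c "axis j 1 :: int ^ 'd"] trig_poly.character[of c "axis j (- 1) :: int ^ 'd"]
    by (simp_all add: freq_def inner_vec_def axis_def if_distrib[of "\<lambda>x. real_of_int x * _"]
        if_distrib[of real_of_int] if_distrib[of "\<lambda>x. x * _"] cong: if_cong)
  have "complex_of_real (cos t * a + sin t * b) = (of_real a / 2 - \<i> * of_real b / 2) * cis t + (of_real a / 2 + \<i> * of_real b / 2) * cis (- t)"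
    for t a b :: real
    by (simp add: complex_eq_iff algebra_simps)
  then show ?case
    unfolding g of_real_sum by (auto intro!: trig_poly_sum trig_poly.add c)
qed (auto intro: trig_poly_const trig_poly.add trig_poly_mult)

context
  fixes f :: "real ^ 'd \<Rightarrow> complex"
  assumes f: "f absolutely_integrable_on torus_cell" and zero: "\<And>k. fourier_coeff f k = 0"
begin

lemma orthogonal_trig_poly:
  assumes "trig_poly P"
  shows "((\<lambda>x. f x * P x) has_integral 0) torus_cell"
  using assms
proof induction
  case (character c k)
  have "(\<lambda>x. f x * cis (freq k \<bullet> x)) integrable_on torus_cell"
    using absolutely_integrable_mult_continuous[OF f continuous_on_character] set_lebesgue_integral_eq_integral(1) by blast
  moreover have "integral torus_cell (\<lambda>x. f x * cis (freq k \<bullet> x)) = 0"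
    using zero[of "- k"] by (simp add: fourier_coeff_def freq_minus)
  ultimately have "((\<lambda>x. f x * cis (freq k \<bullet> x)) has_integral 0) torus_cell"
    by (metis integrable_integral)
  from has_integral_mult_right[OF this, of c] show ?case by (simp add: mult_ac)
next
  case (add P Q)
  from has_integral_add[OF add.IH] show ?case by (simp add: distrib_left)
qed

lemma orthogonal_continuous:
  assumes g: "continuous_on (circle_map ` torus_cell) g"
  shows "((\<lambda>x. f x * of_real (g (circle_map x))) has_integral 0) torus_cell"
proof -
  let ?h = "\<lambda>x. f x * of_real (g (circle_map x))"
  let ?S = "circle_map ` torus_cell :: (complex ^ 'd) set"
  have S: "compact ?S" by (intro compact_continuous_image continuous_on_circle_map compact_torus_cell)
  have "continuous_on torus_cell (\<lambda>x. complex_of_real (g (circle_map x)))"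
    by (intro continuous_on_of_real continuous_on_compose2[OF g continuous_on_circle_map]) auto
  then have h: "?h absolutely_integrable_on torus_cell"
    by (rule absolutely_integrable_mult_continuous[OF f])
  then have hi: "?h integrable_on torus_cell" by (rule set_lebesgue_integral_eq_integral(1))
  have fn: "(\<lambda>x. norm (f x)) integrable_on torus_cell"
    using f by (simp add: absolutely_integrable_on_def)
  have "cmod (integral torus_cell ?h) \<le> e * (integral torus_cell (\<lambda>x. norm (f x)))" if e: "e > 0" for e
  proof -
    obtain q where q: "real_polynomial_function q" "\<And>x. x \<in> ?S \<Longrightarrow> \<bar>g x - q x\<bar> < e"
      using Stone_Weierstrass_real_polynomial_function[OF S g e] by metis
    have "((\<lambda>x. ?h x - f x * of_real (q (circle_map x))) has_integral (integral torus_cell ?h - 0)) torus_cell"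
      by (intro has_integral_diff integrable_integral hi orthogonal_trig_poly trig_poly_real_polynomial q)
    then have i: "((\<lambda>x. f x * of_real (g (circle_map x) - q (circle_map x))) has_integral integral torus_cell ?h) torus_cell"
      by (simp add: algebra_simps)
    have "cmod (integral torus_cell ?h) \<le> integral torus_cell (\<lambda>x. e * norm (f x))"
      unfolding integral_unique[OF i, symmetric]
    proof (rule integral_norm_bound_integral)
      fix x :: "real ^ 'd" assume "x \<in> torus_cell"
      then have "\<bar>g (circle_map x) - q (circle_map x)\<bar> \<le> e" using q(2) by (simp add: less_imp_le)
      then show "norm (f x * of_real (g (circle_map x) - q (circle_map x))) \<le> e * norm (f x)"
        unfolding norm_mult norm_of_real by (simp add: mult.commute[of e] mult_left_mono)
    qed (use i integrable_cmul[OF fn, of e] in auto)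
    then show ?thesis by simp
  qed
  then have le: "cmod (integral torus_cell ?h) \<le> e * integral torus_cell (\<lambda>x. norm (f x))" if "e > 0" for e
    using that by blast
  have "((\<lambda>e. e * integral torus_cell (\<lambda>x. norm (f x))) \<longlongrightarrow> 0 * integral torus_cell (\<lambda>x. norm (f x))) (at_right 0)"
    by (intro tendsto_intros)
  then have "cmod (integral torus_cell ?h) \<le> 0 * integral torus_cell (\<lambda>x. norm (f x))"
    by (rule tendsto_lowerbound) (auto simp: eventually_at_right_less intro: eventually_mono[OF eventually_at_right_less le])
  then show ?thesis using integrable_integral[OF hi] by simp
qed

lemma circle_map_inject:
  assumes "x \<in> box 0 (\<chi> j. 2 * pi)" and "y \<in> torus_cell" and "circle_map x = circle_map (y :: real ^ 'd)"
  shows "x = y"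
proof -
  have "x $ j = y $ j" for j
  proof -
    have "cis (x $ j) = cis (y $ j)" using assms(3) by (simp add: circle_map_def vec_eq_iff)
    then have "sin (x $ j) = sin (y $ j) \<and> cos (x $ j) = cos (y $ j)" by (simp add: complex_eq_iff)
    then obtain n where n: "x $ j = y $ j + 2 * pi * real_of_int n"
      unfolding sin_cos_eq_iff by auto
    have "0 < x $ j" "x $ j < 2 * pi" "0 \<le> y $ j" "y $ j \<le> 2 * pi"
      using assms(1,2) by (auto simp: mem_box_cart torus_cell_def)
    then have "2 * pi * real_of_int n < 2 * pi * 1" "2 * pi * (- 1) < 2 * pi * real_of_int n"
      using n by linarith+
    then have "n = 0" by (simp only: mult_less_cancel_left_pos pi_gt_zero zero_less_numeral mult_pos_pos)
    then show ?thesis using n by simp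
  qed
  then show ?thesis by (simp add: vec_eq_iff)
qed

text \<open>The indicator function of a box inside the open cell is the limit of continuous functions of
  the point \<open>circle_map x\<close>, since no point of the cell outside the box has the same image as one inside.\<close>

lemma integral_small_box:
  fixes c d :: "real ^ 'd"
  assumes "cbox c d \<subseteq> box 0 (\<chi> j. 2 * pi)"
  shows "integral (cbox c d) f = 0"
proof -
  let ?V = "box c d"
  have V: "?V \<subseteq> box 0 (\<chi> j. 2 * pi)" using assms box_subset_cbox by blast
  then have V': "?V \<subseteq> torus_cell" using box_subset_cbox unfolding torus_cell_def by blast
  define C where "C = circle_map ` (torus_cell - ?V)"
  have "compact C"
    unfolding C_def by (intro compact_continuous_image continuous_on_circle_map compact_diff compact_torus_cell open_box)
  then have closed: "closed C" by (rule compact_imp_closed)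
  have "(0 :: real ^ 'd) \<in> torus_cell - ?V"
  proof -
    have "(0 :: real ^ 'd) \<notin> box 0 (\<chi> j. 2 * pi)" and "(0 :: real ^ 'd) \<in> torus_cell"
      by (simp_all add: torus_cell_def mem_box_cart)
    then show ?thesis using V by blast
  qed
  then have ne: "C \<noteq> {}" unfolding C_def by blast
  define g where "g n z = min 1 (real n * infdist z C)" for n z
  have g: "0 \<le> g n z" "g n z \<le> 1" for n z by (auto simp: g_def infdist_nonneg)
  have lim: "(\<lambda>n. f x * of_real (g n (circle_map x))) \<longlonglongrightarrow> (if x \<in> ?V then f x else 0)" if x: "x \<in> torus_cell" for x
  proof (cases "x \<in> ?V")
    case True
    have "circle_map x \<notin> C"
    proof
      assume "circle_map x \<in> C"
      then obtain y where "y \<in> torus_cell" "y \<notin> ?V" "circle_map x = circle_map y" by (auto simp: C_def)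
      then show False using circle_map_inject[of x y] V True by auto
    qed
    then have pos: "infdist (circle_map x) C > 0"
      using in_closed_iff_infdist_zero[OF closed ne] infdist_nonneg[of "circle_map x" C] by (simp add: less_le)
    obtain N where N: "real N * infdist (circle_map x) C \<ge> 1"
      using ex_less_of_nat_mult[OF pos, of 1] by (meson less_imp_le)
    have "g n (circle_map x) = 1" if "n \<ge> N" for n
    proof -
      have "1 \<le> real n * infdist (circle_map x) C"
        using N mult_right_mono[of "real N" "real n" "infdist (circle_map x) C"] that pos by linarith
      then show ?thesis by (simp add: g_def)
    qed
    then have "\<forall>\<^sub>F n in sequentially. f x * of_real (g n (circle_map x)) = f x"
      by (auto simp: eventually_sequentially)
    then show ?thesis using True by (simp add: tendsto_eventually)
  next
    case False
    then have "circle_map x \<in> C" using x by (auto simp: C_def)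
    then show ?thesis using False by (simp add: g_def)
  qed
  have int: "((\<lambda>x. f x * of_real (g n (circle_map x))) has_integral 0) torus_cell" for n
    unfolding g_def by (intro orthogonal_continuous continuous_intros)
  have "(\<lambda>n. integral torus_cell (\<lambda>x. f x * of_real (g n (circle_map x)))) \<longlonglongrightarrow>
      integral torus_cell (\<lambda>x. if x \<in> ?V then f x else 0)"
  proof (rule dominated_convergence(2)[where h = "\<lambda>x. norm (f x)"])
    show "(\<lambda>x. norm (f x)) integrable_on torus_cell"
      using f by (simp add: absolutely_integrable_on_def)
    show "norm (f x * of_real (g n (circle_map x))) \<le> norm (f x)" for n x
      using g[of n "circle_map x"] by (simp add: norm_mult mult_left_le)
  qed (use int lim in auto)
  then have "integral torus_cell (\<lambda>x. if x \<in> ?V then f x else 0) = 0"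
    by (simp add: integral_unique[OF int] LIMSEQ_const_iff)
  then have "integral ?V f = 0"
    using integral_restrict_Int[of torus_cell ?V f] V' by (simp add: Int_absorb1 Int_absorb2)
  then show ?thesis by (simp add: integral_open_interval)
qed

text \<open>The integrals over all boxes inside the open cell vanish, and by Lebesgue's differentiation
  theorem the means over shrinking boxes converge to the value of the function at almost every point.\<close>

lemma fourier_uniqueness:
  obtains N where "negligible N" and "\<And>x. x \<in> torus_cell - N \<Longrightarrow> f x = 0"
proof -
  define F where "F x = (if x \<in> torus_cell then f x else 0)" for x
  have "F absolutely_integrable_on UNIV"
    using f unfolding F_def[abs_def] by (simp add: absolutely_integrable_restrict_UNIV)
  then have "F integrable_on cbox a b" for a b
    by (meson absolutely_integrable_on_subcbox set_lebesgue_integral_eq_integral(1) subset_UNIV integrable_on_subcbox)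
  from integrable_ccontinuous_explicit[OF this] obtain N where N: "negligible N"
    "\<And>x e. x \<notin> N \<Longrightarrow> 0 < e \<Longrightarrow> \<exists>d>0. \<forall>h. 0 < h \<and> h < d \<longrightarrow>
       norm (integral (cbox x (x + h *\<^sub>R One)) F /\<^sub>R h ^ DIM(real ^ 'd) - F x) < e"
    by metis
  let ?B = "box 0 (\<chi> j. 2 * pi) :: (real ^ 'd) set"
  have "f x = 0" if x: "x \<in> ?B" "x \<notin> N" for x
  proof -
    have "norm (F x) < e" if e: "e > 0" for e
    proof -
      obtain d where d: "d > 0" "\<And>h. 0 < h \<Longrightarrow> h < d \<Longrightarrow>
         norm (integral (cbox x (x + h *\<^sub>R One)) F /\<^sub>R h ^ DIM(real ^ 'd) - F x) < e"
        using N(2)[OF x(2) e] by blast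
      obtain \<epsilon> where \<epsilon>: "\<epsilon> > 0" "ball x \<epsilon> \<subseteq> ?B"
        using open_contains_ball[of ?B] open_box x(1) by blast
      define h where "h = min (d / 2) (\<epsilon> / (2 * (norm (One :: real ^ 'd) + 1)))"
      have n1: "norm (One :: real ^ 'd) + 1 > 0" by (simp add: add_nonneg_pos)
      have h: "0 < h" "h < d" using d(1) \<epsilon>(1) n1 by (auto simp: h_def min_less_iff_disj)
      have sub: "cbox x (x + h *\<^sub>R One) \<subseteq> ?B"
      proof
        fix y assume y: "y \<in> cbox x (x + h *\<^sub>R One)"
        have "norm (y - x) \<le> norm (h *\<^sub>R One :: real ^ 'd)"
          using y by (intro norm_le_componentwise) (auto simp: mem_box inner_diff_left inner_add_left)
        also have "\<dots> = h * norm (One :: real ^ 'd)" using h by simp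
        also have "\<dots> < \<epsilon>"
        proof -
          have "h \<le> \<epsilon> / (2 * (norm (One :: real ^ 'd) + 1))" by (simp add: h_def)
          then have "h * (2 * (norm (One :: real ^ 'd) + 1)) \<le> \<epsilon>" using n1 by (simp add: field_simps)
          moreover have "h * (2 * (norm (One :: real ^ 'd) + 1)) = 2 * (h * norm (One :: real ^ 'd)) + 2 * h"
            by (simp add: algebra_simps)
          moreover have "0 \<le> h * norm (One :: real ^ 'd)" using h by simp
          ultimately show ?thesis using h by linarith
        qed
        finally show "y \<in> ?B" using \<epsilon>(2) by (auto simp: dist_norm norm_minus_commute)
      qed
      have "integral (cbox x (x + h *\<^sub>R One)) F = integral (cbox x (x + h *\<^sub>R One)) f"
        by (rule integral_cong) (use sub box_subset_cbox in \<open>force simp: F_def torus_cell_def\<close>)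
      also have "\<dots> = 0" by (rule integral_small_box[OF sub])
      finally show ?thesis using d(2)[OF h] by simp
    qed
    then have "F x = 0" by (metis less_irrefl zero_less_norm_iff)
    moreover have "x \<in> torus_cell" using x box_subset_cbox unfolding torus_cell_def by blast
    ultimately show ?thesis by (simp add: F_def)
  qed
  moreover have "negligible (N \<union> (torus_cell - ?B))"
    unfolding torus_cell_def by (intro negligible_Un N negligible_frontier_interval)
  ultimately show ?thesis by (intro that[of "N \<union> (torus_cell - ?B)"]) auto
qed

end

lemma L2_torus_absolutely_integrable:
  assumes "f \<in> L2_torus"
  shows "f absolutely_integrable_on torus_cell"
proof (rule measurable_bounded_by_integrable_imp_absolutely_integrable)
  show "f \<in> borel_measurable (lebesgue_on torus_cell)"
    using assms by (auto simp: L2_torus_def measurable_restrict_space1)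
  show "(\<lambda>x. 1 + (cmod (f x))\<^sup>2) integrable_on torus_cell"
    using assms by (intro integrable_add set_lebesgue_integral_eq_integral(1))
      (auto simp: L2_torus_def torus_cell_def absolutely_integrable_continuous)
  show "norm (f x) \<le> 1 + (cmod (f x))\<^sup>2" for x
    using zero_le_power2[of "cmod (f x) - 1 / 2"] zero_le_power2[of "cmod (f x)"]
    unfolding power2_diff by (simp add: power_divide)
qed simp

lemma L2_torus_eq_fourier_series:
  assumes f: "f \<in> L2_torus" and s: "abs_summable (fourier_coeff f)"
  obtains N where "negligible N" and "\<And>x. x \<in> torus_cell - N \<Longrightarrow> f x = fourier_series (fourier_coeff f) x"
proof -
  let ?g = "fourier_series (fourier_coeff f)"
  have g: "?g absolutely_integrable_on torus_cell"
    unfolding torus_cell_def by (intro absolutely_integrable_continuous continuous_on_fourier_series s)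
  have fi: "f absolutely_integrable_on torus_cell" by (rule L2_torus_absolutely_integrable[OF f])
  have "fourier_coeff (\<lambda>x. f x - ?g x) k = 0" for k
    by (simp add: fourier_coeff_diff[OF fi g] fourier_coeff_fourier_series[OF s])
  from fourier_uniqueness[OF set_integral_diff(1)[OF fi g] this]
  show ?thesis using that by (metis right_minus_eq)
qed

section \<open>Duhamel's formula for Fourier coefficients\<close>

text \<open>Functions that are measurable in the first and continuous in the second variable are jointly
  measurable: they are limits of functions that are piecewise constant in the second
  variable, on a grid with countably many cells.\<close>

lemma borel_measurable_caratheodory:
  fixes h :: "'a \<Rightarrow> real ^ 'd \<Rightarrow> complex"
  assumes meas: "\<And>x. (\<lambda>s. h s x) \<in> borel_measurable M"
    and cont: "\<And>s. s \<in> space M \<Longrightarrow> continuous_on UNIV (h s)"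
  shows "(\<lambda>(s, x). h s x) \<in> borel_measurable (M \<Otimes>\<^sub>M borel)"
proof (rule borel_measurable_LIMSEQ_metric)
  define ix :: "nat \<Rightarrow> real ^ 'd \<Rightarrow> int ^ 'd" where "ix n x = (\<chi> j. \<lfloor>real (Suc n) * x $ j\<rfloor>)" for n x
  have ix: "ix n \<in> measurable borel (count_space UNIV)" for n
  proof (subst measurable_count_space_eq2_countable)
    have "ix n -` {k} = {x. \<forall>j. real_of_int (k $ j) \<le> real (Suc n) * x $ j \<and> real (Suc n) * x $ j < real_of_int (k $ j) + 1}" for k
      by (auto simp: ix_def vec_eq_iff floor_eq_iff)
    moreover have "{x :: real ^ 'd. \<forall>j. real_of_int (k $ j) \<le> real (Suc n) * x $ j \<and> real (Suc n) * x $ j < real_of_int (k $ j) + 1} \<in> sets borel" for k :: "int ^ 'd"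
      by measurable
    ultimately show "ix n \<in> space borel \<rightarrow> UNIV \<and> (\<forall>k\<in>UNIV. ix n -` {k} \<inter> space borel \<in> sets borel)"
      by simp
  qed
  show "(\<lambda>(s, x). h s ((1 / real (Suc n)) *\<^sub>R freq (ix n x))) \<in> borel_measurable (M \<Otimes>\<^sub>M borel)" for n
    unfolding case_prod_unfold
  proof (rule measurable_compose_countable[where f = "\<lambda>k sx. h (fst sx) ((1 / real (Suc n)) *\<^sub>R freq k)"])
    show "(\<lambda>sx. h (fst sx) ((1 / real (Suc n)) *\<^sub>R freq k)) \<in> borel_measurable (M \<Otimes>\<^sub>M borel)" for k
      by (rule measurable_compose[OF measurable_fst meas])
    show "(\<lambda>sx. ix n (snd sx)) \<in> measurable (M \<Otimes>\<^sub>M borel) (count_space UNIV)"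
      by (rule measurable_compose[OF measurable_snd ix])
  qed
  fix sx assume "sx \<in> space (M \<Otimes>\<^sub>M (borel :: (real ^ 'd) measure))"
  then obtain s x where sx: "sx = (s, x)" "s \<in> space M" by (auto simp: space_pair_measure)
  have "(\<lambda>n. (1 / real (Suc n)) *\<^sub>R freq (ix n x)) \<longlonglongrightarrow> x"
  proof (rule vec_tendstoI)
    fix j
    have "(\<lambda>n. x $ j - inverse (real (Suc n))) \<longlonglongrightarrow> x $ j - 0"
      by (intro tendsto_intros LIMSEQ_inverse_real_of_nat)
    then have lower: "(\<lambda>n. x $ j - inverse (real (Suc n))) \<longlonglongrightarrow> x $ j" by simp
    have bounds: "x $ j - inverse (real (Suc n)) \<le> ((1 / real (Suc n)) *\<^sub>R freq (ix n x)) $ j"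
      "((1 / real (Suc n)) *\<^sub>R freq (ix n x)) $ j \<le> x $ j" for n
    proof -
      define m where "m = real (Suc n)"
      have m: "m > 0" by (simp add: m_def)
      have eq: "((1 / real (Suc n)) *\<^sub>R freq (ix n x)) $ j = of_int \<lfloor>m * x $ j\<rfloor> / m"
        by (simp add: freq_def ix_def m_def)
      have "x $ j - inverse (real (Suc n)) = (m * x $ j - 1) / m"
        using m by (simp add: diff_divide_distrib inverse_eq_divide m_def)
      also have "\<dots> \<le> of_int \<lfloor>m * x $ j\<rfloor> / m"
        using m by (intro divide_right_mono) linarith+
      finally show "x $ j - inverse (real (Suc n)) \<le> ((1 / real (Suc n)) *\<^sub>R freq (ix n x)) $ j"
        by (simp only: eq)
      show "((1 / real (Suc n)) *\<^sub>R freq (ix n x)) $ j \<le> x $ j"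
        unfolding eq using m by (simp add: pos_divide_le_eq mult.commute)
    qed
    show "(\<lambda>n. ((1 / real (Suc n)) *\<^sub>R freq (ix n x)) $ j) \<longlonglongrightarrow> x $ j"
      by (rule tendsto_sandwich[OF _ _ lower tendsto_const]) (simp_all only: bounds eventually_True)
  qed
  moreover have "isCont (h s) x" using cont[OF sx(2)] by (simp add: continuous_on_eq_continuous_at)
  ultimately show "(\<lambda>n. case sx of (s, x) \<Rightarrow> h s ((1 / real (Suc n)) *\<^sub>R freq (ix n x))) \<longlonglongrightarrow> (case sx of (s, x) \<Rightarrow> h s x)"
    unfolding sx prod.case by (rule isCont_tendsto_compose[rotated])
qed

text \<open>Fubini's theorem: taking a Fourier coefficient commutes with a time integral that is
  defined pointwise in \<open>x\<close>. Continuity in \<open>x\<close> supplies the joint measurability, and the uniform bound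
  the integrability on a domain of finite measure.\<close>

lemma
  fixes h :: "real \<Rightarrow> real ^ 'd \<Rightarrow> complex"
  assumes int: "\<And>x. (\<lambda>s. h s x) absolutely_integrable_on {a..b}"
    and cont: "\<And>s. s \<in> {a..b} \<Longrightarrow> continuous_on UNIV (h s)"
    and bound: "\<And>s x. s \<in> {a..b} \<Longrightarrow> cmod (h s x) \<le> C"
  shows integral_absolutely_integrable_on_cell:
      "(\<lambda>x. integral {a..b} (\<lambda>s. h s x)) absolutely_integrable_on torus_cell"
    and fourier_coeff_integrable: "(\<lambda>s. fourier_coeff (h s) k) integrable_on {a..b}"
    and fourier_coeff_integral:
      "fourier_coeff (\<lambda>x. integral {a..b} (\<lambda>s. h s x)) k = integral {a..b} (\<lambda>s. fourier_coeff (h s) k)"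
proof -
  let ?M1 = "lebesgue_on {a..b}" and ?M2 = "lebesgue_on torus_cell :: (real ^ 'd) measure"
  interpret M1: finite_measure ?M1 by (rule finite_measure_lebesgue_on) simp
  interpret M2: finite_measure ?M2 by (rule finite_measure_lebesgue_on) simp
  interpret pair_sigma_finite ?M1 ?M2 ..
  interpret P: finite_measure "?M1 \<Otimes>\<^sub>M ?M2" 
    by (rule finite_measure_pair_measure) unfold_locales
  have meas1: "(\<lambda>s. h s x) \<in> borel_measurable ?M1" for x
    using int[of x] by (simp add: absolutely_integrable_measurable)
  have id2: "(\<lambda>x. x) \<in> measurable ?M2 borel"
    by (rule continuous_imp_measurable_on_sets_lebesgue) (auto intro: continuous_intros)
  have "(\<lambda>(s, x). h s x) \<in> borel_measurable (?M1 \<Otimes>\<^sub>M borel)"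
    by (rule borel_measurable_caratheodory[OF meas1 cont]) simp
  moreover have "(\<lambda>sx. (fst sx, snd sx)) \<in> measurable (?M1 \<Otimes>\<^sub>M ?M2) (?M1 \<Otimes>\<^sub>M borel)"
    by (intro measurable_Pair measurable_fst measurable_compose[OF measurable_snd id2])
  ultimately have meas: "(\<lambda>(s, x). h s x) \<in> borel_measurable (?M1 \<Otimes>\<^sub>M ?M2)"
    using measurable_compose by (fastforce simp: case_prod_unfold)
  have char: "(\<lambda>x. cis (- (freq k \<bullet> x))) \<in> borel_measurable ?M2" for k
    by (rule continuous_imp_measurable_on_sets_lebesgue) (auto simp: cis_conv_exp intro!: continuous_intros)
  have integrable: "integrable (?M1 \<Otimes>\<^sub>M ?M2) (\<lambda>(s, x). h s x * cis (- (freq k \<bullet> x)))" for k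
  proof (rule P.integrable_const_bound)
    show "AE sx in ?M1 \<Otimes>\<^sub>M ?M2. norm (case sx of (s, x) \<Rightarrow> h s x * cis (- (freq k \<bullet> x))) \<le> C"
      by (rule AE_I2) (auto simp: space_pair_measure norm_mult bound)
    show "(\<lambda>(s, x). h s x * cis (- (freq k \<bullet> x))) \<in> borel_measurable (?M1 \<Otimes>\<^sub>M ?M2)"
      using borel_measurable_times[OF meas measurable_compose[OF measurable_snd char[of k]]]
      by (simp add: case_prod_unfold)
  qed
  have inner1: "(LINT s|?M1. h s x * c) = integral {a..b} (\<lambda>s. h s x) * c" for x c
    using int[of x] by (simp add: absolutely_integrable_imp_integrable lebesgue_integral_eq_integral)
  have inner2: "(LINT x|?M2. h s x * cis (- (freq k \<bullet> x))) = fourier_coeff (h s) k * of_real ((2 * pi) ^ CARD('d))"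
    if "s \<in> {a..b}" for s k
  proof -
    have "(\<lambda>x. h s x * cis (- (freq k \<bullet> x))) absolutely_integrable_on torus_cell"
      unfolding torus_cell_def
      by (intro absolutely_integrable_continuous continuous_intros continuous_on_subset[OF cont[OF that]])
        (auto simp: cis_conv_exp intro!: continuous_intros)
    then have "(LINT x|?M2. h s x * cis (- (freq k \<bullet> x))) = integral torus_cell (\<lambda>x. h s x * cis (- (freq k \<bullet> x)))"
      by (simp add: absolutely_integrable_imp_integrable lebesgue_integral_eq_integral)
    then show ?thesis by (simp add: fourier_coeff_def)
  qed
  have outer2: "integrable ?M2 (\<lambda>x. integral {a..b} (\<lambda>s. h s x) * cis (- (freq k \<bullet> x)))" for k
    using integrable_snd[OF integrable[of k]] unfolding inner1 .
  have "integrable ?M1 (\<lambda>s. LINT x|?M2. h s x * cis (- (freq k \<bullet> x)))"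
    using integrable_fst[OF integrable[of k]] .
  then have outer1: "integrable ?M1 (\<lambda>s. fourier_coeff (h s) k * of_real ((2 * pi) ^ CARD('d)))"
    by (rule Bochner_Integration.integrable_cong[THEN iffD1, rotated 2]) (auto simp: inner2)
  then have "integrable ?M1 (\<lambda>s. fourier_coeff (h s) k)"
  proof -
    define W where "W = complex_of_real ((2 * pi) ^ CARD('d))"
    have "W \<noteq> 0" by (simp add: W_def)
    then show ?thesis using integrable_divide[OF outer1[folded W_def], of W] by simp
  qed
  then show int1: "(\<lambda>s. fourier_coeff (h s) k) integrable_on {a..b}"
    by (rule integrable_on_lebesgue_on) simp
  show "(\<lambda>x. integral {a..b} (\<lambda>s. h s x)) absolutely_integrable_on torus_cell"
  proof -
    have "integrable ?M2 (\<lambda>x. integral {a..b} (\<lambda>s. h s x))" using outer2[of 0] by (simp add: freq_zero)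
    then show ?thesis
      unfolding absolutely_integrable_measurable[OF torus_cell_sets(1)] o_def
      by (intro conjI borel_measurable_integrable integrable_norm)
  qed
  have "integral torus_cell (\<lambda>x. integral {a..b} (\<lambda>s. h s x) * cis (- (freq k \<bullet> x)))
      = (LINT x|?M2. integral {a..b} (\<lambda>s. h s x) * cis (- (freq k \<bullet> x)))"
    using outer2 by (simp add: lebesgue_integral_eq_integral)
  also have "\<dots> = (LINT x|?M2. LINT s|?M1. h s x * cis (- (freq k \<bullet> x)))"
    by (simp only: inner1)
  also have "\<dots> = (LINT s|?M1. LINT x|?M2. h s x * cis (- (freq k \<bullet> x)))"
    using Fubini_integral[OF integrable[of k]] .
  also have "\<dots> = (LINT s|?M1. fourier_coeff (h s) k * of_real ((2 * pi) ^ CARD('d)))"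
    by (rule Bochner_Integration.integral_cong) (auto simp: inner2)
  also have "\<dots> = integral {a..b} (\<lambda>s. fourier_coeff (h s) k * of_real ((2 * pi) ^ CARD('d)))"
    by (rule lebesgue_integral_eq_integral[OF outer1]) simp
  also have "\<dots> = integral {a..b} (\<lambda>s. fourier_coeff (h s) k) * of_real ((2 * pi) ^ CARD('d))"
    by simp
  finally show "fourier_coeff (\<lambda>x. integral {a..b} (\<lambda>s. h s x)) k = integral {a..b} (\<lambda>s. fourier_coeff (h s) k)"
    by (simp add: fourier_coeff_def)
qed

text \<open>Minkowski's inequality, by duality: the squared norm of the integral is the integral of the
  inner products of the integrand with the integral.\<close>

lemma weighted_l2_le_integral:
  assumes int: "\<And>k. (\<lambda>s. c s k) integrable_on {a..b}" and "a \<le> b"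
    and c: "\<And>s. s \<in> {a..b} \<Longrightarrow> weighted_l2_le r B (c s)"
  shows "weighted_l2_le r ((b - a) * B) (\<lambda>k. integral {a..b} (\<lambda>s. c s k))"
proof (rule weighted_l2_leI)
  fix K :: "(int ^ 'a) set" assume K: "finite K"
  define I where "I k = integral {a..b} (\<lambda>s. c s k)" for k
  define X where "X = L2_set (\<lambda>k. weight k powr r * cmod (I k)) K"
  have X: "X \<ge> 0" by (simp add: X_def)
  have B: "B \<ge> 0" using c[of a] \<open>a \<le> b\<close> weighted_l2_le_nonneg by auto
  define F where "F s = (\<Sum>k\<in>K. of_real ((weight k powr r)\<^sup>2) * cnj (I k) * c s k)" for s
  have F: "(F has_integral (\<Sum>k\<in>K. of_real ((weight k powr r)\<^sup>2) * cnj (I k) * I k)) (cbox a b)"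
    unfolding F_def I_def using int K
    by (intro has_integral_sum has_integral_mult_right) (auto intro: integrable_integral)
  have "(\<Sum>k\<in>K. of_real ((weight k powr r)\<^sup>2) * cnj (I k) * I k) = of_real (\<Sum>k\<in>K. (weight k powr r * cmod (I k))\<^sup>2)"
    unfolding of_real_sum
    by (intro sum.cong refl) (simp add: power_mult_distrib complex_norm_square mult_ac flip: of_real_power)
  also have "(\<Sum>k\<in>K. (weight k powr r * cmod (I k))\<^sup>2) = X\<^sup>2"
    by (simp add: X_def L2_set_def sum_nonneg)
  finally have F': "(F has_integral of_real (X\<^sup>2)) (cbox a b)" using F by simp
  have "cmod (of_real (X\<^sup>2)) \<le> (X * B) * measure lborel (cbox a b)"
  proof (rule has_integral_bound[OF _ F'])
    fix s assume "s \<in> cbox a b"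
    then have s: "s \<in> {a..b}" by simp
    have "cmod (F s) \<le> (\<Sum>k\<in>K. cmod (of_real ((weight k powr r)\<^sup>2) * cnj (I k) * c s k))"
      unfolding F_def by (rule norm_sum)
    also have "\<dots> = (\<Sum>k\<in>K. \<bar>weight k powr r * cmod (I k)\<bar> * \<bar>weight k powr r * cmod (c s k)\<bar>)"
      by (intro sum.cong refl) (simp add: norm_mult power2_eq_square abs_mult)
    also have "\<dots> \<le> X * L2_set (\<lambda>k. weight k powr r * cmod (c s k)) K"
      unfolding X_def by (rule L2_set_mult_ineq)
    also have "\<dots> \<le> X * B" using X by (intro mult_left_mono weighted_l2_leD[OF c[OF s] K])
    finally show "norm (F s) \<le> X * B" .
  qed (use X B in simp)
  then have "X * X \<le> X * ((b - a) * B)"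
    using \<open>a \<le> b\<close> by (simp add: power2_eq_square mult_ac norm_mult)
  then have "X \<le> (b - a) * B"
    using X B \<open>a \<le> b\<close> by (cases "X = 0") auto
  then show "L2_set (\<lambda>k. weight k powr r * cmod (integral {a..b} (\<lambda>s. c s k))) K \<le> (b - a) * B"
    by (simp add: X_def I_def)
qed

lemma fourier_coeff_cmult: "fourier_coeff (\<lambda>x. c * f x) k = c * fourier_coeff f k"
  by (simp add: fourier_coeff_def mult.assoc)

lemma free_flow_eq_fourier_series:
  "free_flow t f = fourier_series (\<lambda>k. cis (- (t * (norm (freq k))\<^sup>2)) * fourier_coeff f k)"
  by (rule ext) (simp only: free_flow_def laplace_fun_def fourier_series_def free_flow_symbol)

definition continuous_rep :: "(real ^ 'd \<Rightarrow> complex) \<Rightarrow> real ^ 'd \<Rightarrow> complex" where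
  "continuous_rep f = fourier_series (fourier_coeff f)"

lemma sobolev_imp_continuous_rep:
  fixes f :: "real ^ 'd \<Rightarrow> complex"
  assumes \<sigma>: "\<sigma> > real CARD('d::finite) / 2" and f: "f \<in> sobolev \<sigma>" and M: "sobolev_norm \<sigma> f \<le> M"
  shows "sobolev_le \<sigma> M (continuous_rep f)" and "abs_summable (fourier_coeff f)"
    and "\<exists>N. negligible N \<and> (\<forall>x\<in>torus_cell - N. f x = continuous_rep f x)"
proof -
  have "sobolev_norm \<sigma> f \<ge> 0" by (simp add: sobolev_norm_def infsum_nonneg)
  then have l2: "weighted_l2_le \<sigma> M (fourier_coeff f)"
    using f M order_trans[of 0 "sobolev_norm \<sigma> f" M] by (simp add: weighted_l2_le_iff sobolev_def sobolev_norm_def weight_def)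
  then show "sobolev_le \<sigma> M (continuous_rep f)"
    unfolding continuous_rep_def by (rule sobolev_leI[OF \<sigma>])
  show s: "abs_summable (fourier_coeff f)"
    using weighted_l2_le_abs_sum[OF \<sigma>] l2 by metis
  show "\<exists>N. negligible N \<and> (\<forall>x\<in>torus_cell - N. f x = continuous_rep f x)"
    using L2_torus_eq_fourier_series[OF _ s] f unfolding sobolev_def continuous_rep_def
    by (metis (no_types, lifting) mem_Collect_eq)
qed

lemma fourier_coeff_nonlinearity_rep:
  fixes f :: "real ^ 'd \<Rightarrow> complex"
  assumes "\<sigma> > real CARD('d::finite) / 2" and "f \<in> sobolev \<sigma>"
  shows "fourier_coeff (nls_nonlinearity p f) = fourier_coeff (nls_nonlinearity p (continuous_rep f))"
proof -
  obtain N where N: "negligible N" "\<forall>x\<in>torus_cell - N. f x = continuous_rep f x"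
    using sobolev_imp_continuous_rep(3)[OF assms order_refl] by blast
  show ?thesis
    by (rule fourier_coeff_cong_negligible[OF N(1)]) (use N(2) in \<open>simp add: nls_nonlinearity_def\<close>)
qed

context
  fixes p :: nat and \<mu> \<sigma> T M B :: real and u :: "real \<Rightarrow> real ^ 'd \<Rightarrow> complex"
  assumes \<sigma>: "\<sigma> > real CARD('d::finite) / 2"
    and mild: "mild_nls_solution p \<mu> \<sigma> T u"
    and M: "\<And>t. t \<in> {0..T} \<Longrightarrow> sobolev_norm \<sigma> (u t) \<le> M"
    and B: "\<And>f :: real ^ 'd \<Rightarrow> complex. sobolev_le \<sigma> M f \<Longrightarrow> sobolev_le \<sigma> B (nls_nonlinearity p f)"
begin

lemma u_sobolev: "t \<in> {0..T} \<Longrightarrow> u t \<in> sobolev \<sigma>"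
  using mild by (simp add: mild_nls_solution_def)

lemma nonlinearity_sobolev_le:
  assumes "t \<in> {0..T}"
  shows "sobolev_le \<sigma> B (nls_nonlinearity p (continuous_rep (u t)))"
  by (rule B[OF sobolev_imp_continuous_rep(1)[OF \<sigma> u_sobolev[OF assms] M[OF assms]]])

text \<open>The nonlinear terms are uniformly bounded in the algebra \<open>H\<^sup>\<sigma>\<close>, hence so are the suprema of their
  free evolutions, and Fubini's theorem turns Duhamel's formula into one for each coefficient.\<close>

lemma fourier_coeff_duhamel_0:
  assumes t: "t \<in> {0..T}"
  defines "g \<equiv> \<lambda>s k. cis (- ((t - s) * (norm (freq k))\<^sup>2)) * fourier_coeff (nls_nonlinearity p (u s)) k"
  shows "(\<lambda>s. g s k) integrable_on {0..t}"
    and "fourier_coeff (u t) k = cis (- (t * (norm (freq k))\<^sup>2)) * fourier_coeff (u 0) k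
      - \<i> * of_real \<mu> * integral {0..t} (\<lambda>s. g s k)"
proof -
  define h where "h s = free_flow (t - s) (nls_nonlinearity p (u s))" for s
  obtain C where C: "\<And>A (a :: int ^ 'd \<Rightarrow> complex). weighted_l2_le \<sigma> A a \<Longrightarrow> abs_summable a"
    "\<And>A (a :: int ^ 'd \<Rightarrow> complex). weighted_l2_le \<sigma> A a \<Longrightarrow> (\<Sum>\<^sub>\<infinity>k. cmod (a k)) \<le> C * A"
    using weighted_l2_le_abs_sum[OF \<sigma>] by metis
  have h: "h s = fourier_series (g s)" for s
    by (simp add: h_def free_flow_eq_fourier_series g_def)
  have g: "weighted_l2_le \<sigma> B (g s)" if "s \<in> {0..t}" for s
  proof -
    have s: "s \<in> {0..T}" using that t by auto
    have "weighted_l2_le \<sigma> B (fourier_coeff (nls_nonlinearity p (u s)))"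
      unfolding fourier_coeff_nonlinearity_rep[OF \<sigma> u_sobolev[OF s]]
      by (rule sobolev_le_fourier_coeff(1)[OF nonlinearity_sobolev_le[OF s]])
    then show ?thesis unfolding g_def by (rule weighted_l2_le_multiplier) simp
  qed
  have int: "(\<lambda>s. h s x) absolutely_integrable_on {0..t}" for x
    using mild t unfolding mild_nls_solution_def h_def by blast
  have cont: "continuous_on UNIV (h s)" if "s \<in> {0..t}" for s
    unfolding h by (rule continuous_on_fourier_series[OF C(1)[OF g[OF that]]])
  have bound: "cmod (h s x) \<le> C * B" if "s \<in> {0..t}" for s x
    unfolding h using norm_fourier_series_le[OF C(1)[OF g[OF that]], of x] C(2)[OF g[OF that]] by linarith
  have coeff: "fourier_coeff (h s) k = g s k" if "s \<in> {0..t}" for s k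
    unfolding h using fourier_coeff_fourier_series[OF C(1)[OF g[OF that]]] by simp
  show "(\<lambda>s. g s k) integrable_on {0..t}"
    by (rule integrable_eq[OF fourier_coeff_integrable[OF int cont bound]]) (simp_all add: coeff)
  let ?H = "\<lambda>x. integral {0..t} (\<lambda>s. h s x)" and ?c = "\<i> * complex_of_real \<mu>"
  have H: "?H absolutely_integrable_on torus_cell"
    by (rule integral_absolutely_integrable_on_cell[OF int cont bound])
  have s0: "abs_summable (fourier_coeff (u 0))"
    using t by (intro sobolev_imp_continuous_rep(2)[OF \<sigma> u_sobolev order_refl]) auto
  have "AE x in lebesgue. u t x = free_flow t (u 0) x - ?c * ?H x"
    using mild t unfolding mild_nls_solution_def h_def by blast
  then obtain N where N: "N \<in> null_sets lebesgue" "{x. u t x \<noteq> free_flow t (u 0) x - ?c * ?H x} \<subseteq> N"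
    by (auto simp: eventually_ae_filter)
  have "fourier_coeff (u t) k = fourier_coeff (\<lambda>x. free_flow t (u 0) x - ?c * ?H x) k"
    by (rule fun_cong[OF fourier_coeff_cong_negligible[of N]]) (use N in \<open>auto simp: negligible_iff_null_sets\<close>)
  also have "\<dots> = fourier_coeff (free_flow t (u 0)) k - fourier_coeff (\<lambda>x. ?c * ?H x) k"
  proof (rule fourier_coeff_diff)
    show "free_flow t (u 0) absolutely_integrable_on torus_cell"
      unfolding free_flow_eq_fourier_series torus_cell_def
      by (intro absolutely_integrable_continuous continuous_on_fourier_series) (simp add: norm_mult s0)
    show "(\<lambda>x. ?c * ?H x) absolutely_integrable_on torus_cell"
      using H by (rule set_integrable_mult_right)
  qed
  also have "fourier_coeff (free_flow t (u 0)) k = cis (- (t * (norm (freq k))\<^sup>2)) * fourier_coeff (u 0) k"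
    unfolding free_flow_eq_fourier_series by (subst fourier_coeff_fourier_series) (simp_all add: norm_mult s0)
  also have "fourier_coeff (\<lambda>x. ?c * ?H x) k = ?c * integral {0..t} (\<lambda>s. g s k)"
  proof -
    have "integral {0..t} (\<lambda>s. fourier_coeff (h s) k) = integral {0..t} (\<lambda>s. g s k)"
      by (rule Henstock_Kurzweil_Integration.integral_cong) (simp add: coeff)
    then show ?thesis using fourier_coeff_integral[OF int cont bound, of k] by (simp add: fourier_coeff_cmult)
  qed
  finally show "fourier_coeff (u t) k = cis (- (t * (norm (freq k))\<^sup>2)) * fourier_coeff (u 0) k
      - \<i> * of_real \<mu> * integral {0..t} (\<lambda>s. g s k)" .
qed

text \<open>The twisted coefficient \<open>e\<^sup>i\<^sup>t\<^sup>q \<cdot> fourier_coeff (u t) k\<close> with \<open>q = |k|\<^sup>2\<close> differs from its initial value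
  by the integral of a function that does not depend on \<open>t\<close>. The formula can therefore be started
  at any time.\<close>

lemma fourier_coeff_duhamel:
  assumes t: "0 \<le> t" and \<tau>: "0 \<le> \<tau>" and T: "t + \<tau> \<le> T"
  defines "g \<equiv> \<lambda>s k. cis (s * (norm (freq k))\<^sup>2) * fourier_coeff (nls_nonlinearity p (u (t + s))) k"
  shows "(\<lambda>s. g s k) integrable_on {0..\<tau>}"
    and "fourier_coeff (u (t + \<tau>)) k = cis (- (\<tau> * (norm (freq k))\<^sup>2)) *
      (fourier_coeff (u t) k - \<i> * of_real \<mu> * integral {0..\<tau>} (\<lambda>s. g s k))"
proof -
  define q where "q = (norm (freq k))\<^sup>2"
  define n where "n s = fourier_coeff (nls_nonlinearity p (u s)) k" for s
  define f where "f s = cis (s * q) * n s" for s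
  let ?c = "\<i> * complex_of_real \<mu>"
  have split: "cis (- ((t' - s) * q)) * n s = cis (- (t' * q)) * f s" for t' s
    by (simp add: f_def mult.assoc[symmetric] cis_mult left_diff_distrib)
  have cancel: "cis x * (cis (- x) * y) = y" "cis (- x) * (cis x * y) = y" for x y
    by (simp_all add: mult.assoc[symmetric] cis_mult)
  have f_int: "f integrable_on {0..t'}"
    and V: "fourier_coeff (u t') k = cis (- (t' * q)) * (fourier_coeff (u 0) k - ?c * integral {0..t'} f)"
    if "t' \<in> {0..T}" for t'
  proof -
    note D = fourier_coeff_duhamel_0[OF that, of k, folded q_def n_def, unfolded split]
    show "f integrable_on {0..t'}"
      using integrable_on_mult_right[OF D(1), of "cis (t' * q)"] by (simp add: cancel)
    show "fourier_coeff (u t') k = cis (- (t' * q)) * (fourier_coeff (u 0) k - ?c * integral {0..t'} f)"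
      using D(2) by (simp add: right_diff_distrib mult_ac)
  qed
  have f1: "f integrable_on {0..t + \<tau>}" using t \<tau> T by (intro f_int) auto
  have combine: "integral {0..t + \<tau>} f = integral {0..t} f + integral {t..t + \<tau>} f"
    using Henstock_Kurzweil_Integration.integral_combine[OF t _ f1] \<tau> by simp
  have f2: "f integrable_on {t..t + \<tau>}"
    by (rule integrable_on_subinterval[OF f1]) (use t in auto)
  have "(f has_integral integral {t..t + \<tau>} f) (cbox t (t + \<tau>))"
    using integrable_integral[OF f2] by simp
  from has_integral_affinity'[OF this, of 1 t]
  have "((\<lambda>s. f (s + t)) has_integral integral {t..t + \<tau>} f) {0..\<tau>}" by simp
  moreover have "f (s + t) = cis (t * q) * g s k" for s
    by (simp add: f_def g_def n_def q_def add.commute distrib_right cis_mult mult.assoc[symmetric])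
  ultimately have shift: "((\<lambda>s. cis (t * q) * g s k) has_integral integral {t..t + \<tau>} f) {0..\<tau>}" by simp
  from has_integral_mult_right[OF this, of "cis (- (t * q))"]
  have g: "((\<lambda>s. g s k) has_integral cis (- (t * q)) * integral {t..t + \<tau>} f) {0..\<tau>}"
    by (simp add: cancel)
  then show "(\<lambda>s. g s k) integrable_on {0..\<tau>}" by blast
  have "cis (t * q) * integral {0..\<tau>} (\<lambda>s. g s k) = integral {t..t + \<tau>} f"
    by (simp add: integral_unique[OF g] cancel)
  moreover have "fourier_coeff (u 0) k - ?c * integral {0..t} f = cis (t * q) * fourier_coeff (u t) k"
    using t \<tau> T by (simp add: V[of t] cancel)
  ultimately have "fourier_coeff (u 0) k - ?c * integral {0..t + \<tau>} f
      = cis (t * q) * (fourier_coeff (u t) k - ?c * integral {0..\<tau>} (\<lambda>s. g s k))"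
    unfolding combine by (simp add: algebra_simps)
  then have "fourier_coeff (u (t + \<tau>)) k
      = cis (- ((t + \<tau>) * q)) * (cis (t * q) * (fourier_coeff (u t) k - ?c * integral {0..\<tau>} (\<lambda>s. g s k)))"
    using t \<tau> T by (simp add: V[of "t + \<tau>"])
  then show "fourier_coeff (u (t + \<tau>)) k = cis (- (\<tau> * (norm (freq k))\<^sup>2)) *
      (fourier_coeff (u t) k - \<i> * of_real \<mu> * integral {0..\<tau>} (\<lambda>s. g s k))"
    by (simp add: mult.assoc[symmetric] cis_mult distrib_right q_def)
qed

end

section \<open>Local error\<close>

lemma sobolev_le_absolutely_integrable:
  assumes "sobolev_le r A f"
  shows "f absolutely_integrable_on torus_cell"
proof -
  have "continuous_on torus_cell f"
    using continuous_on_fourier_series[OF sobolev_le_fourier_coeff(2)[OF assms]] sobolev_le_fourier_coeff(3)[OF assms]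
    by simp
  then show ?thesis unfolding torus_cell_def by (rule absolutely_integrable_continuous)
qed

lemma fourier_coeff_sobolev_diff:
  assumes "sobolev_le r A f" and "sobolev_le r' B g"
  shows "fourier_coeff (\<lambda>x. f x - g x) k = fourier_coeff f k - fourier_coeff g k"
  by (intro fourier_coeff_diff sobolev_le_absolutely_integrable[OF assms(1)] sobolev_le_absolutely_integrable[OF assms(2)])

lemma fourier_coeff_mult:
  assumes "sobolev_le r A f" and "sobolev_le r' B g"
  shows "fourier_coeff (\<lambda>x. f x * g x) = convolution (fourier_coeff f) (fourier_coeff g)"
proof -
  note f = sobolev_le_fourier_coeff[OF assms(1)] and g = sobolev_le_fourier_coeff[OF assms(2)]
  have "(\<lambda>x. f x * g x) = (\<lambda>x. fourier_series (fourier_coeff f) x * fourier_series (fourier_coeff g) x)"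
    by (simp only: f(3) g(3))
  also have "\<dots> = fourier_series (convolution (fourier_coeff f) (fourier_coeff g))"
    by (simp only: fourier_series_mult[OF f(2) g(2)])
  finally show ?thesis
    by (simp only: fourier_coeff_fourier_series[OF abs_summable_convolution[OF f(2) g(2)]])
qed

lemma fourier_coeff_laplace_fun:
  assumes f: "sobolev_le r A f" and F: "\<And>x. x \<ge> 0 \<Longrightarrow> cmod (F (of_real (- x))) \<le> 1"
  shows "fourier_coeff (laplace_fun F f) k = F (of_real (- (norm (freq k))\<^sup>2)) * fourier_coeff f k"
proof -
  let ?b = "\<lambda>k. F (of_real (- (norm (freq k))\<^sup>2)) * fourier_coeff f k"
  have F': "cmod (F (of_real (- (norm (freq k))\<^sup>2))) \<le> 1" for k :: "int ^ 'a"
    using F[of "(norm (freq k))\<^sup>2"] by simp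
  have "abs_summable ?b"
    by (rule summable_on_comparison_test[OF sobolev_le_fourier_coeff(2)[OF f]])
      (use F' in \<open>auto simp: norm_mult intro!: mult_left_le_one_le\<close>)
  moreover have "laplace_fun F f = fourier_series ?b"
    using laplace_fun_fourier_series[OF sobolev_le_fourier_coeff(2)[OF f], of F] sobolev_le_fourier_coeff(3)[OF f]
    by simp
  ultimately show ?thesis by (simp only: fourier_coeff_fourier_series)
qed

lemma fourier_coeff_free_flow:
  assumes "sobolev_le r A f"
  shows "fourier_coeff (free_flow t f) k = cis (- (t * (norm (freq k))\<^sup>2)) * fourier_coeff f k"
  unfolding free_flow_def
  by (subst fourier_coeff_laplace_fun[OF assms]) (simp_all only: free_flow_symbol norm_cis order_refl)

text \<open>Once absolute convergence is known, the size of the coefficients alone decides on the norm.\<close>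

lemma sobolev_le_improve:
  assumes "sobolev_le r A f" and "weighted_l2_le r' B (fourier_coeff f)"
  shows "sobolev_le r' B f"
  using assms sobolev_le_fourier_coeff[OF assms(1)] unfolding sobolev_le_def by metis

lemma has_integral_cis:
  assumes "0 \<le> \<tau>"
  shows "((\<lambda>s. cis (s * y)) has_integral of_real \<tau> * phi1 (\<i> * of_real (\<tau> * y))) {0..\<tau>}"
proof (cases "y = 0")
  case True
  then show ?thesis using has_integral_const_real[of "1 :: complex" 0 \<tau>] assms
    by (simp add: phi1_def scaleR_conv_of_real)
next
  case False
  show ?thesis
  proof (cases "\<tau> = 0")
    case True
    then show ?thesis by (simp add: has_integral_refl)
  next
    case \<tau>: False
    have "((\<lambda>s. cis (s * y)) has_integral (cis (\<tau> * y) / (\<i> * y) - cis (0 * y) / (\<i> * y))) {0..\<tau>}"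
    proof (rule fundamental_theorem_of_calculus[OF assms])
      fix s
      have "((\<lambda>z. exp (\<i> * of_real y * z) / (\<i> * of_real y)) has_field_derivative exp (\<i> * of_real y * of_real s)) (at (of_real s))"
        using False by (auto intro!: derivative_eq_intros)
      from has_vector_derivative_real_field[OF this]
      show "((\<lambda>s. cis (s * y) / (\<i> * y)) has_vector_derivative cis (s * y)) (at s within {0..\<tau>})"
        by (simp add: cis_conv_exp mult_ac)
    qed
    moreover have "cis (\<tau> * y) / (\<i> * y) - cis (0 * y) / (\<i> * y) = of_real \<tau> * phi1 (\<i> * of_real (\<tau> * y))"
      using False \<tau> by (simp add: phi1_def cis_conv_exp field_simps)
    ultimately show ?thesis by simp
  qed
qed

text \<open>In terms of operators, \<open>\<tau> \<phi>\<^sub>1(- 2 i \<tau> \<Delta>)\<close> is the integral of \<open>e\<^sup>-\<^sup>2\<^sup>i\<^sup>s\<^sup>\<Delta>\<close> over \<open>0 \<le> s \<le> \<tau>\<close>. One step of the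
  integrator is therefore Duhamel's formula with the frozen integrand.\<close>

lemma convolution_filter:
  assumes a: "abs_summable a" and b: "abs_summable b" and \<tau>: "0 \<le> \<tau>"
  shows "((\<lambda>s. convolution a (\<lambda>l. cis (2 * s * (norm (freq l))\<^sup>2) * b l) k) has_integral
    of_real \<tau> * convolution a (\<lambda>l. phi1 (- 2 * \<i> * of_real \<tau> * of_real (- (norm (freq l))\<^sup>2)) * b l) k) {0..\<tau>}"
proof -
  let ?q = "\<lambda>l. (norm (freq l))\<^sup>2"
  let ?f = "\<lambda>l s. a (k - l) * (cis (2 * s * ?q l) * b l)"
  have phi: "integral (cbox 0 \<tau>) (?f l) = of_real \<tau> * (a (k - l) * (phi1 (- 2 * \<i> * of_real \<tau> * of_real (- ?q l)) * b l))" for l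
  proof -
    have "((\<lambda>s. a (k - l) * b l * cis (s * (2 * ?q l))) has_integral
        a (k - l) * b l * (of_real \<tau> * phi1 (\<i> * of_real (\<tau> * (2 * ?q l))))) (cbox 0 \<tau>)"
      unfolding cbox_interval by (intro has_integral_mult_right has_integral_cis \<tau>)
    then have "(?f l has_integral of_real \<tau> * (a (k - l) * (phi1 (- 2 * \<i> * of_real \<tau> * of_real (- ?q l)) * b l))) (cbox 0 \<tau>)"
      by (simp add: mult_ac)
    then show ?thesis by (rule integral_unique)
  qed
  have "((\<lambda>s. \<Sum>\<^sub>\<infinity>l. ?f l s) has_integral (\<Sum>\<^sub>\<infinity>l. integral (cbox 0 \<tau>) (?f l))) (cbox 0 \<tau>)"
    by (rule has_integral_infsum[OF _ abs_convolution_summable[OF a b, of k]])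
      (auto simp: norm_mult cis_conv_exp intro!: continuous_intros)
  then show ?thesis
    unfolding phi convolution_def by (simp add: infsum_cmult_right')
qed

text \<open>The difference of the two Duhamel formulas is the integral over \<open>[0, \<tau>]\<close> of the difference of the
  integrands. Replacing the solution by the free flow costs \<open>O(s)\<close>, and freezing the integrand costs
  \<open>O(s\<^sup>\<gamma>)\<close>; for \<open>\<tau> \<le> 1\<close> both are \<open>O(\<tau>\<^sup>\<gamma>)\<close>, and the integration gains one more power of \<open>\<tau>\<close>.\<close>

lemma local_error:
  assumes r: "r > real CARD('d::finite) / 2" and \<gamma>: "0 < \<gamma>" "\<gamma> \<le> 1" and p: "p \<ge> 1"
  shows "\<exists>C\<ge>0. \<forall>(u :: real \<Rightarrow> real ^ 'd \<Rightarrow> complex) t \<tau>. mild_nls_solution p \<mu> (r + \<gamma>) T u \<longrightarrow>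
    (\<forall>t\<in>{0..T}. sobolev_norm (r + \<gamma>) (u t) \<le> M) \<longrightarrow> 0 \<le> t \<longrightarrow> 0 < \<tau> \<longrightarrow> \<tau> \<le> 1 \<longrightarrow> t + \<tau> \<le> T \<longrightarrow>
    sobolev_le r (\<tau> * (C * \<tau> powr \<gamma>))
      (\<lambda>x. continuous_rep (u (t + \<tau>)) x - integrator_step p \<mu> \<tau> (continuous_rep (u t)) x)"
proof -
  have r\<gamma>: "r + \<gamma> > real CARD('d) / 2" using r \<gamma> by simp
  obtain B where B: "B \<ge> 0"
    "\<And>f :: real ^ 'd \<Rightarrow> complex. sobolev_le (r + \<gamma>) M f \<Longrightarrow> sobolev_le (r + \<gamma>) B (nls_nonlinearity p f)"
    using sobolev_le_nls_nonlinearity[OF r\<gamma>, of M p] by blast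
  obtain L where L: "L \<ge> 0" "\<And>f (g :: real ^ 'd \<Rightarrow> complex) D. sobolev_le r M f \<Longrightarrow> sobolev_le r M g \<Longrightarrow>
    sobolev_le r D (\<lambda>x. f x - g x) \<Longrightarrow> sobolev_le r (L * D) (\<lambda>x. nls_nonlinearity p f x - nls_nonlinearity p g x)"
    using sobolev_le_nls_nonlinearity_diff[OF r, of M p] by blast
  obtain F where F: "F \<ge> 0" "\<And>s (v :: real ^ 'd \<Rightarrow> complex). sobolev_le (r + \<gamma>) M v \<Longrightarrow>
    sobolev_le r (F * \<bar>s\<bar> powr \<gamma>) (\<lambda>x. free_flow (- s) (nls_nonlinearity p (free_flow s v)) x
      - v x ^ (p + 1) * free_flow (- 2 * s) (\<lambda>x. cnj (v x) ^ p) x)"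
    using sobolev_le_frozen_nonlinearity[OF r \<gamma> p, of M] by blast
  define C where "C = L * (\<bar>\<mu>\<bar> * B) + F"
  have C: "C \<ge> 0" using B L F by (simp add: C_def)
  have order: "sobolev_le r D f" if "sobolev_le (r + \<gamma>) D f" for D and f :: "real ^ 'd \<Rightarrow> complex"
    using that \<gamma> by (auto intro: sobolev_le_order)
  show ?thesis
  proof (intro exI conjI allI impI)
    show "0 \<le> \<bar>\<mu>\<bar> * C" using C by simp
    fix u :: "real \<Rightarrow> real ^ 'd \<Rightarrow> complex" and t \<tau> :: real
    assume mild: "mild_nls_solution p \<mu> (r + \<gamma>) T u" and "\<forall>t\<in>{0..T}. sobolev_norm (r + \<gamma>) (u t) \<le> M"
      and t: "0 \<le> t" and \<tau>: "0 < \<tau>" "\<tau> \<le> 1" and T: "t + \<tau> \<le> T"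
    then have M: "\<And>t. t \<in> {0..T} \<Longrightarrow> sobolev_norm (r + \<gamma>) (u t) \<le> M" by blast
    define U where "U s = continuous_rep (u s)" for s
    have U: "sobolev_le (r + \<gamma>) M (U s)" "fourier_coeff (U s) = fourier_coeff (u s)"
      "sobolev_le (r + \<gamma>) B (nls_nonlinearity p (U s))"
      "fourier_coeff (nls_nonlinearity p (u s)) = fourier_coeff (nls_nonlinearity p (U s))" if "s \<in> {0..T}" for s
    proof -
      note us = u_sobolev[OF r\<gamma> mild M B(2) that]
      show "sobolev_le (r + \<gamma>) M (U s)"
        unfolding U_def by (rule sobolev_imp_continuous_rep(1)[OF r\<gamma> us M[OF that]])
      then show "sobolev_le (r + \<gamma>) B (nls_nonlinearity p (U s))" by (rule B(2))
      show "fourier_coeff (U s) = fourier_coeff (u s)"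
        unfolding U_def continuous_rep_def
        by (rule fourier_coeff_fourier_series[OF sobolev_imp_continuous_rep(2)[OF r\<gamma> us M[OF that]]])
      show "fourier_coeff (nls_nonlinearity p (u s)) = fourier_coeff (nls_nonlinearity p (U s))"
        unfolding U_def by (rule fourier_coeff_nonlinearity_rep[OF r\<gamma> us])
    qed
    define v where "v = U t"
    have v: "sobolev_le (r + \<gamma>) M v" using t \<tau> T by (simp add: v_def U(1))
    define q :: "int ^ 'd \<Rightarrow> real" where "q k = (norm (freq k))\<^sup>2" for k
    define g where "g s k = cis (s * q k) * fourier_coeff (nls_nonlinearity p (U (t + s))) k" for s k
    have g_l2: "weighted_l2_le (r + \<gamma>) B (g s)" if "s \<in> {0..\<tau>}" for s
      unfolding g_def using that t T
      by (intro weighted_l2_le_multiplier sobolev_le_fourier_coeff(1)[OF U(3)]) auto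
    have g_int: "(\<lambda>s. g s k) integrable_on {0..s'}"
      and duhamel: "fourier_coeff (U (t + s')) k = cis (- (s' * q k)) * (fourier_coeff v k - \<i> * of_real \<mu> * integral {0..s'} (\<lambda>s. g s k))"
      if "s' \<in> {0..\<tau>}" for s' k
    proof -
      have g': "cis (s * (norm (freq k))\<^sup>2) * fourier_coeff (nls_nonlinearity p (u (t + s))) k = g s k"
        if "s \<in> {0..s'}" for s
        using that \<open>s' \<in> {0..\<tau>}\<close> t T by (simp add: g_def q_def U(4))
      have s': "0 \<le> s'" "t + s' \<le> T" using that T by auto
      note D = fourier_coeff_duhamel[OF r\<gamma> mild M B(2) t s', of k]
      show "(\<lambda>s. g s k) integrable_on {0..s'}"
        by (rule integrable_eq[OF D(1)]) (simp_all add: g')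
      have "integral {0..s'} (\<lambda>s. cis (s * (norm (freq k))\<^sup>2) * fourier_coeff (nls_nonlinearity p (u (t + s))) k)
          = integral {0..s'} (\<lambda>s. g s k)"
        by (rule Henstock_Kurzweil_Integration.integral_cong) (simp add: g')
      then show "fourier_coeff (U (t + s')) k = cis (- (s' * q k)) * (fourier_coeff v k - \<i> * of_real \<mu> * integral {0..s'} (\<lambda>s. g s k))"
        using D(2) s' t by (simp add: U(2) v_def q_def)
    qed
    \<comment> \<open>The solution stays \<open>O(s)\<close>-close to the free flow, as the nonlinearity is bounded in \<open>H\<^sup>r\<^sup>+\<^sup>\<gamma>\<close>.\<close>
    have free: "sobolev_le r (\<bar>\<mu>\<bar> * (s * B)) (\<lambda>x. U (t + s) x - free_flow s v x)" if s: "s \<in> {0..\<tau>}" for s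
    proof (rule order, rule sobolev_le_improve)
      have Us: "sobolev_le (r + \<gamma>) M (U (t + s))" using s t T by (intro U(1)) auto
      show "sobolev_le (r + \<gamma>) (M + M) (\<lambda>x. U (t + s) x - free_flow s v x)"
        by (intro sobolev_le_diff Us sobolev_le_free_flow v)
      have "fourier_coeff (\<lambda>x. U (t + s) x - free_flow s v x)
          = (\<lambda>k. cis (- (s * q k)) * (- (\<i> * of_real \<mu>) * integral {0..s} (\<lambda>s. g s k)))"
      proof
        fix k
        show "fourier_coeff (\<lambda>x. U (t + s) x - free_flow s v x) k
            = cis (- (s * q k)) * (- (\<i> * of_real \<mu>) * integral {0..s} (\<lambda>s. g s k))"
          unfolding fourier_coeff_sobolev_diff[OF Us sobolev_le_free_flow[OF v]] fourier_coeff_free_flow[OF v]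
            duhamel[OF s] q_def[symmetric] by (simp add: algebra_simps)
      qed
      moreover have "weighted_l2_le (r + \<gamma>) (cmod (- (\<i> * of_real \<mu>)) * ((s - 0) * B))
          (\<lambda>k. cis (- (s * q k)) * (- (\<i> * of_real \<mu>) * integral {0..s} (\<lambda>s. g s k)))"
        using s by (intro weighted_l2_le_multiplier weighted_l2_le_cmult weighted_l2_le_integral g_int g_l2) auto
      ultimately show "weighted_l2_le (r + \<gamma>) (\<bar>\<mu>\<bar> * (s * B)) (fourier_coeff (\<lambda>x. U (t + s) x - free_flow s v x))"
        by (simp add: norm_mult)
    qed
    define V W where "V = (\<lambda>x. v x ^ (p + 1))" and "W = (\<lambda>x. cnj (v x) ^ p)"
    obtain A\<^sub>V A\<^sub>W where V: "sobolev_le r A\<^sub>V V" and W: "sobolev_le r A\<^sub>W W"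
      unfolding V_def W_def using sobolev_le_power[OF r] order[OF v] sobolev_le_cnj[OF order[OF v]] by metis
    define Q where "Q s k = convolution (fourier_coeff V) (\<lambda>l. cis (2 * s * q l) * fourier_coeff W l) k" for s k
    obtain K where mult: "\<And>A B f (g :: real ^ 'd \<Rightarrow> complex). sobolev_le r A f \<Longrightarrow> sobolev_le r B g \<Longrightarrow>
      sobolev_le r (K * A * B) (\<lambda>x. f x * g x)"
      using sobolev_le_mult[OF r] by metis
    have integrand: "weighted_l2_le r (C * \<tau> powr \<gamma>) (\<lambda>k. g s k - Q s k)" if s: "s \<in> {0..\<tau>}" for s
    proof -
      have ts: "t + s \<in> {0..T}" using s t T by auto
      have free_v: "sobolev_le r M (free_flow s v)" by (intro sobolev_le_free_flow order v)
      obtain D where N_free: "sobolev_le r D (nls_nonlinearity p (free_flow s v))"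
        using sobolev_le_nls_nonlinearity[OF r] free_v by metis
      have N_U: "sobolev_le r B (nls_nonlinearity p (U (t + s)))" by (intro order U(3) ts)
      have "sobolev_le r (L * (\<bar>\<mu>\<bar> * (s * B)))
          (\<lambda>x. nls_nonlinearity p (U (t + s)) x - nls_nonlinearity p (free_flow s v) x)"
        by (rule L(2)[OF order[OF U(1)[OF ts]] free_v free[OF s]])
      from sobolev_le_free_flow[OF this, of "- s"]
      have "sobolev_le r (L * (\<bar>\<mu>\<bar> * (s * B)) + F * \<bar>s\<bar> powr \<gamma>)
          (\<lambda>x. (free_flow (- s) (nls_nonlinearity p (U (t + s))) x - free_flow (- s) (nls_nonlinearity p (free_flow s v)) x)
            + (free_flow (- s) (nls_nonlinearity p (free_flow s v)) x - V x * free_flow (- 2 * s) W x))"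
        unfolding free_flow_diff[OF N_U N_free] V_def W_def by (intro sobolev_le_add F(2)[OF v])
      then have E: "sobolev_le r (L * (\<bar>\<mu>\<bar> * (s * B)) + F * \<bar>s\<bar> powr \<gamma>)
          (\<lambda>x. free_flow (- s) (nls_nonlinearity p (U (t + s))) x - V x * free_flow (- 2 * s) W x)"
        by simp
      have coeff: "fourier_coeff (\<lambda>x. free_flow (- s) (nls_nonlinearity p (U (t + s))) x - V x * free_flow (- 2 * s) W x) k = g s k - Q s k" for k
        unfolding fourier_coeff_sobolev_diff[OF sobolev_le_free_flow[OF N_U] mult[OF V sobolev_le_free_flow[OF W]]]
          fourier_coeff_mult[OF V sobolev_le_free_flow[OF W]] fourier_coeff_free_flow[OF N_U] g_def Q_def
        by (simp add: fourier_coeff_free_flow[OF W, abs_def] q_def)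
      have le: "L * (\<bar>\<mu>\<bar> * (s * B)) + F * \<bar>s\<bar> powr \<gamma> \<le> C * \<tau> powr \<gamma>"
      proof -
        have "s \<le> \<tau>" using s by simp
        also have "\<tau> \<le> \<tau> powr \<gamma>" using powr_mono'[of \<gamma> 1 \<tau>] \<gamma> \<tau> by simp
        finally have "L * (\<bar>\<mu>\<bar> * (s * B)) \<le> L * (\<bar>\<mu>\<bar> * (\<tau> powr \<gamma> * B))"
          using L B by (intro mult_left_mono mult_right_mono) auto
        moreover have "F * \<bar>s\<bar> powr \<gamma> \<le> F * \<tau> powr \<gamma>"
          using s F \<gamma> by (intro mult_left_mono powr_mono2) auto
        ultimately show ?thesis by (simp add: C_def algebra_simps)
      qed
      show ?thesis
        using sobolev_le_fourier_coeff(1)[OF E] le unfolding coeff[abs_def] by (rule weighted_l2_le_mono)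
    qed
    define \<Phi> where "\<Phi> = filtered_power p \<tau> v"
    have \<Phi>: "sobolev_le r A\<^sub>W \<Phi>"
      unfolding \<Phi>_def filtered_power_def W_def[symmetric]
      by (intro sobolev_le_laplace_fun W norm_filter_symbol_le)
    have \<Phi>_coeff: "fourier_coeff \<Phi> = (\<lambda>l. phi1 (- 2 * \<i> * of_real \<tau> * of_real (- q l)) * fourier_coeff W l)"
      unfolding \<Phi>_def filtered_power_def W_def[symmetric] q_def
      by (rule ext, rule fourier_coeff_laplace_fun[OF W, where F = "\<lambda>z. phi1 (- 2 * \<i> * of_real \<tau> * z)"])
        (rule norm_filter_symbol_le)
    have Q: "((\<lambda>s. Q s k) has_integral of_real \<tau> * fourier_coeff (\<lambda>x. V x * \<Phi> x) k) {0..\<tau>}" for k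
      unfolding fourier_coeff_mult[OF V \<Phi>] \<Phi>_coeff Q_def q_def using \<tau>
      by (intro convolution_filter sobolev_le_fourier_coeff(2)[OF V] sobolev_le_fourier_coeff(2)[OF W]) auto
    define c where "c = \<i> * complex_of_real \<mu>"
    have step: "integrator_step p \<mu> \<tau> v = free_flow \<tau> (\<lambda>x. v x - (c * of_real \<tau>) * (V x * \<Phi> x))"
      by (simp add: integrator_step_eq c_def V_def \<Phi>_def)
    have V\<Phi>: "sobolev_le r (cmod (c * of_real \<tau>) * (K * A\<^sub>V * A\<^sub>W)) (\<lambda>x. (c * of_real \<tau>) * (V x * \<Phi> x))"
      by (intro sobolev_le_cmult mult V \<Phi>)
    note inner = sobolev_le_diff[OF order[OF v] V\<Phi>]
    have U\<tau>: "sobolev_le r M (U (t + \<tau>))" using t \<tau> T by (intro order U(1)) auto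
    have "sobolev_le r (\<bar>\<mu>\<bar> * ((\<tau> - 0) * (C * \<tau> powr \<gamma>))) (\<lambda>x. U (t + \<tau>) x - integrator_step p \<mu> \<tau> v x)"
    proof (rule sobolev_le_improve)
      show "sobolev_le r (M + (M + cmod (c * of_real \<tau>) * (K * A\<^sub>V * A\<^sub>W))) (\<lambda>x. U (t + \<tau>) x - integrator_step p \<mu> \<tau> v x)"
        unfolding step by (intro sobolev_le_diff U\<tau> sobolev_le_free_flow inner)
      have "fourier_coeff (\<lambda>x. U (t + \<tau>) x - integrator_step p \<mu> \<tau> v x)
          = (\<lambda>k. cis (- (\<tau> * q k)) * (- c * integral {0..\<tau>} (\<lambda>s. g s k - Q s k)))"
      proof
        fix k
        have "\<tau> \<in> {0..\<tau>}" using \<tau> by simp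
        have i1: "integral {0..\<tau>} (\<lambda>s. g s k - Q s k) = integral {0..\<tau>} (\<lambda>s. g s k) - of_real \<tau> * fourier_coeff (\<lambda>x. V x * \<Phi> x) k"
          using \<tau> Q[of k] by (subst Henstock_Kurzweil_Integration.integral_diff) (auto intro: g_int simp: integral_unique)
        have i2: "fourier_coeff (integrator_step p \<mu> \<tau> v) k
            = cis (- (\<tau> * q k)) * (fourier_coeff v k - c * of_real \<tau> * fourier_coeff (\<lambda>x. V x * \<Phi> x) k)"
          unfolding step fourier_coeff_free_flow[OF inner] fourier_coeff_sobolev_diff[OF order[OF v] V\<Phi>]
            fourier_coeff_cmult q_def ..
        have i3: "fourier_coeff (\<lambda>x. U (t + \<tau>) x - integrator_step p \<mu> \<tau> v x) k
            = fourier_coeff (U (t + \<tau>)) k - fourier_coeff (integrator_step p \<mu> \<tau> v) k"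
          unfolding step by (rule fourier_coeff_sobolev_diff[OF U\<tau> sobolev_le_free_flow[OF inner]])
        show "fourier_coeff (\<lambda>x. U (t + \<tau>) x - integrator_step p \<mu> \<tau> v x) k
            = cis (- (\<tau> * q k)) * (- c * integral {0..\<tau>} (\<lambda>s. g s k - Q s k))"
          unfolding i3 i2 i1 duhamel[OF \<open>\<tau> \<in> {0..\<tau>}\<close>] by (simp add: c_def algebra_simps)
      qed
      moreover have "weighted_l2_le r (cmod (- c) * ((\<tau> - 0) * (C * \<tau> powr \<gamma>)))
          (\<lambda>k. cis (- (\<tau> * q k)) * (- c * integral {0..\<tau>} (\<lambda>s. g s k - Q s k)))"
        using \<tau> by (intro weighted_l2_le_multiplier weighted_l2_le_cmult weighted_l2_le_integral integrand
            Henstock_Kurzweil_Integration.integrable_diff g_int has_integral_integrable[OF Q]) auto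
      ultimately show "weighted_l2_le r (\<bar>\<mu>\<bar> * ((\<tau> - 0) * (C * \<tau> powr \<gamma>)))
          (fourier_coeff (\<lambda>x. U (t + \<tau>) x - integrator_step p \<mu> \<tau> v x))"
        by (simp add: c_def norm_mult)
    qed
    then show "sobolev_le r (\<tau> * (\<bar>\<mu>\<bar> * C * \<tau> powr \<gamma>))
      (\<lambda>x. continuous_rep (u (t + \<tau>)) x - integrator_step p \<mu> \<tau> (continuous_rep (u t)) x)"
      by (simp add: U_def v_def mult_ac)
  qed
qed

section \<open>Convergence\<close>

lemma L2_torus_diff:
  assumes f: "f \<in> L2_torus" and g: "sobolev_le r B g"
  shows "(\<lambda>x. f x - g x) \<in> L2_torus"
proof -
  have cont: "continuous_on S g" for S
    using continuous_on_fourier_series[OF sobolev_le_fourier_coeff(2)[OF g]] sobolev_le_fourier_coeff(3)[OF g] by simp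
  have meas: "(\<lambda>x. f x - g x) \<in> borel_measurable lebesgue"
    using f continuous_imp_measurable_on_sets_lebesgue[OF cont[of UNIV]]
    by (auto simp: L2_torus_def lebesgue_on_UNIV_eq)
  have "(\<lambda>x. (cmod (f x - g x))\<^sup>2) absolutely_integrable_on torus_cell"
  proof (rule measurable_bounded_by_integrable_imp_absolutely_integrable)
    show "(\<lambda>x. (cmod (f x - g x))\<^sup>2) \<in> borel_measurable (lebesgue_on torus_cell)"
      by (intro measurable_restrict_space1 borel_measurable_power measurable_compose[OF meas borel_measurable_norm])
    show "(\<lambda>x. 2 * (cmod (f x))\<^sup>2 + 2 * (cmod (g x))\<^sup>2) integrable_on torus_cell"
    proof (intro integrable_add integrable_on_mult_right)
      show "(\<lambda>x. (cmod (f x))\<^sup>2) integrable_on torus_cell"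
        using f by (auto simp: L2_torus_def intro: set_lebesgue_integral_eq_integral(1))
      show "(\<lambda>x. (cmod (g x))\<^sup>2) integrable_on torus_cell"
        unfolding torus_cell_def by (intro integrable_continuous continuous_intros cont)
    qed
    show "norm ((cmod (f x - g x))\<^sup>2) \<le> 2 * (cmod (f x))\<^sup>2 + 2 * (cmod (g x))\<^sup>2" for x
    proof -
      have "(cmod (f x - g x))\<^sup>2 \<le> (cmod (f x) + cmod (g x))\<^sup>2"
        by (intro power_mono norm_triangle_ineq4) auto
      also have "\<dots> \<le> 2 * (cmod (f x))\<^sup>2 + 2 * (cmod (g x))\<^sup>2"
        using zero_le_power2[of "cmod (f x) - cmod (g x)"] unfolding power2_sum power2_diff by simp
      finally show ?thesis by simp
    qed
  qed simp
  moreover have "torus_periodic (\<lambda>x. f x - g x)"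
    using f torus_periodic_fourier_series[of "fourier_coeff g"] sobolev_le_fourier_coeff(3)[OF g]
    by (simp add: L2_torus_def torus_periodic_def)
  ultimately show ?thesis using meas by (simp add: L2_torus_def)
qed

lemma sobolev_normI:
  assumes "f \<in> L2_torus" and "weighted_l2_le r B (fourier_coeff f)"
  shows "f \<in> sobolev r" and "sobolev_norm r f \<le> B"
  using assms by (simp_all add: weighted_l2_le_iff sobolev_def sobolev_norm_def weight_def)

text \<open>The step uses its argument only through Fourier coefficients, so that null sets do not matter.
  From the first step on, the numerical solution is thus the same as for the continuous
  representative of the initial value.\<close>

lemma integrator_step_cong:
  assumes "negligible N" and "\<And>x. x \<in> torus_cell - N \<Longrightarrow> f x = g x"
  shows "integrator_step p \<mu> \<tau> f = integrator_step p \<mu> \<tau> g"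
proof -
  have "fourier_coeff (\<lambda>y. cnj (f y) ^ p) = fourier_coeff (\<lambda>y. cnj (g y) ^ p)"
    by (rule fourier_coeff_cong_negligible[OF assms(1)]) (simp add: assms(2))
  then have filt: "filtered_power p \<tau> f = filtered_power p \<tau> g"
    by (simp add: filtered_power_def laplace_fun_def fun_eq_iff)
  have "fourier_coeff (\<lambda>x. f x - (\<i> * of_real \<mu> * of_real \<tau>) * (f x ^ (p + 1) * filtered_power p \<tau> f x))
      = fourier_coeff (\<lambda>x. g x - (\<i> * of_real \<mu> * of_real \<tau>) * (g x ^ (p + 1) * filtered_power p \<tau> g x))"
    by (rule fourier_coeff_cong_negligible[OF assms(1)]) (simp only: assms(2) filt)
  then show ?thesis by (simp only: integrator_step_eq free_flow_eq_fourier_series)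
qed

theorem corollary2p4:
  fixes p :: nat and \<mu> T r \<gamma> :: real
  assumes "p \<ge> 1" and "T > 0"
    and "r > real CARD('d::finite) / 2"
    and "0 < \<gamma>" and "\<gamma> \<le> 1"
  shows "\<exists>C :: real \<Rightarrow> real. \<forall>u :: real \<Rightarrow> real ^ 'd \<Rightarrow> complex.
    mild_nls_solution p \<mu> (r + \<gamma>) T u \<longrightarrow>
    (\<exists>\<tau>0>0. \<forall>\<tau> n. 0 < \<tau> \<and> \<tau> \<le> \<tau>0 \<and> real n * \<tau> \<le> T \<longrightarrow>
      (\<lambda>x. u (real n * \<tau>) x - integrator p \<mu> \<tau> (u 0) n x) \<in> sobolev r \<and>
      sobolev_norm r (\<lambda>x. u (real n * \<tau>) x - integrator p \<mu> \<tau> (u 0) n x)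
        \<le> C (SUP t\<in>{0..T}. sobolev_norm (r + \<gamma>) (u t)) * \<tau> powr \<gamma>)"
proof -
  have r\<gamma>: "r + \<gamma> > real CARD('d) / 2" using assms by simp
  define convergent where "convergent M c \<longleftrightarrow>
    (\<forall>u :: real \<Rightarrow> real ^ 'd \<Rightarrow> complex. mild_nls_solution p \<mu> (r + \<gamma>) T u \<longrightarrow>
      (\<forall>t\<in>{0..T}. sobolev_norm (r + \<gamma>) (u t) \<le> M) \<longrightarrow>
      (\<exists>\<tau>0>0. \<forall>\<tau> n. 0 < \<tau> \<and> \<tau> \<le> \<tau>0 \<and> real n * \<tau> \<le> T \<longrightarrow>
        (\<lambda>x. u (real n * \<tau>) x - integrator p \<mu> \<tau> (u 0) n x) \<in> sobolev r \<and>
        sobolev_norm r (\<lambda>x. u (real n * \<tau>) x - integrator p \<mu> \<tau> (u 0) n x) \<le> c * \<tau> powr \<gamma>))" for M c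
  have "\<exists>c. convergent M c" for M
  proof -
    obtain C where C: "C \<ge> 0" "\<And>(u :: real \<Rightarrow> real ^ 'd \<Rightarrow> complex) t \<tau>. mild_nls_solution p \<mu> (r + \<gamma>) T u \<Longrightarrow>
      (\<forall>t\<in>{0..T}. sobolev_norm (r + \<gamma>) (u t) \<le> M) \<Longrightarrow> 0 \<le> t \<Longrightarrow> 0 < \<tau> \<Longrightarrow> \<tau> \<le> 1 \<Longrightarrow> t + \<tau> \<le> T \<Longrightarrow>
      sobolev_le r (\<tau> * (C * \<tau> powr \<gamma>))
        (\<lambda>x. continuous_rep (u (t + \<tau>)) x - integrator_step p \<mu> \<tau> (continuous_rep (u t)) x)"
      using local_error[OF assms(3-5,1)] by blast
    obtain L where L: "L \<ge> 0" "\<And>\<tau> f (g :: real ^ 'd \<Rightarrow> complex) D. \<tau> \<ge> 0 \<Longrightarrow> sobolev_le r (M + 1) f \<Longrightarrow>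
      sobolev_le r (M + 1) g \<Longrightarrow> sobolev_le r D (\<lambda>x. f x - g x) \<Longrightarrow>
      sobolev_le r ((1 + L * \<tau>) * D) (\<lambda>x. integrator_step p \<mu> \<tau> f x - integrator_step p \<mu> \<tau> g x)"
      using sobolev_le_integrator_step_diff[OF assms(3), of "M + 1" p \<mu>] by blast
    define E where "E = T * exp (L * T) * C"
    have E: "E \<ge> 0" using C assms(2) by (simp add: E_def)
    \<comment> \<open>For \<open>\<tau> \<le> \<tau>0\<close> the error bound \<open>E \<tau>\<^sup>\<gamma>\<close> is at most 1.\<close>
    define \<tau>0 where "\<tau>0 = min 1 ((1 / (E + 1)) powr (1 / \<gamma>))"
    have \<tau>0: "\<tau>0 > 0" using E by (simp add: \<tau>0_def)
    have small: "E * \<tau> powr \<gamma> \<le> 1" if "0 < \<tau>" "\<tau> \<le> \<tau>0" for \<tau>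
    proof -
      have "\<tau> powr \<gamma> \<le> ((1 / (E + 1)) powr (1 / \<gamma>)) powr \<gamma>"
        using that assms(4) by (intro powr_mono2) (auto simp: \<tau>0_def)
      also have "\<dots> = 1 / (E + 1)" using assms(4) E by (simp add: powr_powr)
      finally have "E * \<tau> powr \<gamma> \<le> E * (1 / (E + 1))" using E by (intro mult_left_mono) auto
      also have "\<dots> \<le> 1" using E by simp
      finally show ?thesis .
    qed
    show ?thesis
      unfolding convergent_def
    proof (rule exI[of _ E], intro allI impI, rule exI[of _ \<tau>0], intro conjI allI impI \<tau>0)
      fix u :: "real \<Rightarrow> real ^ 'd \<Rightarrow> complex" and \<tau> n
      assume mild: "mild_nls_solution p \<mu> (r + \<gamma>) T u" and M: "\<forall>t\<in>{0..T}. sobolev_norm (r + \<gamma>) (u t) \<le> M"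
        and *: "0 < \<tau> \<and> \<tau> \<le> \<tau>0 \<and> real n * \<tau> \<le> T"
      have \<tau>: "0 < \<tau>" "\<tau> \<le> 1" "\<tau> \<le> \<tau>0" using * by (auto simp: \<tau>0_def)
      have u: "u t \<in> sobolev (r + \<gamma>)" if "t \<in> {0..T}" for t
        using mild that by (simp add: mild_nls_solution_def)
      define U where "U t = continuous_rep (u t)" for t
      have U: "sobolev_le r M (U t)" if "t \<in> {0..T}" for t
        unfolding U_def
        by (rule sobolev_le_order[OF sobolev_imp_continuous_rep(1)[OF r\<gamma> u[OF that] M[rule_format, OF that]]])
          (use assms(4) in simp)
      define Z where "Z = integrator p \<mu> \<tau> (U 0)"
      \<comment> \<open>A solution of the recursive inequality \<open>e (n + 1) \<ge> (1 + L \<tau>) e n + C \<tau>\<^sup>1\<^sup>+\<^sup>\<gamma>\<close> with \<open>e 0 = 0\<close>.\<close>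
      define e where "e n = real n * \<tau> * (1 + L * \<tau>) ^ n * (C * \<tau> powr \<gamma>)" for n
      have e: "e n \<le> E * \<tau> powr \<gamma>" if "real n * \<tau> \<le> T" for n
      proof -
        have "(1 + L * \<tau>) ^ n \<le> exp (L * \<tau>) ^ n"
          using L \<tau> by (intro power_mono) (auto simp: exp_ge_add_one_self)
        also have "\<dots> = exp (L * (real n * \<tau>))" by (simp add: mult_ac flip: exp_of_nat_mult)
        also have "\<dots> \<le> exp (L * T)" using L that by (simp add: mult_left_mono)
        finally have "real n * \<tau> * (1 + L * \<tau>) ^ n \<le> T * exp (L * T)"
          using that \<tau> L assms(2) by (intro mult_mono) auto
        then have "real n * \<tau> * (1 + L * \<tau>) ^ n * (C * \<tau> powr \<gamma>) \<le> T * exp (L * T) * (C * \<tau> powr \<gamma>)"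
          using C by (intro mult_right_mono) auto
        then show ?thesis by (simp add: e_def E_def mult.assoc)
      qed
      \<comment> \<open>The bound keeps the numerical solution in the ball of radius \<open>M + 1\<close>, in which \<open>L\<close> is valid.\<close>
      have error: "sobolev_le r (e n) (\<lambda>x. U (real n * \<tau>) x - Z n x)" if "real n * \<tau> \<le> T" for n
        using that
      proof (induction n)
        case 0
        have "sobolev_le r 0 (\<lambda>_ :: real ^ 'd. 0)"
          using sobolev_le_cmult[OF sobolev_le_one, of r 0] by simp
        then show ?case by (simp add: e_def Z_def)
      next
        case (Suc n)
        define t where "t = real n * \<tau>"
        have t: "0 \<le> t" "t + \<tau> \<le> T" "real (Suc n) * \<tau> = t + \<tau>" "t \<le> T"
          using Suc.prems \<tau> by (auto simp: t_def algebra_simps)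
        have IH: "sobolev_le r (e n) (\<lambda>x. U t x - Z n x)" using Suc.IH t by (simp add: t_def)
        have Ut: "sobolev_le r M (U t)" using t by (intro U) auto
        have en: "e n \<le> 1" using e[of n] small[of \<tau>] \<tau> t by (simp add: t_def)
        have "sobolev_le r (M + e n) (\<lambda>x. U t x - (U t x - Z n x))" by (rule sobolev_le_diff[OF Ut IH])
        then have Zn: "sobolev_le r (M + 1) (Z n)" using en sobolev_le_mono by fastforce
        have "sobolev_le r (\<tau> * (C * \<tau> powr \<gamma>) + (1 + L * \<tau>) * e n)
           (\<lambda>x. (U (t + \<tau>) x - integrator_step p \<mu> \<tau> (U t) x)
             + (integrator_step p \<mu> \<tau> (U t) x - integrator_step p \<mu> \<tau> (Z n) x))"
          using \<tau> Ut by (intro sobolev_le_add L(2) IH Zn C(2)[OF mild M t(1) \<tau>(1,2) t(2), folded U_def])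
            (auto intro: sobolev_le_mono)
        then have "sobolev_le r (\<tau> * (C * \<tau> powr \<gamma>) + (1 + L * \<tau>) * e n) (\<lambda>x. U (real (Suc n) * \<tau>) x - Z (Suc n) x)"
          by (simp only: t(3)) (simp add: Z_def)
        moreover have "\<tau> * (C * \<tau> powr \<gamma>) + (1 + L * \<tau>) * e n \<le> e (Suc n)"
        proof -
          have "1 \<le> (1 + L * \<tau>) ^ Suc n" using L \<tau> by (intro one_le_power) simp
          then have "\<tau> * (C * \<tau> powr \<gamma>) * 1 \<le> \<tau> * (C * \<tau> powr \<gamma>) * (1 + L * \<tau>) ^ Suc n"
            using C \<tau> by (intro mult_left_mono) auto
          then show ?thesis by (simp add: e_def algebra_simps)
        qed
        ultimately show ?case by (rule sobolev_le_mono)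
      qed
      let ?D = "\<lambda>x. u (real n * \<tau>) x - integrator p \<mu> \<tau> (u 0) n x"
      have n: "real n * \<tau> \<in> {0..T}" and "0 \<in> {0..T}" using * assms(2) by auto
      have "?D \<in> L2_torus \<and> weighted_l2_le r (E * \<tau> powr \<gamma>) (fourier_coeff ?D)"
      proof (cases n)
        case 0
        have zero: "sobolev_le r 0 (\<lambda>_ :: real ^ 'd. 0)"
          using sobolev_le_cmult[OF sobolev_le_one, of r 0] by simp
        have "(\<lambda>_ :: real ^ 'd. 0) \<in> L2_torus"
          by (simp add: L2_torus_def torus_periodic_def absolutely_integrable_on_def integrable_0)
        then show ?thesis
          using 0 sobolev_le_fourier_coeff(1)[OF sobolev_le_mono[OF zero, of "E * \<tau> powr \<gamma>"]] E by simp
      next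
        case (Suc m)
        \<comment> \<open>The first step already maps to the continuous representative.\<close>
        obtain N\<^sub>0 where "negligible N\<^sub>0" "\<forall>x\<in>torus_cell - N\<^sub>0. u 0 x = U 0 x"
          using sobolev_imp_continuous_rep(3)[OF r\<gamma> u[OF \<open>0 \<in> {0..T}\<close>] order_refl] unfolding U_def by blast
        then have step: "integrator_step p \<mu> \<tau> (u 0) = integrator_step p \<mu> \<tau> (U 0)"
          by (intro integrator_step_cong) auto
        have "integrator p \<mu> \<tau> (u 0) (Suc m) = Z (Suc m)"
          unfolding Z_def by (induction m) (simp_all add: step)
        then have D: "?D = (\<lambda>x. u (real n * \<tau>) x - Z n x)" using Suc by simp
        have err: "sobolev_le r (e n) (\<lambda>x. U (real n * \<tau>) x - Z n x)" using error * by blast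
        have "sobolev_le r (M + e n) (\<lambda>x. U (real n * \<tau>) x - (U (real n * \<tau>) x - Z n x))"
          by (rule sobolev_le_diff[OF U[OF n] err])
        then have Zn: "sobolev_le r (M + e n) (Z n)" by simp
        obtain N where N: "negligible N" "\<forall>x\<in>torus_cell - N. u (real n * \<tau>) x = U (real n * \<tau>) x"
          using sobolev_imp_continuous_rep(3)[OF r\<gamma> u[OF n] order_refl] unfolding U_def by blast
        have "fourier_coeff ?D = fourier_coeff (\<lambda>x. U (real n * \<tau>) x - Z n x)"
          unfolding D by (rule fourier_coeff_cong_negligible[OF N(1)]) (use N(2) in auto)
        moreover have "weighted_l2_le r (E * \<tau> powr \<gamma>) (fourier_coeff (\<lambda>x. U (real n * \<tau>) x - Z n x))"
          using err e[of n] * by (intro sobolev_le_fourier_coeff(1) sobolev_le_mono[OF err]) auto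
        moreover have "?D \<in> L2_torus"
          unfolding D using u[OF n] by (intro L2_torus_diff[OF _ Zn]) (simp add: sobolev_def)
        ultimately show ?thesis by simp
      qed
      then have D: "?D \<in> L2_torus" "weighted_l2_le r (E * \<tau> powr \<gamma>) (fourier_coeff ?D)" by simp_all
      show "?D \<in> sobolev r" by (rule sobolev_normI(1)[OF D])
      show "sobolev_norm r ?D \<le> E * \<tau> powr \<gamma>" by (rule sobolev_normI(2)[OF D])
    qed
  qed
  then obtain C where C: "\<And>M. convergent M (C M)" by metis
  show ?thesis
  proof (intro exI[of _ C] allI impI)
    fix u :: "real \<Rightarrow> real ^ 'd \<Rightarrow> complex" assume mild: "mild_nls_solution p \<mu> (r + \<gamma>) T u"
    then have "bdd_above ((\<lambda>t. sobolev_norm (r + \<gamma>) (u t)) ` {0..T})" by (simp add: mild_nls_solution_def)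
    then have "\<forall>t\<in>{0..T}. sobolev_norm (r + \<gamma>) (u t) \<le> (SUP t\<in>{0..T}. sobolev_norm (r + \<gamma>) (u t))"
      by (auto intro: cSUP_upper)
    from C[unfolded convergent_def, THEN spec, THEN mp, THEN mp, OF mild this] show "\<exists>\<tau>0>0. \<forall>\<tau> n. 0 < \<tau> \<and> \<tau> \<le> \<tau>0 \<and> real n * \<tau> \<le> T \<longrightarrow>
      (\<lambda>x. u (real n * \<tau>) x - integrator p \<mu> \<tau> (u 0) n x) \<in> sobolev r \<and>
      sobolev_norm r (\<lambda>x. u (real n * \<tau>) x - integrator p \<mu> \<tau> (u 0) n x)
        \<le> C (SUP t\<in>{0..T}. sobolev_norm (r + \<gamma>) (u t)) * \<tau> powr \<gamma>" .
  qed
qed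

end
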